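(* Let $R$ be a Cohen-Macaulay ring containing an infinite field $k$ and let $I$ be a $0$-dimensional ideal of height $d>0$ having a reduction generated by a regular sequence $\underline{\alpha}$. Assume that $\mathrm{char}\,k=0$ or $\mathrm{char}\,k>r_{(\underline{\alpha})}(I)$. Then for every $t\ge r_{(\underline{\alpha})}(I)$, $$\mathrm{core}(I)=(\underline{\alpha})^{t+1}:I^t=(\underline{\alpha}^{t+1}):I^{dt}=(\underline{\alpha}^{t+1}):(I^{dt},\underline{\alpha}^{t+1}).$$
   Context: All rings are commutative and Noetherian. An ideal $I$ is $0$-dimensional if $\dim R/I=0$. A subideal $J$ of an ideal $I$ is a reduction of $I$ if $I^{r+1}=JI^r$ for some integer $r\ge 0$; the reduction number $r_J(I)$ is the smallest such $r$. $\mathrm{core}(I)$ is the intersection of all reductions of $I$. For a sequence $\underline{\alpha}=\alpha_1,\ldots,\alpha_s$ and a positive integer $t$, $\underline{\alpha}^t$ denotes the sequence $\alpha_1^t,\ldots,\alpha_s^t$, so $(\underline{\alpha}^t)=(\alpha_1^t,\ldots,\alpha_s^t)$, whereas $(\underline{\alpha})^t$ is the $t$-th power of the ideal $(\underline{\alpha})$. *)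

theory Defs
  imports "HOL-Algebra.Ideal_Product" "HOL-Algebra.Ring_Divisibility" "HOL-Algebra.Subrings"
    "HOL-Library.Extended_Real"
begin

text \<open>Powers of ideals are taken in the library's semiring of ideals of \<open>R\<close>, so that
  \<open>I\<^sup>0 = R\<close>.\<close>

abbreviation ideal_power :: "('a, 'b) ring_scheme \<Rightarrow> 'a set \<Rightarrow> nat \<Rightarrow> 'a set" where
  "ideal_power R I n \<equiv> I [^]\<^bsub>ideals_set R\<^esub> n"

definition ideal_colon :: "('a, 'b) ring_scheme \<Rightarrow> 'a set \<Rightarrow> 'a set \<Rightarrow> 'a set" where
  "ideal_colon R A B = {x \<in> carrier R. \<forall>b\<in>B. x \<otimes>\<^bsub>R\<^esub> b \<in> A}"


section \<open>Reductions and the core\<close>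

definition is_reduction :: "('a, 'b) ring_scheme \<Rightarrow> 'a set \<Rightarrow> 'a set \<Rightarrow> bool" where
  "is_reduction R J I \<longleftrightarrow> ideal J R \<and> J \<subseteq> I \<and>
     (\<exists>r. ideal_power R I (r + 1) = J \<cdot>\<^bsub>R\<^esub> ideal_power R I r)"

definition reduction_number :: "('a, 'b) ring_scheme \<Rightarrow> 'a set \<Rightarrow> 'a set \<Rightarrow> nat" where
  "reduction_number R J I =
     (LEAST r. ideal_power R I (r + 1) = J \<cdot>\<^bsub>R\<^esub> ideal_power R I r)"

definition ideal_core :: "('a, 'b) ring_scheme \<Rightarrow> 'a set \<Rightarrow> 'a set" where
  "ideal_core R I = \<Inter> {J. is_reduction R J I}"


section \<open>Dimension, height, characteristic\<close>

definition prime_chain :: "('a, 'b) ring_scheme \<Rightarrow> (nat \<Rightarrow> 'a set) \<Rightarrow> nat \<Rightarrow> bool" where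
  "prime_chain R P n \<longleftrightarrow> (\<forall>i\<le>n. primeideal (P i) R) \<and> (\<forall>i<n. P i \<subset> P (Suc i))"

text \<open>The suprema are taken in \<^typ>\<open>ereal\<close>, so that the zero ring has dimension \<open>-\<infinity>\<close>; in
  particular \<open>krull_dim (R Quot I) = 0\<close> forces \<open>I\<close> to be a proper ideal.\<close>

definition krull_dim :: "('a, 'b) ring_scheme \<Rightarrow> ereal" where
  "krull_dim R = (SUP n \<in> {n. \<exists>P. prime_chain R P n}. ereal (real n))"

definition prime_height :: "('a, 'b) ring_scheme \<Rightarrow> 'a set \<Rightarrow> ereal" where
  "prime_height R p = (SUP n \<in> {n. \<exists>P. prime_chain R P n \<and> P n = p}. ereal (real n))"

definition ideal_height :: "('a, 'b) ring_scheme \<Rightarrow> 'a set \<Rightarrow> ereal" where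
  "ideal_height R I = (INF p \<in> {p. primeideal p R \<and> I \<subseteq> p}. prime_height R p)"

definition ring_char :: "('a, 'b) ring_scheme \<Rightarrow> nat" where
  "ring_char R =
     (if \<exists>n::nat. n > 0 \<and> [n] \<cdot>\<^bsub>R\<^esub> \<one>\<^bsub>R\<^esub> = \<zero>\<^bsub>R\<^esub>
      then LEAST n::nat. n > 0 \<and> [n] \<cdot>\<^bsub>R\<^esub> \<one>\<^bsub>R\<^esub> = \<zero>\<^bsub>R\<^esub> else 0)"


section \<open>Regular sequences\<close>

text \<open>The second conjunct says that the class of \<open>xs ! i\<close> is a nonzerodivisor on
  \<open>R / (xs ! 0, \<dots>, xs ! (i - 1))\<close>, the third that \<open>R / (xs) \<noteq> 0\<close>.\<close>

definition regular_sequence :: "('a, 'b) ring_scheme \<Rightarrow> 'a list \<Rightarrow> bool" where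
  "regular_sequence R xs \<longleftrightarrow> set xs \<subseteq> carrier R \<and>
     (\<forall>i<length xs. \<forall>r\<in>carrier R.
        xs ! i \<otimes>\<^bsub>R\<^esub> r \<in> genideal R (set (take i xs)) \<longrightarrow> r \<in> genideal R (set (take i xs))) \<and>
     genideal R (set xs) \<noteq> carrier R"

definition ideal_grade :: "('a, 'b) ring_scheme \<Rightarrow> 'a set \<Rightarrow> ereal" where
  "ideal_grade R J =
     (SUP xs \<in> {xs. regular_sequence R xs \<and> set xs \<subseteq> J}. ereal (real (length xs)))"


section \<open>Localization\<close>

definition fraction_rel ::
    "('a, 'b) ring_scheme \<Rightarrow> 'a set \<Rightarrow> (('a \<times> 'a) \<times> ('a \<times> 'a)) set" where
  "fraction_rel R S = {((a, s), (b, t)). a \<in> carrier R \<and> s \<in> S \<and> b \<in> carrier R \<and> t \<in> S \<and>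
     (\<exists>u\<in>S. u \<otimes>\<^bsub>R\<^esub> (a \<otimes>\<^bsub>R\<^esub> t \<ominus>\<^bsub>R\<^esub> b \<otimes>\<^bsub>R\<^esub> s) = \<zero>\<^bsub>R\<^esub>)}"

definition fraction :: "('a, 'b) ring_scheme \<Rightarrow> 'a set \<Rightarrow> 'a \<Rightarrow> 'a \<Rightarrow> ('a \<times> 'a) set" where
  "fraction R S a s = fraction_rel R S `` {(a, s)}"

text \<open>The unions below run over all representatives of the classes \<open>C\<close> and \<open>D\<close>; for
  multiplicatively closed \<open>S\<close> all members of each union coincide.\<close>

definition localization :: "('a, 'b) ring_scheme \<Rightarrow> 'a set \<Rightarrow> ('a \<times> 'a) set ring" where
  "localization R S =
     \<lparr>carrier = (carrier R \<times> S) // fraction_rel R S,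
      monoid.mult = (\<lambda>C D. \<Union>(a, s)\<in>C. \<Union>(b, t)\<in>D. fraction R S (a \<otimes>\<^bsub>R\<^esub> b) (s \<otimes>\<^bsub>R\<^esub> t)),
      one = fraction R S \<one>\<^bsub>R\<^esub> \<one>\<^bsub>R\<^esub>,
      zero = fraction R S \<zero>\<^bsub>R\<^esub> \<one>\<^bsub>R\<^esub>,
      add = (\<lambda>C D. \<Union>(a, s)\<in>C. \<Union>(b, t)\<in>D.
               fraction R S (a \<otimes>\<^bsub>R\<^esub> t \<oplus>\<^bsub>R\<^esub> b \<otimes>\<^bsub>R\<^esub> s) (s \<otimes>\<^bsub>R\<^esub> t))\<rparr>"


section \<open>Cohen-Macaulay rings\<close>

definition cohen_macaulay_local :: "('a, 'b) ring_scheme \<Rightarrow> bool" where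
  "cohen_macaulay_local A \<longleftrightarrow> cring A \<and> noetherian_ring A \<and>
     (\<exists>m. {n. maximalideal n A} = {m} \<and> ideal_grade A m = krull_dim A)"

definition cohen_macaulay :: "('a, 'b) ring_scheme \<Rightarrow> bool" where
  "cohen_macaulay R \<longleftrightarrow> cring R \<and> noetherian_ring R \<and>
     (\<forall>m. maximalideal m R \<longrightarrow> cohen_macaulay_local (localization R (carrier R - m)))"

end

(*
  The computation takes place in a commutative ring of class comm_ring_1, modulo a base ideal k: a
  given ring R with an explicit carrier is the quotient of the free commutative ring on its elements
  by the kernel k of the evaluation map. Localizing at 1 + I is replaced by the closure operator cl,
  which makes regular sequences in I permutable, by Krull's intersection theorem.

  Inclusion of J^(t+1) : I^t in every reduction L. For a list xs of generators of J and T = t + 1,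
  the colon ideal equals (xs^T) : I^(dt). If a reduction (D, a) is changed to a reduction (D, b),
  then a^T M and b^T M agree modulo D^T, where M = I^(dt); since a^T is regular modulo D^T, the colon
  ideal (D^T, a^T) : M is contained in (D^T, b^T) : M. Because the ground field is infinite and
  R / I^n is Artinian, b can be chosen in L, and after d exchanges all generators lie in L.

  Inclusion of the core in J^(t+1) : I^t. Modulo general linear forms in the generators only one
  generator a remains. For y in I and almost all u in the field, a + u y again generates a reduction,
  and an element x of the core lies in all the ideals (a + u y). Multiplying these together gives
  x (a, y)^(N-1) <= (prod (a + u y)), and since y is integral over (a) this yields
  x y^r <= (a^(r+1)). Varying the linear forms gives x y^r in J^(r+1), and the assumption on the
  characteristic allows polarization to x I^r <= J^(r+1).
*)
theory Submission
  imports Defs HOL.Modules "HOL-Library.Set_Algebras" "HOL-Library.Poly_Mapping"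
    "HOL-Library.Multiset" "HOL-Algebra.QuotRing"
begin

section \<open>Ideals of a commutative ring modulo a base ideal\<close>

text \<open>R need not be local, so a regular sequence cannot simply be permuted, while the exchange
  must reach every generator. The closure costs nothing in the end: it fixes every ideal above
  \<open>k\<close> that contains a power of I, such as the reductions, the powers of J and (xs^T).

  R / I may have several maximal ideals, so genericity is not argued with open sets over one residue
  field. Instead a pencil b + u b' is studied in a single degree of the associated graded ring: the
  torsion submodules of its members are independent modulo the torsion common to b and b', so by
  Noetherianity only finitely many members have torsion outside that common part. An element without
  torsion acts injectively, and finite length turns this into surjectivity, the reduction equation.

  The two colon ideals are linked by the self-duality of a polynomial ring in d variables modulo
  their (t+1)st powers: the socle has degree d t, and forms of degrees n and d t - n are paired
  perfectly.

  The characteristic is compared with r, not t, because polarization is done in degree r; I^t =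
  J^(t-r) I^r, up to closure, then passes to t.\<close>

interpretation idl: Modules.module "(*) :: 'a::comm_ring_1 \<Rightarrow> 'a \<Rightarrow> 'a"
  by standard (auto simp: algebra_simps)

declare idl.scale_scale [simp del]

lemma span_times:
  assumes "x \<in> idl.span A" "y \<in> idl.span B"
  shows "x * y \<in> idl.span (A * B)"
  using assms(1)
proof (induction rule: idl.span_induct_alt)
  case (step c a x)
  have "a * y \<in> idl.span (A * B)"
    using assms(2)
  proof (induction rule: idl.span_induct_alt)
    case (step d b y)
    have "a * b \<in> A * B" using \<open>a \<in> A\<close> step by auto
    then have "d * (a * b) \<in> idl.span (A * B)" by (intro idl.span_scale idl.span_base)
    then have "d * (a * b) + a * y \<in> idl.span (A * B)" using step by (intro idl.span_add)
    then show ?case by (simp add: algebra_simps)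
  qed (simp add: idl.span_zero)
  then have "c * (a * y) + x * y \<in> idl.span (A * B)"
    using step by (simp add: idl.span_add idl.span_scale)
  then show ?case by (simp add: algebra_simps)
qed (simp add: idl.span_zero)

lemma times_span: "idl.span A * idl.span B \<subseteq> idl.span (A * B)"
  by (auto elim!: set_times_elim intro: span_times)

lemma span_power_subset: "idl.span A ^ n \<subseteq> idl.span (A ^ n)"
proof (induction n)
  case (Suc n)
  have "idl.span A ^ Suc n \<subseteq> idl.span A * idl.span (A ^ n)"
    using set_times_mono2[OF order_refl Suc, of "idl.span A"] by simp
  then show ?case using times_span[of A "A ^ n"] by auto
qed (simp add: idl.span_base)

lemma set_power_mono: "A \<subseteq> B \<Longrightarrow> A ^ n \<subseteq> (B ^ n :: 'a::comm_monoid_mult set)"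
  by (induction n) (simp_all add: set_times_mono2)

lemma in_set_power: "x \<in> A \<Longrightarrow> x ^ n \<in> (A ^ n :: 'a::comm_monoid_mult set)"
  by (induction n) auto

lemma ideal_power_antimono:
  assumes "idl.subspace I" "m \<le> n"
  shows "idl.span (I ^ n) \<subseteq> idl.span (I ^ m)"
proof -
  have "I ^ m * I ^ (n - m) \<subseteq> idl.span (I ^ m)"
    by (auto elim!: set_times_elim) (metis idl.span_base idl.span_scale mult.commute)
  moreover have "I ^ n = I ^ m * I ^ (n - m)" using assms(2) by (simp flip: power_add)
  ultimately show ?thesis by (simp add: idl.span_minimal)
qed

lemma ideal_times_subset:
  fixes I :: "'a::comm_ring_1 set"
  shows "idl.subspace I \<Longrightarrow> I * X \<subseteq> I" and "idl.subspace I \<Longrightarrow> X * I \<subseteq> I"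
  by (auto elim!: set_times_elim simp: idl.subspace_scale) (metis idl.subspace_scale mult.commute)

lemma ideal_multL: "idl.subspace I \<Longrightarrow> x \<in> I \<Longrightarrow> x * (c::'a::comm_ring_1) \<in> I"
  by (metis idl.subspace_scale mult.commute)

lemma span_multL: "x \<in> idl.span X \<Longrightarrow> x * c \<in> idl.span X"
  by (simp add: ideal_multL)

definition prime_idl :: "'a::comm_ring_1 set \<Rightarrow> bool" where
  "prime_idl P \<longleftrightarrow> idl.subspace P \<and> 1 \<notin> P \<and> (\<forall>a b. a * b \<in> P \<longrightarrow> a \<in> P \<or> b \<in> P)"

definition mult_closed :: "'a::comm_ring_1 set \<Rightarrow> bool" where
  "mult_closed S \<longleftrightarrow> 1 \<in> S \<and> (\<forall>a\<in>S. \<forall>b\<in>S. a * b \<in> S)"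

text \<open>The quotient by \<open>k\<close> is Noetherian. The condition is put on the ideals above
  \<open>k\<close> because the ambient ring, a free commutative ring in possibly infinitely many
  variables, need not be Noetherian itself.\<close>

locale noeth_mod =
  fixes k :: "'a::comm_ring_1 set"
  assumes k_ideal: "idl.subspace k"
    and finitely_generated: "\<And>A. idl.subspace A \<Longrightarrow> k \<subseteq> A \<Longrightarrow> \<exists>F. finite F \<and> A = idl.span (F \<union> k)"
begin

lemma chain_stable:
  assumes "\<And>n. idl.subspace (f n)" "\<And>n. k \<subseteq> f n" "\<And>n. f n \<subseteq> f (Suc n)"
  shows "\<exists>n. \<forall>m\<ge>n. f m = f n"
proof -
  have mono: "f m \<subseteq> f n" if "m \<le> n" for m n
    using lift_Suc_mono_le[where f = f, OF _ that] assms(3) by simp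
  have "idl.subspace (\<Union>n. f n)"
  proof (rule idl.subspaceI)
    fix x y assume "x \<in> (\<Union>n. f n)" "y \<in> (\<Union>n. f n)"
    then obtain m n where "x \<in> f m" "y \<in> f n" by auto
    then have "x \<in> f (max m n)" "y \<in> f (max m n)" using mono[of m "max m n"] mono[of n "max m n"] by auto
    then have "x + y \<in> f (max m n)" using assms(1) by (simp add: idl.subspace_add)
    then show "x + y \<in> (\<Union>n. f n)" by blast
  next
    show "0 \<in> (\<Union>n. f n)" using idl.subspace_0[OF assms(1)] by auto
    show "c * x \<in> (\<Union>n. f n)" if "x \<in> (\<Union>n. f n)" for c x
      using that idl.subspace_scale[OF assms(1)] by auto
  qed
  moreover have "k \<subseteq> (\<Union>n. f n)" using assms(2) by auto
  ultimately obtain F where F: "finite F" "(\<Union>n. f n) = idl.span (F \<union> k)"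
    using finitely_generated by meson
  have "F \<subseteq> (\<Union>n. f n)" unfolding F(2) using idl.span_superset[of "F \<union> k"] by simp
  then have "\<forall>x\<in>F. \<exists>n. x \<in> f n" by auto
  then obtain h where h: "\<And>x. x \<in> F \<Longrightarrow> x \<in> f (h x)" by metis
  define n where "n = Max (insert 0 (h ` F))"
  have "h x \<le> n" if "x \<in> F" for x using that F(1) by (simp add: n_def)
  then have "F \<subseteq> f n" using h mono[of _ n] by (meson subsetD subsetI)
  then have "(\<Union>n. f n) \<subseteq> f n" unfolding F(2) using assms(1,2) by (simp add: idl.span_minimal)
  then have "f m = f n" if "m \<ge> n" for m using mono[OF that] by blast
  then show ?thesis by blast
qed

lemma ex_maximal:
  assumes "\<F> \<noteq> {}" "\<And>A. A \<in> \<F> \<Longrightarrow> idl.subspace A \<and> k \<subseteq> A"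
  shows "\<exists>M\<in>\<F>. \<forall>A\<in>\<F>. M \<subseteq> A \<longrightarrow> A = M"
proof (rule ccontr)
  assume "\<not> ?thesis"
  then have "\<forall>M\<in>\<F>. \<exists>A\<in>\<F>. M \<subset> A" by blast
  then obtain g where g: "\<And>M. M \<in> \<F> \<Longrightarrow> g M \<in> \<F> \<and> M \<subset> g M" by metis
  obtain A where A: "A \<in> \<F>" using assms(1) by blast
  define f where "f n = (g ^^ n) A" for n
  have f: "f n \<in> \<F>" for n by (induction n) (use A g in \<open>auto simp: f_def\<close>)
  have inc: "f n \<subset> f (Suc n)" for n using g[OF f[of n]] by (simp add: f_def)
  have "\<exists>n. \<forall>m\<ge>n. f m = f n"
    by (rule chain_stable) (simp_all add: f assms(2) psubset_imp_subset[OF inc])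
  then obtain n where "f (Suc n) = f n" by (meson le_Suc_eq order_refl)
  then show False using inc[of n] by simp
qed

text \<open>An ideal that is maximal among those above \<open>A\<close> missing \<open>S\<close> is
  prime: if \<open>a\<close> and \<open>b\<close> are outside it, adding either one makes it meet
  \<open>S\<close>, and the product of the two elements of \<open>S\<close> found in this way would
  lie in it as soon as \<open>a * b\<close> does.\<close>

lemma ex_prime_disjoint:
  assumes "idl.subspace A" "k \<subseteq> A" "mult_closed S" "A \<inter> S = {}"
  shows "\<exists>P. prime_idl P \<and> A \<subseteq> P \<and> P \<inter> S = {}"
proof -
  let ?F = "{B. idl.subspace B \<and> A \<subseteq> B \<and> B \<inter> S = {}}"
  have "A \<in> ?F" using assms by simp
  then have "?F \<noteq> {}" by blast
  moreover have "idl.subspace B \<and> k \<subseteq> B" if "B \<in> ?F" for B using that assms(2) by auto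
  ultimately obtain P where P: "P \<in> ?F" "\<And>B. B \<in> ?F \<Longrightarrow> P \<subseteq> B \<Longrightarrow> B = P"
    using ex_maximal[of ?F] by meson
  have meets: "\<exists>s c. s \<in> S \<and> s - c * x \<in> P" if "x \<notin> P" for x
  proof -
    have "idl.span (insert x P) \<notin> ?F"
      using P(2)[of "idl.span (insert x P)"] that idl.span_superset[of "insert x P"] by auto
    then have "idl.span (insert x P) \<inter> S \<noteq> {}"
      using P(1) idl.span_superset[of "insert x P"] by auto
    then obtain s where "s \<in> S" "s \<in> idl.span (insert x P)" by blast
    moreover have "idl.span P = P" using P(1) by simp
    ultimately show ?thesis using idl.span_breakdown_eq[of s x P] by auto
  qed
  have "prime_idl P" unfolding prime_idl_def
  proof (intro conjI allI impI)
    show "1 \<notin> P" using P(1) assms(3) by (auto simp: mult_closed_def)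
    fix a b assume ab: "a * b \<in> P"
    show "a \<in> P \<or> b \<in> P"
    proof (rule ccontr)
      assume "\<not> ?thesis"
      then obtain s c s' c' where s: "s \<in> S" "s - c * a \<in> P" "s' \<in> S" "s' - c' * b \<in> P"
        using meets by metis
      have "(s - c * a) * s' + (s' - c' * b) * (c * a) + (c * c') * (a * b) \<in> P"
        by (intro idl.subspace_add ideal_multL[OF _ s(2)] ideal_multL[OF _ s(4)] idl.subspace_scale[OF _ ab])
          (use P(1) in auto)
      also have "(s - c * a) * s' + (s' - c' * b) * (c * a) + (c * c') * (a * b) = s * s'"
        by (simp add: algebra_simps)
      finally show False using s(1,3) P(1) assms(3) by (auto simp: mult_closed_def)
    qed
  qed (use P in auto)
  then show ?thesis using P by auto
qed

end

section \<open>Pigeonhole principle, Nakayama, Krull intersection\<close>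

declare set_one [simp del]

section \<open>Monomials in a finite set of generators\<close>

lemma set_power_insert:
  fixes a :: "'a::comm_monoid_mult"
  assumes "y \<in> insert a X ^ n"
  shows "\<exists>i\<le>n. \<exists>x\<in>X ^ (n - i). y = a ^ i * x"
  using assms
proof (induction n arbitrary: y)
  case (Suc n)
  then obtain u v where uv: "y = u * v" "u \<in> insert a X" "v \<in> insert a X ^ n"
    by (auto elim: set_times_elim)
  then obtain i x where ix: "i \<le> n" "x \<in> X ^ (n - i)" "v = a ^ i * x" using Suc.IH by blast
  show ?case
  proof (cases "u = a")
    case True
    then show ?thesis using ix uv by (intro exI[of _ "Suc i"]) (auto simp: ac_simps)
  next
    case False
    then have "u * x \<in> X ^ (Suc n - i)" using ix uv by (auto simp: Suc_diff_le)
    then show ?thesis using ix uv by (intro exI[of _ i] conjI bexI[of _ "u * x"]) (auto simp: ac_simps)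
  qed
qed simp

lemma span_times_subset:
  assumes "\<And>x y. x \<in> X \<Longrightarrow> y \<in> Y \<Longrightarrow> x * y \<in> idl.span Z" "u \<in> idl.span X" "v \<in> idl.span Y"
  shows "u * v \<in> idl.span Z"
proof -
  have "X * Y \<subseteq> idl.span Z" using assms(1) by (auto elim!: set_times_elim)
  then have "idl.span (X * Y) \<subseteq> idl.span Z" by (simp add: idl.span_minimal)
  then show ?thesis using span_times[OF assms(2,3)] by blast
qed

text \<open>Sort the products of t + n factors by the exponent of \<open>a\<close>: more than t
  factors \<open>a\<close> give a multiple of a^(t+1); otherwise n factors from \<open>X\<close> can
  be set aside, and exactly t factors remain.\<close>

lemma span_power_insert:
  fixes a :: "'a::comm_ring_1"
  shows "insert a X ^ (t + n) \<subseteq> idl.span (insert (a ^ Suc t) (X ^ n * insert a X ^ t))"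
proof
  fix y assume "y \<in> insert a X ^ (t + n)"
  then obtain i x where ix: "i \<le> t + n" "x \<in> X ^ (t + n - i)" "y = a ^ i * x"
    using set_power_insert by blast
  show "y \<in> idl.span (insert (a ^ Suc t) (X ^ n * insert a X ^ t))"
  proof (cases "i \<le> t")
    case True
    then have "t + n - i = n + (t - i)" by simp
    then have "X ^ (t + n - i) = X ^ n * X ^ (t - i)" by (simp add: power_add)
    then obtain u v where uv: "x = u * v" "u \<in> X ^ n" "v \<in> X ^ (t - i)"
      using ix(2) by (auto elim: set_times_elim)
    have "a ^ i * v \<in> insert a X ^ i * insert a X ^ (t - i)"
      using uv(3) set_power_mono[of X "insert a X" "t - i"] in_set_power[of a "insert a X" i] by blast
    also have "\<dots> = insert a X ^ t" using True by (simp flip: power_add)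
    finally have "u * (a ^ i * v) \<in> X ^ n * insert a X ^ t" using uv(2) by blast
    moreover have "y = u * (a ^ i * v)" using uv ix by (simp add: ac_simps)
    ultimately show ?thesis by (simp add: idl.span_base)
  next
    case False
    then have "a ^ i = a ^ (i - Suc t) * a ^ Suc t"
      by (metis le_add_diff_inverse2 not_less_eq_eq power_add)
    then have "y = (a ^ (i - Suc t) * x) * a ^ Suc t" using ix by (simp add: ac_simps)
    then show ?thesis using idl.span_scale idl.span_base by (metis insertI1)
  qed
qed

text \<open>Each \<open>d\<close> can occur t times before d^(t+1) appears, so n of the factors must
  come from \<open>Y\<close>. In the induction \<open>d\<close> is first counted with
  \<open>Y\<close>, and \<open>span_power_insert\<close> then separates it. The uses have
  \<open>Y\<close> empty with n = 1, \<open>Y\<close> a single further generator, or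
  \<open>Y\<close> the base ideal.\<close>

lemma span_power_pigeonhole:
  fixes ds :: "'a::comm_ring_1 list"
  shows "(set ds \<union> Y) ^ (length ds * t + n)
    \<subseteq> idl.span ((\<lambda>d. d ^ Suc t) ` set ds \<union> Y ^ n * (set ds \<union> Y) ^ (length ds * t))"
proof (induction ds arbitrary: Y n)
  case (Cons d ds)
  let ?Q = "set (d # ds) \<union> Y" and ?e = "length ds * t"
  let ?Z = "(\<lambda>d. d ^ Suc t) ` set (d # ds) \<union> Y ^ n * ?Q ^ (length (d # ds) * t)"
  have Q: "set ds \<union> insert d Y = ?Q" by auto
  have "u * v \<in> idl.span ?Z" if "u \<in> idl.span (insert (d ^ Suc t) (Y ^ n * insert d Y ^ t))" "v \<in> ?Q ^ ?e" for u v
  proof (rule span_times_subset[OF _ that(1) idl.span_base[OF that(2)]])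
    fix x y assume x: "x \<in> insert (d ^ Suc t) (Y ^ n * insert d Y ^ t)" and y: "y \<in> ?Q ^ ?e"
    show "x * y \<in> idl.span ?Z"
    proof (cases "x = d ^ Suc t")
      case True
      show ?thesis unfolding True by (intro span_multL idl.span_base) simp
    next
      case False
      then obtain p q where pq: "x = p * q" "p \<in> Y ^ n" "q \<in> insert d Y ^ t"
        using x by (auto elim: set_times_elim)
      have "q \<in> ?Q ^ t" using pq(3) set_power_mono[of "insert d Y" ?Q t] by auto
      then have "q * y \<in> ?Q ^ t * ?Q ^ ?e" using y by blast
      also have "\<dots> = ?Q ^ (length (d # ds) * t)" by (simp add: power_add)
      finally have "p * (q * y) \<in> Y ^ n * ?Q ^ (length (d # ds) * t)" using pq(2) by blast
      then show ?thesis using pq(1) by (intro idl.span_base) (simp add: ac_simps)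
    qed
  qed
  then have "insert d Y ^ (t + n) * ?Q ^ ?e \<subseteq> idl.span ?Z"
    using span_power_insert[of d Y t n] by (auto elim!: set_times_elim)
  moreover have "(\<lambda>d. d ^ Suc t) ` set ds \<subseteq> idl.span ?Z" by (auto intro: idl.span_base)
  ultimately have "idl.span ((\<lambda>d. d ^ Suc t) ` set ds \<union> insert d Y ^ (t + n) * ?Q ^ ?e) \<subseteq> idl.span ?Z"
    by (intro idl.span_minimal) auto
  moreover have "?Q ^ (length (d # ds) * t + n) = (set ds \<union> insert d Y) ^ (?e + (t + n))"
    by (simp add: Q ac_simps)
  ultimately show ?case using Cons.IH[of "insert d Y" "t + n"] unfolding Q by blast
qed (simp add: idl.span_superset)

text \<open>Nakayama over the localization at \<open>T\<close>, without fractions: closure of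
  \<open>T\<close> under subtracting elements of \<open>I\<close> says that \<open>I\<close> becomes
  part of the Jacobson radical. Generators are eliminated one at a time instead of by a determinant.
  The uses are \<open>T\<close> = 1 + I and \<open>T\<close> the complement of a prime that plays
  the role of \<open>I\<close>.\<close>

lemma nakayama:
  fixes hs :: "'a::comm_ring_1 list"
  assumes I: "idl.subspace I" and T: "mult_closed T" "\<And>s i. s \<in> T \<Longrightarrow> i \<in> I \<Longrightarrow> s - i \<in> T"
    and "\<And>h. h \<in> set hs \<Longrightarrow> \<exists>s\<in>T. s * h \<in> idl.span (A \<union> I * set hs)"
  shows "\<exists>s\<in>T. \<forall>h\<in>set hs. s * h \<in> idl.span A"
  using assms(4)
proof (induction hs arbitrary: A)
  case Nil
  then show ?case using T(1) by (auto simp: mult_closed_def)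
next
  case (Cons g hs)
  have "A \<union> I * set (g # hs) \<subseteq> idl.span (insert g A \<union> I * set hs)"
    by (auto elim!: set_times_elim intro: idl.span_base idl.span_scale)
  then have "idl.span (A \<union> I * set (g # hs)) \<subseteq> idl.span (insert g A \<union> I * set hs)"
    by (simp add: idl.span_minimal)
  then have "\<exists>s\<in>T. s * h \<in> idl.span (insert g A \<union> I * set hs)" if "h \<in> set hs" for h
    using Cons.prems[of h] that by auto
  from Cons.IH[OF this] obtain s where
    s: "s \<in> T" "\<And>h. h \<in> set hs \<Longrightarrow> s * h \<in> idl.span (insert g A)" by blast
  obtain s0 where s0: "s0 \<in> T" "s0 * g \<in> idl.span (A \<union> I * set (g # hs))"
    using Cons.prems[of g] by auto
  have "s * y \<in> idl.span (A \<union> I * {g})" if y: "y \<in> idl.span (A \<union> I * set (g # hs))" for y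
  proof (rule span_times_subset[OF _ idl.span_base[of s "{s}"] y])
    fix u x assume "u \<in> {s}" "x \<in> A \<union> I * set (g # hs)"
    then consider "x \<in> A" "u = s" | i where "i \<in> I" "x = i * g" "u = s"
      | i h where "i \<in> I" "h \<in> set hs" "x = i * h" "u = s"
      by (auto elim!: set_times_elim)
    then show "u * x \<in> idl.span (A \<union> I * {g})"
    proof cases
      case 1
      then show ?thesis by (simp add: idl.span_base idl.span_scale)
    next
      case 2
      then have "i * g \<in> idl.span (A \<union> I * {g})" by (intro idl.span_base) auto
      then show ?thesis using 2 by (simp add: idl.span_scale)
    next
      case 3
      obtain c where c: "s * h - c * g \<in> idl.span A"
        using s(2)[OF 3(2)] by (auto simp: idl.span_breakdown_eq)
      have "i * (s * h - c * g) \<in> idl.span (A \<union> I * {g})"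
        using c idl.span_mono[of A "A \<union> I * {g}"] by (auto intro: idl.span_scale)
      moreover have "c * (i * g) \<in> idl.span (A \<union> I * {g})"
        using 3 by (intro idl.span_scale idl.span_base) auto
      ultimately have "i * (s * h - c * g) + c * (i * g) \<in> idl.span (A \<union> I * {g})"
        by (rule idl.span_add)
      then show ?thesis using 3 by (simp add: algebra_simps)
    qed
  qed simp
  from this[OF s0(2)] have "s * s0 * g \<in> idl.span (A \<union> I * {g})" by (simp add: ac_simps)
  then obtain x y where xy: "s * s0 * g = x + y" "x \<in> idl.span A" "y \<in> idl.span (I * {g})"
    unfolding idl.span_Un by blast
  have "I * {g} \<subseteq> {i * g |i. i \<in> I}" by (auto elim!: set_times_elim)
  moreover have "idl.subspace {i * g |i. i \<in> I}"
  proof (rule idl.subspaceI)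
    show "0 \<in> {i * g |i. i \<in> I}" using idl.subspace_0[OF I] by force
    fix x y assume "x \<in> {i * g |i. i \<in> I}" "y \<in> {i * g |i. i \<in> I}"
    then obtain i j where "x = i * g" "y = j * g" "i \<in> I" "j \<in> I" by auto
    then show "x + y \<in> {i * g |i. i \<in> I}"
      using idl.subspace_add[OF I, of i j] by (auto intro!: exI[of _ "i + j"] simp: algebra_simps)
  next
    fix c x assume "x \<in> {i * g |i. i \<in> I}"
    then obtain i where "x = i * g" "i \<in> I" by auto
    then show "c * x \<in> {i * g |i. i \<in> I}"
      using idl.subspace_scale[OF I, of i c] by (auto intro!: exI[of _ "c * i"] simp: algebra_simps)
  qed
  ultimately have "idl.span (I * {g}) \<subseteq> {i * g |i. i \<in> I}" by (rule idl.span_minimal)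
  then obtain i where i: "i \<in> I" "y = i * g" using xy by auto
  \<comment> \<open>With the other generators replaced by multiples of \<open>g\<close> modulo
    \<open>A\<close>, s s0 g = x + i g with x in the span of \<open>A\<close>; hence s s0 - i
    carries \<open>g\<close> into that span.\<close>
  define s' where "s' = s * s0 - i"
  have s'g: "s' * g \<in> idl.span A" using xy i by (simp add: s'_def algebra_simps)
  have "s' \<in> T" unfolding s'_def using s(1) s0(1) T(1) by (intro T(2) i) (auto simp: mult_closed_def)
  then have "s' * s \<in> T" using T(1) s(1) by (auto simp: mult_closed_def)
  moreover have "(s' * s) * h \<in> idl.span A" if "h \<in> set (g # hs)" for h
  proof (cases "h = g")
    case True
    then show ?thesis using idl.span_scale[OF s'g, of s] by (simp add: ac_simps)
  next
    case False
    then obtain c where c: "s * h - c * g \<in> idl.span A"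
      using s(2)[of h] \<open>h \<in> set (g # hs)\<close> by (auto simp: idl.span_breakdown_eq)
    have "s' * (s * h - c * g) + c * (s' * g) \<in> idl.span A"
      using c s'g by (simp add: idl.span_add idl.span_scale)
    then show ?thesis by (simp add: algebra_simps)
  qed
  ultimately show ?case by blast
qed

section \<open>The closure belonging to the localization at 1 + I\<close>

locale noeth_pair = noeth_mod k for k :: "'a::comm_ring_1 set" +
  fixes I :: "'a set"
  assumes I_ideal: "idl.subspace I" and k_subset: "k \<subseteq> I"
begin

text \<open>The contraction, from the localization at 1 + I, of the ideal generated by
  \<open>X\<close> and \<open>k\<close>. In that localization \<open>I\<close> lies in the Jacobson
  radical.\<close>

definition cl :: "'a set \<Rightarrow> 'a set" where
  "cl X = {z. \<exists>s. s - 1 \<in> I \<and> s * z \<in> idl.span (X \<union> k)}"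

lemma unit_mult: "s - 1 \<in> I \<Longrightarrow> s' - 1 \<in> I \<Longrightarrow> s * s' - 1 \<in> I"
proof -
  assume "s - 1 \<in> I" "s' - 1 \<in> I"
  then have "s' * (s - 1) + (s' - 1) \<in> I" using I_ideal by (simp add: idl.subspace_add idl.subspace_scale)
  then show ?thesis by (simp add: algebra_simps)
qed

lemma span_in_cl: "z \<in> idl.span (X \<union> k) \<Longrightarrow> z \<in> cl X"
  using idl.subspace_0[OF I_ideal] by (auto simp: cl_def intro!: exI[of _ 1])

lemma cl_base: "z \<in> X \<Longrightarrow> z \<in> cl X" and cl_k: "z \<in> k \<Longrightarrow> z \<in> cl X"
  by (simp_all add: span_in_cl idl.span_base)

lemma cl_span: "z \<in> idl.span X \<Longrightarrow> z \<in> cl X"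
  using idl.span_mono[of X "X \<union> k"] by (intro span_in_cl) blast

lemma cl_ideal: "idl.subspace (cl X)"
proof (rule idl.subspaceI)
  show "0 \<in> cl X" by (rule span_in_cl) (rule idl.span_zero)
  fix x y assume "x \<in> cl X" "y \<in> cl X"
  then obtain s s' where s: "s - 1 \<in> I" "s * x \<in> idl.span (X \<union> k)"
    "s' - 1 \<in> I" "s' * y \<in> idl.span (X \<union> k)" by (auto simp: cl_def)
  have "s' * (s * x) + s * (s' * y) \<in> idl.span (X \<union> k)"
    using s by (simp add: idl.span_add idl.span_scale)
  then have "(s * s') * (x + y) \<in> idl.span (X \<union> k)" by (simp add: algebra_simps)
  then show "x + y \<in> cl X" using unit_mult[OF s(1,3)] by (auto simp: cl_def)
next
  fix c x assume "x \<in> cl X"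
  then obtain s where s: "s - 1 \<in> I" "s * x \<in> idl.span (X \<union> k)" by (auto simp: cl_def)
  have "c * (s * x) \<in> idl.span (X \<union> k)" using s by (simp add: idl.span_scale)
  then show "c * x \<in> cl X" using s by (auto simp: cl_def ac_simps)
qed

lemmas cl_zero = idl.subspace_0[OF cl_ideal]
  and cl_add = idl.subspace_add[OF cl_ideal]
  and cl_diff = idl.subspace_diff[OF cl_ideal]
  and cl_scale = idl.subspace_scale[OF cl_ideal]
  and cl_multL = ideal_multL[OF cl_ideal]

lemma cl_unit: "s - 1 \<in> I \<Longrightarrow> s * z \<in> cl X \<Longrightarrow> z \<in> cl X"
proof -
  assume s: "s - 1 \<in> I" "s * z \<in> cl X"
  then obtain s' where s': "s' - 1 \<in> I" "s' * (s * z) \<in> idl.span (X \<union> k)" by (auto simp: cl_def)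
  then have "(s' * s) * z \<in> idl.span (X \<union> k)" by (simp add: ac_simps)
  then show ?thesis using unit_mult[OF s'(1) s(1)] by (auto simp: cl_def)
qed

lemma cl_mult_into:
  assumes "\<And>x. x \<in> X \<Longrightarrow> c * x \<in> cl Y" "z \<in> cl X"
  shows "c * z \<in> cl Y"
proof -
  obtain s where s: "s - 1 \<in> I" "s * z \<in> idl.span (X \<union> k)" using assms(2) by (auto simp: cl_def)
  have "idl.subspace {z. c * z \<in> cl Y}"
    by (rule idl.subspaceI) (auto simp: cl_zero cl_add algebra_simps, metis cl_scale mult.left_commute)
  moreover have "X \<union> k \<subseteq> {z. c * z \<in> cl Y}" using assms(1) by (auto intro: cl_scale cl_k)
  ultimately have "idl.span (X \<union> k) \<subseteq> {z. c * z \<in> cl Y}" by (intro idl.span_minimal)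
  then have "s * (c * z) \<in> cl Y" using s by (auto simp: ac_simps)
  then show ?thesis by (rule cl_unit[OF s(1)])
qed

lemma cl_minimal: "X \<subseteq> cl Y \<Longrightarrow> cl X \<subseteq> cl Y"
  using cl_mult_into[of X 1 Y] by auto

lemma cl_mono: "X \<subseteq> Y \<Longrightarrow> cl X \<subseteq> cl Y"
  by (rule cl_minimal) (auto intro: cl_base)

lemma cl_eqI: "X \<subseteq> cl Y \<Longrightarrow> Y \<subseteq> cl X \<Longrightarrow> cl X = cl Y"
  by (simp add: cl_minimal subset_antisym)

lemma cl_Un: "z \<in> cl (X \<union> Y) \<longleftrightarrow> (\<exists>s y. s - 1 \<in> I \<and> y \<in> idl.span Y \<and> s * z - y \<in> cl X)"
proof
  assume "z \<in> cl (X \<union> Y)"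
  then obtain s where s: "s - 1 \<in> I" "s * z \<in> idl.span ((X \<union> k) \<union> Y)" by (auto simp: cl_def Un_ac)
  then obtain x y where "s * z = x + y" "x \<in> idl.span (X \<union> k)" "y \<in> idl.span Y"
    unfolding idl.span_Un by blast
  then have "y \<in> idl.span Y \<and> s * z - y \<in> cl X" using span_in_cl[of x X] by simp
  then show "\<exists>s y. s - 1 \<in> I \<and> y \<in> idl.span Y \<and> s * z - y \<in> cl X" using s(1) by blast
next
  assume "\<exists>s y. s - 1 \<in> I \<and> y \<in> idl.span Y \<and> s * z - y \<in> cl X"
  then obtain s y where s: "s - 1 \<in> I" "y \<in> idl.span Y" "s * z - y \<in> cl X" by blast
  have "y \<in> cl (X \<union> Y)" using s(2) idl.span_mono[of Y "X \<union> Y"] by (auto intro: cl_span)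
  moreover have "s * z - y \<in> cl (X \<union> Y)" using s(3) cl_mono[of X "X \<union> Y"] by auto
  ultimately have "(s * z - y) + y \<in> cl (X \<union> Y)" by (rule cl_add[rotated])
  then show "z \<in> cl (X \<union> Y)" using cl_unit[OF s(1)] by simp
qed

lemma cl_insert: "z \<in> cl (insert a X) \<longleftrightarrow> (\<exists>s c. s - 1 \<in> I \<and> s * z - c * a \<in> cl X)"
  using cl_Un[of z X "{a}"] by (auto simp: idl.span_singleton)

lemma cl_times:
  assumes "x \<in> cl X" "y \<in> cl Y" shows "x * y \<in> cl (X * Y)"
proof (rule cl_mult_into[OF _ assms(2)])
  fix v assume v: "v \<in> Y"
  have "v * u \<in> cl (X * Y)" if "u \<in> X" for u
    using that v set_times_intro[of u X v Y] by (simp add: cl_base mult.commute)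
  from cl_mult_into[OF this assms(1)] show "x * v \<in> cl (X * Y)" by (simp add: mult.commute)
qed

text \<open>Let D be the intersection and F = (X) + k + I D. An ideal C that is maximal among those
  meeting D exactly in F contains a power of every element of I, hence by the pigeonhole principle a
  power of I, hence D. So D = F, and Nakayama gives s in 1 + I that carries D into (X) + k. No
  Artin-Rees lemma is involved.\<close>

theorem krull_intersection:
  assumes z: "\<And>n. z \<in> idl.span (X \<union> k \<union> I ^ n)"
  shows "z \<in> cl X"
proof -
  define D where "D = (\<Inter>n. idl.span (X \<union> k \<union> I ^ n))"
  define F where "F = idl.span (X \<union> k \<union> I * D)"
  have D: "idl.subspace D" unfolding D_def by (rule idl.subspace_Int) simp
  have XD: "X \<union> k \<subseteq> D" by (auto simp: D_def intro: idl.span_base)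
  have FD: "F \<subseteq> D" unfolding F_def using XD ideal_times_subset(2)[OF D, of I] D
    by (intro idl.span_minimal) auto
  let ?C = "{C. idl.subspace C \<and> k \<subseteq> C \<and> C \<inter> D = F}"
  have kF: "k \<subseteq> F" by (auto simp: F_def intro: idl.span_base)
  then have "F \<in> ?C" using FD by (auto simp: F_def)
  then obtain C where C: "C \<in> ?C" "\<And>B. B \<in> ?C \<Longrightarrow> C \<subseteq> B \<Longrightarrow> B = C"
    using ex_maximal[of ?C] by (metis (no_types, lifting) empty_iff mem_Collect_eq)
  have Cs: "idl.subspace C" "k \<subseteq> C" "C \<inter> D = F" using C(1) by auto
  \<comment> \<open>The ideals C : a^m stabilize at some n. Then C + (a^n) still meets D in F,
    because multiplication by \<open>a\<close> takes D into F, and maximality of C puts a^n into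
    C.\<close>
  have pw: "\<exists>n. a ^ n \<in> C" if a: "a \<in> I" for a
  proof -
    define f where "f m = {y. a ^ m * y \<in> C}" for m
    have "idl.subspace (f m)" for m using Cs(1)
      by (auto simp: f_def idl.subspace_def algebra_simps)
    moreover have "k \<subseteq> f m" for m using Cs by (auto simp: f_def intro: idl.subspace_scale)
    moreover have "f m \<subseteq> f (Suc m)" for m
      using Cs(1) by (auto simp: f_def mult.assoc intro: idl.subspace_scale)
    ultimately obtain n where n: "\<forall>m\<ge>n. f m = f n" using chain_stable[of f] by meson
    have "y \<in> F" if y: "y \<in> idl.span (insert (a ^ n) C)" "y \<in> D" for y
    proof -
      obtain c where c: "y - c * a ^ n \<in> C"
        using y(1) Cs(1) by (auto simp: idl.span_breakdown_eq idl.span_eq_iff[THEN iffD2])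
      have "a * y \<in> I * D" using a y(2) by blast
      then have "a * y \<in> F" unfolding F_def by (intro idl.span_base) blast
      then have "a * y \<in> C" using Cs(3) by blast
      moreover have "a * (y - c * a ^ n) \<in> C" by (rule idl.subspace_scale[OF Cs(1) c])
      ultimately have "a * y - a * (y - c * a ^ n) \<in> C" by (rule idl.subspace_diff[OF Cs(1)])
      then have "c \<in> f (Suc n)" by (simp add: f_def algebra_simps)
      then have "c \<in> f n" using n by (metis le_Suc_eq order_refl)
      then have "(y - c * a ^ n) + a ^ n * c \<in> C" using c by (intro idl.subspace_add[OF Cs(1)]) (auto simp: f_def)
      then show ?thesis using y(2) Cs(3) by (auto simp: algebra_simps)
    qed
    moreover have "C \<subseteq> idl.span (insert (a ^ n) C)" using idl.span_superset by blast
    ultimately have "idl.span (insert (a ^ n) C) \<in> ?C" using Cs by auto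
    then have "idl.span (insert (a ^ n) C) = C" using C(2) \<open>C \<subseteq> _\<close> by blast
    then show ?thesis using idl.span_base[of "a ^ n" "insert (a ^ n) C"] by auto
  qed
  obtain G where G: "finite G" "I = idl.span (G \<union> k)" using finitely_generated[OF I_ideal k_subset] by blast
  obtain gs where gs: "set gs = G" using finite_list[OF G(1)] by blast
  obtain h where h: "\<And>a. a \<in> I \<Longrightarrow> a ^ h a \<in> C" using pw by metis
  define t where "t = Max (insert 0 (h ` G))"
  have "g ^ Suc t \<in> C" if "g \<in> G" for g
  proof -
    have "h g \<le> t" using that G(1) by (simp add: t_def)
    then have "g ^ Suc t = g ^ (Suc t - h g) * g ^ h g" by (simp flip: power_add)
    moreover have "g \<in> I" using that G(2) by (auto intro: idl.span_base)
    ultimately show ?thesis using h[of g] by (metis idl.subspace_scale Cs(1))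
  qed
  moreover have "k * (G \<union> k) ^ (length gs * t) \<subseteq> C"
    using ideal_times_subset(1)[OF k_ideal] Cs(2) by blast
  ultimately have "idl.span ((\<lambda>d. d ^ Suc t) ` set gs \<union> k ^ 1 * (set gs \<union> k) ^ (length gs * t)) \<subseteq> C"
    using Cs(1) gs by (intro idl.span_minimal) auto
  then have "(G \<union> k) ^ (length gs * t + 1) \<subseteq> C"
    using span_power_pigeonhole[of gs k t 1] gs by blast
  then have "I ^ (length gs * t + 1) \<subseteq> C"
    using span_power_subset[of "G \<union> k" "length gs * t + 1"] idl.span_minimal[OF _ Cs(1)]
    unfolding G(2) by blast
  moreover have "X \<subseteq> C" using Cs(3) F_def idl.span_superset[of "X \<union> k \<union> I * D"] by blast
  ultimately have "idl.span (X \<union> k \<union> I ^ (length gs * t + 1)) \<subseteq> C"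
    using Cs by (intro idl.span_minimal) auto
  then have "D \<subseteq> C" unfolding D_def by blast
  then have DF: "D = F" using Cs(3) FD by blast
  obtain H where H: "finite H" "D = idl.span (H \<union> k)" using finitely_generated[OF D] XD by blast
  obtain hs where hs: "set hs = H" using finite_list[OF H(1)] by blast
  have "I * D \<subseteq> idl.span ((X \<union> k) \<union> I * H)"
  proof -
    have "x * y \<in> idl.span ((X \<union> k) \<union> I * H)" if "x \<in> I" "y \<in> D" for x y
    proof (rule span_times_subset[OF _ idl.span_base[OF that(1)]])
      show "y \<in> idl.span (H \<union> k)" using that(2) H by simp
      fix x y assume "x \<in> I" "y \<in> H \<union> k"
      then show "x * y \<in> idl.span ((X \<union> k) \<union> I * H)"
        by (auto intro: idl.span_base idl.span_scale)
    qed
    then show ?thesis by (auto elim!: set_times_elim)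
  qed
  then have "F \<subseteq> idl.span ((X \<union> k) \<union> I * H)" unfolding F_def
    by (intro idl.span_minimal) (auto intro: idl.span_base)
  moreover have "H \<subseteq> D" unfolding H(2) by (auto intro: idl.span_base)
  ultimately have "set hs \<subseteq> idl.span ((X \<union> k) \<union> I * set hs)" using DF hs by blast
  then have "\<exists>s\<in>{s. s - 1 \<in> I}. s * h \<in> idl.span ((X \<union> k) \<union> I * set hs)" if "h \<in> set hs" for h
    using that idl.subspace_0[OF I_ideal] by (intro bexI[of _ 1]) auto
  moreover have "mult_closed {s. s - 1 \<in> I}"
    using unit_mult idl.subspace_0[OF I_ideal] by (auto simp: mult_closed_def)
  moreover have "s - i \<in> {s. s - 1 \<in> I}" if "s \<in> {s. s - 1 \<in> I}" "i \<in> I" for s i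
    using idl.subspace_diff[OF I_ideal, of "s - 1" i] that by (simp add: algebra_simps)
  ultimately obtain s where s: "s - 1 \<in> I" "\<And>h. h \<in> H \<Longrightarrow> s * h \<in> idl.span (X \<union> k)"
    using nakayama[OF I_ideal, of "{s. s - 1 \<in> I}" hs "X \<union> k"] hs by blast
  have "s * h \<in> cl X" if "h \<in> H \<union> k" for h
    using that s(2) by (auto intro: span_in_cl cl_k cl_scale)
  moreover have "z \<in> cl (H \<union> k)" using z H(2) by (auto simp: D_def intro: cl_span)
  ultimately have "s * z \<in> cl X" by (metis cl_mult_into)
  then show ?thesis by (rule cl_unit[OF s(1)])
qed

text \<open>Modulo I^n an element s of 1 + I is already invertible, since 1 - s is nilpotent there:
  z - (1-s)^m z lies in the ideal for every m, in particular for m = n.\<close>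

lemma cl_Un_power:
  assumes "z \<in> cl (X \<union> I ^ n)"
  shows "z \<in> idl.span (X \<union> k \<union> I ^ n)"
proof -
  let ?Y = "idl.span (X \<union> k \<union> I ^ n)"
  obtain s where s: "s - 1 \<in> I" "s * z \<in> ?Y"
    using assms by (auto simp: cl_def Un_ac)
  have "z - (1 - s) ^ m * z \<in> ?Y" for m
  proof (induction m)
    case (Suc m)
    have "(1 - s) * (z - (1 - s) ^ m * z) + s * z \<in> ?Y"
      using Suc s(2) by (simp add: idl.span_add idl.span_scale)
    then show ?case by (simp add: algebra_simps)
  qed (simp add: idl.span_zero)
  then have "z - (1 - s) ^ n * z \<in> ?Y" .
  moreover have "1 - s \<in> I" using idl.subspace_neg[OF I_ideal s(1)] by simp
  then have "(1 - s) ^ n * z \<in> ?Y" by (intro span_multL idl.span_base) (simp add: in_set_power)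
  ultimately have "(z - (1 - s) ^ n * z) + (1 - s) ^ n * z \<in> ?Y" by (rule idl.span_add)
  then show ?thesis by simp
qed

text \<open>The closure is closed in the I-adic topology. In this form Krull's theorem allows
  successive approximation.\<close>

lemma cl_closed:
  assumes "\<And>n. z \<in> cl (X \<union> I ^ n)" shows "z \<in> cl X"
  using krull_intersection cl_Un_power assms by blast

end

section \<open>Regular sequences up to units in \<open>1 + I\<close>\<close>

lemma power_insert_Suc:
  fixes x :: "'a::comm_monoid_mult"
  shows "insert x X ^ Suc n \<subseteq> (*) x ` (insert x X ^ n) \<union> X ^ Suc n"
proof
  fix y assume "y \<in> insert x X ^ Suc n"
  then obtain i w where iw: "i \<le> Suc n" "w \<in> X ^ (Suc n - i)" "y = x ^ i * w"
    using set_power_insert by blast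
  show "y \<in> (*) x ` (insert x X ^ n) \<union> X ^ Suc n"
  proof (cases i)
    case 0
    then show ?thesis using iw by simp
  next
    case (Suc j)
    have "x ^ j * w \<in> insert x X ^ j * insert x X ^ (n - j)"
      using iw(2) Suc set_power_mono[of X "insert x X" "n - j"] in_set_power[of x "insert x X" j] by auto
    also have "\<dots> = insert x X ^ n" using iw(1) Suc by (simp flip: power_add)
    finally have "x ^ j * w \<in> insert x X ^ n" .
    moreover have "y = x * (x ^ j * w)" using iw(3) Suc by (simp add: ac_simps)
    ultimately show ?thesis by blast
  qed
qed

lemma empty_power_Suc: "({} :: 'a::comm_monoid_mult set) ^ Suc n = {}"
  by (simp add: set_times_def)

lemma singleton_power: "{a :: 'a::comm_monoid_mult} ^ n = {a ^ n}"
  by (induction n) (auto simp: set_one set_times_def)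

lemma span_image_mult: "y \<in> idl.span ((*) x ` X) \<Longrightarrow> \<exists>v \<in> idl.span X. y = x * v"
proof (induction rule: idl.span_induct_alt)
  case base
  then show ?case by (intro bexI[of _ 0]) (auto simp: idl.span_zero)
next
  case (step c u y)
  then obtain v w where "v \<in> idl.span X" "y = x * v" "u = x * w" "w \<in> X" by auto
  then show ?case by (intro bexI[of _ "c * w + v"])
    (auto simp: algebra_simps intro: idl.span_add idl.span_scale idl.span_base)
qed

context noeth_pair
begin

text \<open>A nonzerodivisor on the localized quotient by \<open>D\<close>, the zero quotient
  included; this keeps the exponent 0, where the quotient is zero, uniform with the other
  powers.\<close>

definition reg :: "'a set \<Rightarrow> 'a \<Rightarrow> bool" where
  "reg D x \<longleftrightarrow> (\<forall>z. x * z \<in> cl D \<longrightarrow> z \<in> cl D)"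

primrec creg :: "'a set \<Rightarrow> 'a list \<Rightarrow> bool" where
  "creg D [] = True"
| "creg D (x # xs) = (reg D x \<and> creg (insert x D) xs)"

lemma cl_comb: "x \<in> cl X \<Longrightarrow> y \<in> cl X \<Longrightarrow> a * x + b * y \<in> cl X"
  and cl_comb_diff: "x \<in> cl X \<Longrightarrow> y \<in> cl X \<Longrightarrow> a * x - b * y \<in> cl X"
  by (simp_all add: cl_add cl_diff cl_scale)

lemma regD: "reg D x \<Longrightarrow> x * z \<in> cl D \<Longrightarrow> z \<in> cl D"
  by (simp add: reg_def)

lemma cl_insert_cong: "cl D = cl E \<Longrightarrow> cl (insert x D) = cl (insert x E)"
  by (auto simp: cl_insert)

lemma reg_cong: "cl D = cl E \<Longrightarrow> reg D x = reg E x"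
  by (simp add: reg_def)

lemma creg_cong: "cl D = cl E \<Longrightarrow> creg D xs = creg E xs"
proof (induction xs arbitrary: D E)
  case (Cons x xs)
  have "creg (insert x D) xs = creg (insert x E) xs"
    by (rule Cons.IH) (rule cl_insert_cong[OF Cons.prems])
  then show ?case using reg_cong[OF Cons.prems] by simp
qed simp

lemma creg_append: "creg D (xs @ ys) \<longleftrightarrow> creg D xs \<and> creg (D \<union> set xs) ys"
  by (induction xs arbitrary: D) auto

lemma reg_prod: "reg D x \<Longrightarrow> reg D y \<Longrightarrow> reg D (x * y)"
  unfolding reg_def mult.assoc by blast

lemma reg_power: "reg D x \<Longrightarrow> reg D (x ^ n)"
proof (induction n)
  case 0
  show ?case unfolding reg_def by simp
next
  case (Suc n)
  then show ?case unfolding power_Suc by (intro reg_prod)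
qed

lemma cl_insert_memI: "s - 1 \<in> I \<Longrightarrow> s * z - c * a \<in> cl X \<Longrightarrow> z \<in> cl (insert a X)"
  by (auto simp: cl_insert)

lemma cl_insert_memE:
  assumes "z \<in> cl (insert a X)"
  obtains s c where "s - 1 \<in> I" "s * z - c * a \<in> cl X"
  using assms by (auto simp: cl_insert)

lemma cl_absorb: "a \<in> cl X \<Longrightarrow> cl (insert a X) = cl X"
  by (rule cl_eqI) (auto intro: cl_base)

lemma reg_div:
  assumes "reg D a" "a * z \<in> cl (insert (a * b) D)"
  shows "z \<in> cl (insert b D)"
proof -
  obtain s c where sc: "s - 1 \<in> I" "s * (a * z) - c * (a * b) \<in> cl D"
    using assms(2) by (rule cl_insert_memE)
  then have "a * (s * z - c * b) \<in> cl D" by (simp add: algebra_simps)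
  then show ?thesis using regD[OF assms(1)] sc(1) by (auto intro: cl_insert_memI)
qed

text \<open>If y z = 0 modulo D, then z = c x; cancelling x gives y c = 0, so c is again a multiple
  of x. Hence z lies in (x^n) + D for every n, and x in I makes the I-adic closedness applicable.
  That x remains regular after y is then a formal computation.\<close>

lemma creg_swap:
  assumes "creg D (x # y # zs)" "x \<in> I" "y \<in> I"
  shows "creg D (y # x # zs)"
proof -
  have x: "reg D x" and y: "reg (insert x D) y" using assms(1) by auto
  have xy: "c \<in> cl (insert x D)" if "y * c \<in> cl (insert x D)" for c using regD[OF y that] .
  have step: "z \<in> cl (insert x D)" if "y * z \<in> cl D" for z
    using that xy cl_mono[of D "insert x D"] by blast
  have "z \<in> cl (insert (x ^ n) D)" if z: "y * z \<in> cl D" for z n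
  proof (induction n)
    case (Suc n)
    then obtain s c where sc: "s - 1 \<in> I" "s * z - c * x ^ n \<in> cl D" by (rule cl_insert_memE)
    have "s * (y * z) - y * (s * z - c * x ^ n) \<in> cl D"
      using z sc(2) by (rule cl_comb_diff)
    then have "x ^ n * (y * c) \<in> cl D" by (simp add: algebra_simps)
    then have "c \<in> cl (insert x D)" using step regD[OF reg_power[OF x]] by blast
    then obtain s' c' where s': "s' - 1 \<in> I" "s' * c - c' * x \<in> cl D" by (rule cl_insert_memE)
    have "s' * (s * z - c * x ^ n) + x ^ n * (s' * c - c' * x) \<in> cl D"
      using sc(2) s'(2) by (rule cl_comb)
    then have "(s' * s) * z - c' * x ^ Suc n \<in> cl D" by (simp add: algebra_simps)
    then show ?case using unit_mult[OF s'(1) sc(1)] by (rule cl_insert_memI[rotated])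
  next
    case 0
    show ?case using cl_scale[OF cl_base[of 1 "insert 1 D"], of z] by simp
  qed
  note xpow = this
  have sub: "cl (insert (x ^ n) D) \<subseteq> cl (D \<union> I ^ n)" for n
    using in_set_power[OF assms(2), of n] by (intro cl_mono) simp
  have "z \<in> cl D" if "y * z \<in> cl D" for z
    by (rule cl_closed) (rule subsetD[OF sub xpow[OF that]])
  then have "reg D y" by (simp add: reg_def)
  moreover have "reg (insert y D) x" unfolding reg_def
  proof (intro allI impI)
    fix z assume "x * z \<in> cl (insert y D)"
    then obtain s w where s: "s - 1 \<in> I" "s * (x * z) - w * y \<in> cl D" by (rule cl_insert_memE)
    have "(s * z) * x - 1 * (s * (x * z) - w * y) \<in> cl (insert x D)"
      by (rule cl_comb_diff) (use s(2) cl_mono[of D "insert x D"] in \<open>auto intro: cl_base\<close>)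
    then have "y * w \<in> cl (insert x D)" by (simp add: algebra_simps)
    then have "w \<in> cl (insert x D)" by (rule xy)
    then obtain s' c where s': "s' - 1 \<in> I" "s' * w - c * x \<in> cl D" by (rule cl_insert_memE)
    have "s' * (s * (x * z) - w * y) + y * (s' * w - c * x) \<in> cl D"
      using s(2) s'(2) by (rule cl_comb)
    then have "x * ((s' * s) * z - c * y) \<in> cl D" by (simp add: algebra_simps)
    then have "(s' * s) * z - c * y \<in> cl D" by (rule regD[OF x])
    then show "z \<in> cl (insert y D)" using unit_mult[OF s'(1) s(1)] by (rule cl_insert_memI[rotated])
  qed
  moreover have "creg (insert x (insert y D)) zs" using assms(1) by (simp add: insert_commute[of x y])
  ultimately show ?thesis by simp
qed

text \<open>Iterated swaps bring any entry to the last place, where it can be replaced without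
  affecting the conditions on the other entries.\<close>

lemma creg_rotate:
  assumes "insert y (set xs) \<subseteq> I"
  shows "creg D (xs @ [y]) \<longleftrightarrow> creg D (y # xs)"
  using assms
proof (induction xs arbitrary: D)
  case (Cons x xs)
  have "creg D ((x # xs) @ [y]) \<longleftrightarrow> creg D (x # y # xs)"
    using Cons.IH[of "insert x D"] Cons.prems by simp
  also have "\<dots> \<longleftrightarrow> creg D (y # x # xs)"
  proof
    have I: "x \<in> I" "y \<in> I" using Cons.prems by auto
    show "creg D (x # y # xs)" if "creg D (y # x # xs)" by (rule creg_swap[OF that I(2,1)])
    show "creg D (y # x # xs)" if "creg D (x # y # xs)" by (rule creg_swap[OF that I])
  qed
  finally show ?case .
qed simp

lemma creg_map:
  assumes "creg D (xs @ ys)" "set xs \<union> set ys \<subseteq> I" "\<And>x. x \<in> set xs \<Longrightarrow> f x \<in> I"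
    and "\<And>D x. x \<in> set xs \<Longrightarrow> reg D x \<Longrightarrow> reg D (f x)"
  shows "creg D (map f xs @ ys)"
  using assms
proof (induction xs arbitrary: ys)
  case (Cons x xs)
  have "creg D ((xs @ ys) @ [x])" using Cons.prems creg_rotate[of x "xs @ ys"] by auto
  then have "creg D ((xs @ ys) @ [f x])"
    using Cons.prems(4)[of x] by (auto simp: creg_append)
  then have "creg D (map f xs @ (ys @ [f x]))"
    using Cons.prems by (intro Cons.IH) auto
  then show ?case using creg_rotate[of "f x" "map f xs @ ys"] Cons.prems by auto
qed simp

lemma I_power: "x \<in> I \<Longrightarrow> x ^ Suc n \<in> I"
  using ideal_multL[OF I_ideal] by auto

lemma creg_powers:
  assumes "creg D xs" "set xs \<subseteq> I" shows "creg D (map (\<lambda>x. x ^ Suc t) xs)"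
proof -
  have "creg D (map (\<lambda>x. x ^ Suc t) xs @ [])"
  proof (rule creg_map)
    show "x ^ Suc t \<in> I" if "x \<in> set xs" for x using that assms(2) I_power by blast
    show "reg D (x ^ Suc t)" if "reg D x" for D x by (rule reg_power[OF that])
  qed (use assms in auto)
  then show ?thesis by simp
qed

lemma cl_Un_power_insert: "cl (D \<union> insert x X ^ n) \<subseteq> cl (insert x D \<union> X ^ n)"
proof (rule cl_minimal)
  have "insert x X ^ n \<subseteq> idl.span (insert x (X ^ n))"
    using span_power_insert[of x X 0 n] by simp
  then show "D \<union> insert x X ^ n \<subseteq> cl (insert x D \<union> X ^ n)"
    using cl_span[of _ "insert x (X ^ n)"] cl_mono[of "insert x (X ^ n)" "insert x D \<union> X ^ n"]
    by (auto intro: cl_base)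
qed

lemma cl_power_antimono: "m \<le> n \<Longrightarrow> cl (D \<union> X ^ n) \<subseteq> cl (D \<union> X ^ m)"
proof (rule cl_minimal)
  assume "m \<le> n"
  then have "X ^ n = X ^ m * X ^ (n - m)" by (simp flip: power_add)
  then show "D \<union> X ^ n \<subseteq> cl (D \<union> X ^ m)"
    by (auto elim!: set_times_elim intro: cl_base intro!: cl_multL)
qed

text \<open>An element of (x, X)^(n+1) is x v plus an element of (X)^(n+1) with v in (x, X)^n, and x
  can be cancelled modulo (X)^(n+1). In the associated graded ring of (x, X) the initial form of x
  is thus a nonzerodivisor.\<close>

lemma colon_power:
  assumes reg: "\<And>m. reg (D \<union> X ^ m) x" and w: "x * w \<in> cl (D \<union> insert x X ^ Suc n)"
  shows "w \<in> cl (D \<union> insert x X ^ n)"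
proof -
  have "x * w \<in> cl ((D \<union> X ^ Suc n) \<union> (*) x ` (insert x X ^ n))"
    using w power_insert_Suc[of x X n] cl_mono[of "D \<union> insert x X ^ Suc n" "(D \<union> X ^ Suc n) \<union> (*) x ` (insert x X ^ n)"]
    by blast
  then obtain s y where s: "s - 1 \<in> I" "y \<in> idl.span ((*) x ` (insert x X ^ n))"
    "s * (x * w) - y \<in> cl (D \<union> X ^ Suc n)" unfolding cl_Un[of _ "D \<union> X ^ Suc n"] by blast
  then obtain v where v: "v \<in> idl.span (insert x X ^ n)" "y = x * v" using span_image_mult by blast
  have "x * (s * w - v) \<in> cl (D \<union> X ^ Suc n)" using s v by (simp add: algebra_simps)
  then have "s * w - v \<in> cl (D \<union> X ^ Suc n)" by (rule regD[OF reg])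
  then have "s * w - v \<in> cl (D \<union> insert x X ^ n)"
    using cl_power_antimono[of n "Suc n" D X] cl_mono[of "D \<union> X ^ n" "D \<union> insert x X ^ n"]
      set_power_mono[of X "insert x X" n] by auto
  moreover have "v \<in> cl (D \<union> insert x X ^ n)"
    using cl_span[OF v(1)] cl_mono[of "insert x X ^ n" "D \<union> insert x X ^ n"] by auto
  ultimately have "(s * w - v) + v \<in> cl (D \<union> insert x X ^ n)" by (rule cl_add)
  then show ?thesis using cl_unit[OF s(1)] by simp
qed

lemma cl_one_UNIV: "cl (D \<union> X ^ 0) = UNIV"
  using cl_multL[OF cl_base[of 1 "D \<union> X ^ 0"]] by (auto simp: set_one)

text \<open>Double induction, on the list and on n. Let Q be generated by x and \<open>xs\<close>.
  If a z lies in Q^(n+1), the outer induction modulo x gives z = c x modulo (xs)^(n+1); then x (a c)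
  lies in Q^(n+1), so a c lies in Q^n by \<open>colon_power\<close>, and the inner induction puts c
  into Q^n and hence z into Q^(n+1).\<close>

lemma reg_power_ideal:
  assumes "creg D (a # xs)" "set (a # xs) \<subseteq> I"
  shows "reg (D \<union> set xs ^ n) a"
  using assms
proof (induction xs arbitrary: D a n)
  case Nil
  show ?case
  proof (cases n)
    case 0
    then show ?thesis using cl_one_UNIV[of D "set []"] by (simp add: reg_def)
  next
    case (Suc m)
    then have "D \<union> set [] ^ n = D" using empty_power_Suc[of m] by auto
    then show ?thesis using Nil.prems by simp
  qed
next
  case (Cons x xs)
  let ?Q = "set (x # xs)"
  have xa: "creg D (x # a # xs)" using Cons.prems creg_swap[of D a x xs] by auto
  have "creg D ((x # xs) @ [a])" using Cons.prems creg_rotate[of a "x # xs"] by auto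
  then have "creg D (x # xs)" unfolding creg_append by simp
  then have regx: "reg (D \<union> set xs ^ m) x" for m using Cons.IH[of D x] Cons.prems by auto
  have rega: "reg (insert x D \<union> set xs ^ m) a" for m
    using Cons.IH[of "insert x D" a] xa Cons.prems by auto
  show ?case
  proof (induction n)
    case 0
    then show ?case using cl_one_UNIV by (simp add: reg_def)
  next
    case (Suc n)
    show ?case unfolding reg_def
    proof (intro allI impI)
      fix z assume z: "a * z \<in> cl (D \<union> ?Q ^ Suc n)"
      then have "a * z \<in> cl (insert x D \<union> set xs ^ Suc n)"
        using cl_Un_power_insert[of D x "set xs" "Suc n"] by auto
      then have "z \<in> cl (insert x D \<union> set xs ^ Suc n)" by (rule regD[OF rega])
      then have "z \<in> cl (insert x (D \<union> set xs ^ Suc n))" by simp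
      then obtain s c where sc: "s - 1 \<in> I" "s * z - c * x \<in> cl (D \<union> set xs ^ Suc n)"
        by (rule cl_insert_memE)
      have "cl (D \<union> set xs ^ Suc n) \<subseteq> cl (D \<union> ?Q ^ Suc n)"
        using set_power_mono[of "set xs" ?Q "Suc n"] by (intro cl_mono) auto
      then have sc2: "s * z - c * x \<in> cl (D \<union> ?Q ^ Suc n)" using sc by blast
      have "s * (a * z) - a * (s * z - c * x) \<in> cl (D \<union> ?Q ^ Suc n)"
        using z sc2 by (rule cl_comb_diff)
      then have "x * (a * c) \<in> cl (D \<union> insert x (set xs) ^ Suc n)" by (simp add: algebra_simps)
      then have "a * c \<in> cl (D \<union> insert x (set xs) ^ n)" by (rule colon_power[OF regx])
      then have "c \<in> cl (D \<union> ?Q ^ n)" using regD[OF Suc] by simp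
      moreover have "x * y \<in> cl (D \<union> ?Q ^ Suc n)" if "y \<in> D \<union> ?Q ^ n" for y
      proof (cases "y \<in> D")
        case True
        then show ?thesis by (intro cl_scale cl_base) simp
      next
        case False
        then have "x * y \<in> ?Q ^ Suc n" using that by (auto intro: set_times_intro)
        then show ?thesis by (simp add: cl_base)
      qed
      ultimately have "x * c \<in> cl (D \<union> ?Q ^ Suc n)" by (rule cl_mult_into[rotated])
      then have "(s * z - c * x) + x * c \<in> cl (D \<union> ?Q ^ Suc n)" by (rule cl_add[OF sc2])
      then show "z \<in> cl (D \<union> ?Q ^ Suc n)" using cl_unit[OF sc(1)] by (simp add: ac_simps)
    qed
  qed
qed

lemma creg_colon:
  assumes "creg D (x # xs)" "set (x # xs) \<subseteq> I" "x * w \<in> cl (D \<union> set (x # xs) ^ Suc n)"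
  shows "w \<in> cl (D \<union> set (x # xs) ^ n)"
proof -
  have "w \<in> cl (D \<union> insert x (set xs) ^ n)"
    by (rule colon_power[OF reg_power_ideal[OF assms(1,2)]]) (use assms(3) in simp)
  then show ?thesis by simp
qed

lemma creg_colon_power:
  assumes "creg D (x # xs)" "set (x # xs) \<subseteq> I" "x ^ j * w \<in> cl (D \<union> set (x # xs) ^ (n + j))"
  shows "w \<in> cl (D \<union> set (x # xs) ^ n)"
  using assms(3)
proof (induction j arbitrary: w)
  case (Suc j)
  have "x ^ j * w \<in> cl (D \<union> set (x # xs) ^ (n + j))"
    using Suc.prems by (intro creg_colon[OF assms(1,2), of "x ^ j * w"]) (simp add: mult.assoc)
  then show ?case by (rule Suc.IH)
qed simp

text \<open>Modulo D, A M lies in B M, so A x M lies in B x M, which is contained in B (A);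
  cancelling A leaves (B). The uses are A = a^(t+1), B = b^(t+1), and A a product of elements a + u
  y, B a power of a.\<close>

lemma exchange:
  assumes "reg D A" "\<And>m. m \<in> M \<Longrightarrow> x * m \<in> cl (insert A D)"
    and "\<And>m. m \<in> M \<Longrightarrow> A * m \<in> cl ((*) B ` M \<union> D)" and "m \<in> M"
  shows "x * m \<in> cl (insert B D)"
proof -
  have "x * y \<in> cl (insert (A * B) D)" if y: "y \<in> (*) B ` M \<union> D" for y
  proof (cases "y \<in> D")
    case True
    then show ?thesis by (auto intro: cl_base cl_scale)
  next
    case False
    then obtain m' where m': "m' \<in> M" "y = B * m'" using y by auto
    have "B * u \<in> cl (insert (A * B) D)" if "u \<in> insert A D" for u
    proof (cases "u = A")
      case True
      then show ?thesis using cl_base[of "A * B" "insert (A * B) D"] by (simp add: mult.commute)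
    next
      case False
      then show ?thesis using that by (auto intro: cl_base cl_scale)
    qed
    from cl_mult_into[OF this assms(2)[OF m'(1)]] show ?thesis using m' by (simp add: ac_simps)
  qed
  from cl_mult_into[OF this assms(3)[OF assms(4)]]
  have "A * (x * m) \<in> cl (insert (A * B) D)" by (simp add: ac_simps)
  then show ?thesis by (rule reg_div[OF assms(1)])
qed

end

section \<open>Socle of powers of regular sequences; pencils of linear forms\<close>

context noeth_pair
begin

section \<open>Duality modulo powers of a regular sequence\<close>

lemma cl_Un_one: "cl (D \<union> 1) = UNIV" "cl (insert a (D \<union> 1)) = UNIV"
  using cl_one_UNIV[of D] cl_one_UNIV[of "insert a D"] by simp_all

lemma cl_Un_scale:
  assumes "x \<in> cl (D \<union> X)" "\<And>y. y \<in> X \<Longrightarrow> c * y \<in> cl (D \<union> Y)"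
  shows "c * x \<in> cl (D \<union> Y)"
  by (rule cl_mult_into[OF _ assms(1)]) (auto simp: assms(2) intro: cl_base cl_scale)

lemma cl_Un_mono: "X \<subseteq> Y \<Longrightarrow> z \<in> cl (D \<union> X) \<Longrightarrow> z \<in> cl (D \<union> Y)"
  using cl_mono[of "D \<union> X" "D \<union> Y"] by auto

lemma reg_mod_powers:
  assumes "creg D (a # ys)" "set (a # ys) \<subseteq> I"
  shows "reg (D \<union> (\<lambda>y. y ^ Suc t) ` set ys) a"
proof -
  have "creg D (ys @ [a])" using assms creg_rotate[of a ys] by simp
  then have "creg D (map (\<lambda>y. y ^ Suc t) ys @ [a])"
    using assms(2) I_power by (intro creg_map) (auto intro: reg_power reg_prod)
  then show ?thesis by (simp add: creg_append)
qed

text \<open>Modulo \<open>D\<close>, the graded ring of Q = (a, ys) is a polynomial ring over the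
  quotient by Q. Modulo a^(m+1) and the (t+1)st powers of \<open>ys\<close> its socle has degree m +
  length ys * t, and forms of complementary degrees are paired perfectly. For n at most m and t
  these powers contribute nothing in degree n, so a form of degree n that pairs to zero vanishes: z
  lies in Q^(n+1). The exponent of \<open>a\<close> is separate from t because the induction on n
  divides z by \<open>a\<close> and lowers m. \<open>mod_a\<close> is the assertion for
  \<open>ys\<close> modulo \<open>a\<close>, supplied by the induction on the list.\<close>

lemma socle_step_aux:
  assumes creg: "creg D (a # ys)" and sub: "set (a # ys) \<subseteq> I"
    and hyp: "n \<le> m" "n \<le> t" "z \<in> cl (D \<union> set (a # ys) ^ n)"
      "\<And>q. q \<in> set (a # ys) ^ (m + length ys * t - n) \<Longrightarrow>
        z * q \<in> cl (insert (a ^ Suc m) (D \<union> (\<lambda>y. y ^ Suc t) ` set ys))"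
    and mod_a: "\<And>n z. n \<le> t \<Longrightarrow> z \<in> cl (insert a D \<union> set ys ^ n) \<Longrightarrow>
      (\<And>p. p \<in> set ys ^ (length ys * t - n) \<Longrightarrow> z * p \<in> cl (insert a D \<union> (\<lambda>y. y ^ Suc t) ` set ys)) \<Longrightarrow>
      z \<in> cl (insert a D \<union> set ys ^ Suc n)"
  shows "z \<in> cl (D \<union> set (a # ys) ^ Suc n)"
  using hyp
proof (induction n arbitrary: m z)
  case 0
  let ?pw = "(\<lambda>y. y ^ Suc t) ` set ys"
  have rega: "reg (D \<union> ?pw) a" by (rule reg_mod_powers[OF creg sub])
  \<comment> \<open>The factor a^m raises the degree to the one in the hypothesis; cancelling it
    afterwards turns a^(m+1) into a.\<close>
  have "z * p \<in> cl (insert a D \<union> ?pw)" if p: "p \<in> set ys ^ (length ys * t)" for p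
  proof -
    have "a ^ m * p \<in> set (a # ys) ^ m * set (a # ys) ^ (length ys * t)"
      using p set_power_mono[of "set ys" "set (a # ys)"] in_set_power[of a "set (a # ys)" m] by auto
    then have "z * (a ^ m * p) \<in> cl (insert (a ^ Suc m) (D \<union> ?pw))"
      by (intro 0(4)) (simp add: power_add)
    then have "a ^ m * (z * p) \<in> cl (insert (a ^ m * a) (D \<union> ?pw))" by (simp add: ac_simps)
    then show ?thesis using reg_div[OF reg_power[OF rega]] by auto
  qed
  then have "z \<in> cl (insert a D \<union> set ys ^ Suc 0)"
    by (intro mod_a) (auto simp: cl_Un_one)
  then show ?case using cl_mono[of "insert a D \<union> set ys" "D \<union> set (a # ys)"] by auto
next
  case (Suc n)
  let ?pw = "(\<lambda>y. y ^ Suc t) ` set ys" and ?Q = "set (a # ys)" and ?e = "length ys * t"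
  have rega: "reg (D \<union> ?pw) a" by (rule reg_mod_powers[OF creg sub])
  have "z \<in> cl (insert a D \<union> set ys ^ Suc n)"
    using Suc.prems(3) cl_Un_power_insert[of D a "set ys" "Suc n"] by auto
  moreover have "z * p \<in> cl (insert a D \<union> ?pw)" if p: "p \<in> set ys ^ (?e - Suc n)" for p
  proof -
    have "a ^ m * p \<in> ?Q ^ m * ?Q ^ (?e - Suc n)"
      using p set_power_mono[of "set ys" "?Q"] in_set_power[of a "?Q" m] by auto
    then have ap: "a ^ m * p \<in> ?Q ^ (m + (?e - Suc n))" by (simp add: power_add)
    have "z * (a ^ m * p) \<in> cl (insert (a ^ Suc m) (D \<union> ?pw))"
    proof (cases "Suc n \<le> ?e")
      case True
      then show ?thesis using ap by (intro Suc.prems(4)) simp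
    next
      \<comment> \<open>The subtraction \<open>?e - Suc n\<close> is truncated to 0 here. The
        product a^m p then has degree m, at least the degree in the hypothesis, and the surplus
        factors are split off.\<close>
      case False
      then have "?Q ^ (m + (?e - Suc n)) = ?Q ^ (m + ?e - Suc n) * ?Q ^ (m - (m + ?e - Suc n))"
        using Suc.prems(1) by (simp flip: power_add)
      then obtain q1 q2 where q: "a ^ m * p = q1 * q2" "q1 \<in> ?Q ^ (m + ?e - Suc n)"
        using ap by (auto elim: set_times_elim)
      then show ?thesis using cl_multL[OF Suc.prems(4)[OF q(2)], of q2] by (simp add: ac_simps)
    qed
    then have "a ^ m * (z * p) \<in> cl (insert (a ^ m * a) (D \<union> ?pw))" by (simp add: ac_simps)
    then show ?thesis using reg_div[OF reg_power[OF rega]] by auto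
  qed
  ultimately have "z \<in> cl (insert a (D \<union> set ys ^ Suc (Suc n)))"
    using mod_a[OF Suc.prems(2)] by simp
  then obtain s v where sv: "s - 1 \<in> I" "s * z - v * a \<in> cl (D \<union> set ys ^ Suc (Suc n))"
    by (rule cl_insert_memE)
  have sv': "s * z - v * a \<in> cl (D \<union> ?Q ^ Suc (Suc n))"
    using cl_Un_mono[OF set_power_mono[of "set ys" ?Q] sv(2)] by auto
  have "s * z - v * a \<in> cl (D \<union> ?Q ^ Suc n)"
    using sv' cl_power_antimono[of "Suc n" "Suc (Suc n)" D ?Q] by auto
  then have "s * z - 1 * (s * z - v * a) \<in> cl (D \<union> ?Q ^ Suc n)" using Suc.prems(3) by (rule cl_comb_diff[rotated])
  then have "a * v \<in> cl (D \<union> ?Q ^ Suc n)" by (simp add: algebra_simps)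
  then have "v \<in> cl (D \<union> ?Q ^ n)" by (rule creg_colon[OF creg sub])
  moreover obtain m' where m: "m = Suc m'" "n \<le> m'" using Suc.prems(1) by (cases m) auto
  moreover have "v * q \<in> cl (insert (a ^ Suc m') (D \<union> ?pw))" if q: "q \<in> ?Q ^ (m' + ?e - n)" for q
  proof -
    \<comment> \<open>The quotient v has degree n and inherits the hypothesis with m' for m. The
      error s z - v a lies in Q^(n+2); times q it reaches degree ?e + m + 1, one above the socle
      degree, where the pigeonhole principle applies.\<close>
    let ?Z = "insert (a ^ Suc m) (D \<union> ?pw)"
    have zq: "z * q \<in> cl ?Z" using q m by (intro Suc.prems(4)) simp
    have "q * (s * z - v * a) \<in> cl ?Z"
    proof (rule cl_mult_into[OF _ sv'])
      fix x assume x: "x \<in> D \<union> ?Q ^ Suc (Suc n)"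
      show "q * x \<in> cl ?Z"
      proof (cases "x \<in> D")
        case True
        then show ?thesis by (intro cl_scale cl_base) simp
      next
        case False
        then have "q * x \<in> ?Q ^ (m' + ?e - n) * ?Q ^ Suc (Suc n)" using x q by auto
        also have "\<dots> = ?Q ^ (?e + Suc m)" unfolding power_add[symmetric] using m by (simp add: ac_simps)
        also have "\<dots> = (set ys \<union> {a}) ^ (?e + Suc m)" by simp
        finally have "q * x \<in> idl.span (?pw \<union> {a} ^ Suc m * (set ys \<union> {a}) ^ ?e)"
          using span_power_pigeonhole[of ys "{a}" t "Suc m"] by blast
        moreover have "?pw \<union> {a} ^ Suc m * (set ys \<union> {a}) ^ ?e \<subseteq> cl ?Z"
          by (auto simp del: power_Suc simp: singleton_power elim!: set_times_elim intro: cl_base intro!: cl_multL)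
        then have "idl.span (?pw \<union> {a} ^ Suc m * (set ys \<union> {a}) ^ ?e) \<subseteq> cl ?Z"
          using cl_ideal by (rule idl.span_minimal)
        ultimately show ?thesis by blast
      qed
    qed
    then have "s * (z * q) - 1 * (q * (s * z - v * a)) \<in> cl ?Z" by (rule cl_comb_diff[OF zq])
    then have "a * (v * q) \<in> cl (insert (a * a ^ Suc m') (D \<union> ?pw))" using m by (simp add: algebra_simps)
    then show ?thesis by (rule reg_div[OF rega])
  qed
  ultimately have "v \<in> cl (D \<union> ?Q ^ Suc n)" using Suc.prems(2) by (intro Suc.IH[of m']) auto
  then have "a * v \<in> cl (D \<union> ?Q ^ Suc (Suc n))"
    by (rule cl_Un_scale) (auto intro: cl_base)
  then have "(s * z - v * a) + a * v \<in> cl (D \<union> ?Q ^ Suc (Suc n))" by (rule cl_add[OF sv'])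
  then show ?case using cl_unit[OF sv(1)] by (simp add: ac_simps)
qed

lemma socle_step:
  assumes "creg D (a # ys)" "set (a # ys) \<subseteq> I" "n \<le> m" "n \<le> t"
    and "z \<in> cl (D \<union> set (a # ys) ^ n)"
    and "\<And>q. q \<in> set (a # ys) ^ (m + length ys * t - n) \<Longrightarrow>
      z * q \<in> cl (insert (a ^ Suc m) (D \<union> (\<lambda>y. y ^ Suc t) ` set ys))"
  shows "z \<in> cl (D \<union> set (a # ys) ^ Suc n)"
  using assms
proof (induction ys arbitrary: D a m n z)
  case Nil
  show ?case
  proof (rule socle_step_aux[OF Nil.prems])
    fix n z assume z: "z \<in> cl (insert a D \<union> set [] ^ n)"
      "\<And>p. p \<in> set [] ^ (length [] * t - n) \<Longrightarrow> z * p \<in> cl (insert a D \<union> (\<lambda>y. y ^ Suc t) ` set [])"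
    show "z \<in> cl (insert a D \<union> set [] ^ Suc n)"
      \<comment> \<open>The exponent \<open>length [] * t - n\<close> is 0, so p = 1 is admissible
        and z itself lies in (a) + D.\<close>
      using z(2)[of 1] by (simp add: set_one empty_power_Suc del: power_Suc)
  qed
next
  case (Cons b ys)
  show ?case
  proof (rule socle_step_aux[OF Cons.prems])
    fix n z assume n: "n \<le> t" and z: "z \<in> cl (insert a D \<union> set (b # ys) ^ n)"
      "\<And>p. p \<in> set (b # ys) ^ (length (b # ys) * t - n) \<Longrightarrow>
        z * p \<in> cl (insert a D \<union> (\<lambda>y. y ^ Suc t) ` set (b # ys))"
    show "z \<in> cl (insert a D \<union> set (b # ys) ^ Suc n)"
    proof (rule Cons.IH[OF _ _ n n z(1)])
      show "z * q \<in> cl (insert (b ^ Suc t) (insert a D \<union> (\<lambda>y. y ^ Suc t) ` set ys))"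
        if "q \<in> set (b # ys) ^ (t + length ys * t - n)" for q
        using z(2)[of q] that by (simp del: power_Suc add: insert_commute)
    qed (use Cons.prems in auto)
  qed
qed

text \<open>Degree 0 of the duality: what kills all forms of the socle degree
  \<open>length xs * t\<close> has no constant term.\<close>

lemma colon_generators:
  assumes "creg D xs" "set xs \<subseteq> I"
    and "\<And>q. q \<in> set xs ^ (length xs * t) \<Longrightarrow> z * q \<in> cl (D \<union> (\<lambda>x. x ^ Suc t) ` set xs)"
  shows "z \<in> cl (D \<union> set xs)"
proof (cases xs)
  case Nil
  then show ?thesis using assms(3)[of 1] by (simp add: set_one)
next
  case (Cons a ys)
  have "z \<in> cl (D \<union> set (a # ys) ^ Suc 0)"
    by (rule socle_step[where m = t and t = t])
      (use assms Cons in \<open>auto simp: cl_Un_one simp del: power_Suc\<close>)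
  then show ?thesis using Cons by simp
qed

text \<open>With d = length xs, the degree complementary to n is d t - n, which is at least (d-1) t
  for n up to t. The duality therefore applies in the degrees 0, ..., t one after another and lifts
  z to degree t + 1.\<close>

lemma colon_powers:
  assumes "creg D xs" "set xs \<subseteq> I" "xs \<noteq> []"
    and z: "\<And>q. q \<in> set xs ^ ((length xs - 1) * t) \<Longrightarrow> z * q \<in> cl (D \<union> (\<lambda>x. x ^ Suc t) ` set xs)"
  shows "z \<in> cl (D \<union> set xs ^ Suc t)"
proof -
  obtain a ys where xs: "xs = a # ys" using assms(3) by (cases xs) auto
  have "z \<in> cl (D \<union> set (a # ys) ^ n)" if "n \<le> Suc t" for n
    using that
  proof (induction n)
    case 0
    then show ?case by (simp add: cl_Un_one)
  next
    case (Suc n)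
    show ?case
    proof (rule socle_step[where m = t and t = t])
      fix q assume "q \<in> set (a # ys) ^ (t + length ys * t - n)"
      moreover have "t + length ys * t - n = length ys * t + (t - n)" using Suc.prems by simp
      ultimately obtain q1 q2 where q: "q = q1 * q2" "q1 \<in> set (a # ys) ^ (length ys * t)"
        by (auto simp: power_add elim: set_times_elim)
      then have "z * q1 \<in> cl (insert (a ^ Suc t) (D \<union> (\<lambda>y. y ^ Suc t) ` set ys))"
        using z[of q1] xs by (simp del: power_Suc)
      then show "z * q \<in> cl (insert (a ^ Suc t) (D \<union> (\<lambda>y. y ^ Suc t) ` set ys))"
        using cl_multL[of "z * q1" _ q2] q by (simp add: ac_simps)
    qed (use Suc assms xs in auto)
  qed
  then show ?thesis using xs by blast
qed

section \<open>Pencils of linear forms\<close>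

lemma unit_mod_k:
  assumes "w * u - 1 \<in> k" "u * z \<in> cl X" shows "z \<in> cl X"
proof -
  have "w * (u * z) \<in> cl X" using assms(2) by (rule cl_scale)
  then show ?thesis using cl_unit[of "w * u" z X] assms(1) k_subset by (auto simp: mult.assoc)
qed

text \<open>Stands for an infinite field lifted to the ambient ring. Chosen preimages need not form
  a field, but invertibility of differences modulo \<open>k\<close> survives the choice.\<close>

definition separated :: "'a set \<Rightarrow> bool" where
  "separated K \<longleftrightarrow> (\<forall>u\<in>K. \<forall>v\<in>K. u \<noteq> v \<longrightarrow> (\<exists>w. w * (u - v) - 1 \<in> k))"

lemma separated_cancel:
  "separated K \<Longrightarrow> u \<in> K \<Longrightarrow> v \<in> K \<Longrightarrow> u \<noteq> v \<Longrightarrow> (u - v) * z \<in> cl X \<Longrightarrow> z \<in> cl X"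
  unfolding separated_def using unit_mod_k by metis

text \<open>Modulo x - u a, each form x - v a becomes (u - v) a, a unit times a.\<close>

lemma linear_forms_mod:
  assumes "separated K" "u \<in> K" "set us \<subseteq> K" "u \<notin> set us"
    and "x - u * a \<in> cl X" "g * (\<Prod>v\<leftarrow>us. x - v * a) \<in> cl X"
  shows "a ^ length us * g \<in> cl X"
  using assms(3,4,6)
proof (induction us arbitrary: g)
  case (Cons v us)
  let ?L = "\<Prod>v\<leftarrow>us. x - v * a"
  have "1 * (g * ((x - v * a) * ?L)) - (g * ?L) * (x - u * a) \<in> cl X"
    using Cons.prems(3) assms(5) by (intro cl_comb_diff) simp_all
  also have "1 * (g * ((x - v * a) * ?L)) - (g * ?L) * (x - u * a) = (u - v) * (g * a * ?L)"
    by (simp add: algebra_simps)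
  finally have "g * a * ?L \<in> cl X"
    by (rule separated_cancel[rotated -1]) (use Cons.prems assms(1,2) in auto)
  then have "a ^ length us * (g * a) \<in> cl X" using Cons.prems by (intro Cons.IH) auto
  then show ?case by (simp add: ac_simps)
qed simp

text \<open>Together with \<open>a\<close>, the elements x and x - c a generate the same ideal, so
  the sheared element can take the place of x; it is then swapped to the front.\<close>

lemma creg_shear:
  assumes creg: "creg D (a # x # xs)" and sub: "set (a # x # xs) \<subseteq> I"
  shows "creg (insert (x - c * a) D) (a # xs)"
proof -
  have xI: "x - c * a \<in> I" using sub I_ideal by (simp add: idl.subspace_diff idl.subspace_scale)
  have cl_eq: "cl (insert (x - c * a) (insert a D)) = cl (insert x (insert a D))"
  proof (rule cl_eqI)
    have "1 * x - c * a \<in> cl (insert x (insert a D))" by (rule cl_comb_diff) (simp_all add: cl_base)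
    then show "insert (x - c * a) (insert a D) \<subseteq> cl (insert x (insert a D))" by (auto intro: cl_base)
    have "1 * (x - c * a) + c * a \<in> cl (insert (x - c * a) (insert a D))"
      by (rule cl_comb) (simp_all add: cl_base)
    then show "insert x (insert a D) \<subseteq> cl (insert (x - c * a) (insert a D))" by (auto intro: cl_base)
  qed
  have reg: "reg (insert a D) (x - c * a)" unfolding reg_def
  proof (intro allI impI)
    fix z assume "(x - c * a) * z \<in> cl (insert a D)"
    then have "1 * ((x - c * a) * z) + (c * z) * a \<in> cl (insert a D)"
      by (rule cl_comb) (simp add: cl_base)
    then have "x * z \<in> cl (insert a D)" by (simp add: algebra_simps)
    moreover have "reg (insert a D) x" using creg by simp
    ultimately show "z \<in> cl (insert a D)" by (rule regD[rotated])
  qed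
  have "creg (insert (x - c * a) (insert a D)) xs"
    using creg creg_cong[OF cl_eq] by simp
  with reg have "creg D (a # (x - c * a) # xs)" using creg by simp
  then have "creg D ((x - c * a) # a # xs)" by (rule creg_swap) (use sub xI in auto)
  then show ?thesis by simp
qed

text \<open>Modulo the n-th power of V = (a, x, xs), f is divisible by one form x - u a after
  another. If f = g L with L a product of l such forms, then modulo a further form x - u a the
  factor L is a unit times a^l, and cancelling a^l puts g into (x - u a) plus a power n - l, so L
  gains the factor x - u a. After n forms L itself lies in V^n.\<close>

lemma pencil_intersection:
  assumes K: "separated K" "infinite K"
    and creg: "creg D (a # x # xs)" "set (a # x # xs) \<subseteq> I"
    and f: "\<And>c. c \<in> K \<Longrightarrow> f \<in> cl (insert (x - c * a) D \<union> set (a # xs) ^ n)"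
  shows "f \<in> cl (D \<union> set (a # x # xs) ^ n)"
proof -
  let ?Q = "set (a # xs)" and ?V = "set (a # x # xs)"
  let ?L = "\<lambda>us. \<Prod>v\<leftarrow>us. x - v * a"
  have creg_c: "creg (insert (x - c * a) D) (a # xs)" for c
    by (rule creg_shear[OF creg])
  have V_sub: "?V ^ m \<subseteq> cl (insert (x - u * a) D \<union> ?Q ^ m)" for u m
  proof -
    have "1 * (x - u * a) + u * a \<in> idl.span (insert (x - u * a) ?Q)"
      by (intro idl.span_add idl.span_scale idl.span_base) auto
    then have "?V \<subseteq> idl.span (insert (x - u * a) ?Q)" by (auto intro: idl.span_base)
    then have "?V ^ m \<subseteq> idl.span (insert (x - u * a) ?Q) ^ m" by (rule set_power_mono)
    also have "\<dots> \<subseteq> idl.span (insert (x - u * a) ?Q ^ m)" by (rule span_power_subset)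
    also have "\<dots> \<subseteq> cl (D \<union> insert (x - u * a) ?Q ^ m)"
      using cl_span cl_mono[of "insert (x - u * a) ?Q ^ m" "D \<union> insert (x - u * a) ?Q ^ m"] by blast
    also have "\<dots> \<subseteq> cl (insert (x - u * a) D \<union> ?Q ^ m)" by (rule cl_Un_power_insert)
    finally show ?thesis .
  qed
  have L_span: "?L us \<in> idl.span (?V ^ length us)" for us
  proof (induction us)
    case (Cons u us)
    have "x - u * a \<in> idl.span ?V"
      by (intro idl.span_diff idl.span_scale idl.span_base) auto
    from span_times[OF this Cons] show ?case by simp
  qed (simp add: set_one idl.span_base)
  have "f \<in> cl (insert (?L us) (D \<union> ?V ^ n))"
    if "distinct us" "set us \<subseteq> K" "length us \<le> n" for us
    using that
  proof (induction us)
    case Nil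
    show ?case using cl_scale[OF cl_base[of 1 "insert 1 (D \<union> ?V ^ n)"], of f] by simp
  next
    case (Cons u us)
    let ?D = "insert (x - u * a) D"
    have "f \<in> cl (insert (?L us) (D \<union> ?V ^ n))" using Cons by simp
    then obtain s g where sg: "s - 1 \<in> I" "s * f - g * ?L us \<in> cl (D \<union> ?V ^ n)"
      by (rule cl_insert_memE)
    have "cl (D \<union> ?V ^ n) \<subseteq> cl (?D \<union> ?Q ^ n)"
      using V_sub[of n u] by (intro cl_minimal) (auto intro: cl_base)
    then have "s * f - 1 * (s * f - g * ?L us) \<in> cl (?D \<union> ?Q ^ n)"
      by (intro cl_comb_diff[of f _ "s * f - g * ?L us"]) (use sg(2) f[of u] Cons.prems in auto)
    then have "g * ?L us \<in> cl (?D \<union> ?Q ^ n)" by simp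
    then have "a ^ length us * g \<in> cl (?D \<union> ?Q ^ n)"
      using Cons.prems by (intro linear_forms_mod[OF K(1), of u us x]) (auto intro: cl_base)
    then have "a ^ length us * g \<in> cl (?D \<union> ?Q ^ ((n - length us) + length us))"
      using Cons.prems by simp
    then have g: "g \<in> cl (?D \<union> ?Q ^ (n - length us))"
      by (rule creg_colon_power[OF creg_c, rotated]) (use creg(2) in auto)
    have "?L us * g \<in> cl (insert (?L (u # us)) (D \<union> ?V ^ n))"
    proof (rule cl_mult_into[OF _ g])
      fix y assume "y \<in> ?D \<union> ?Q ^ (n - length us)"
      then consider "y = x - u * a" | "y \<in> D" | "y \<in> ?Q ^ (n - length us)" by auto
      then show "?L us * y \<in> cl (insert (?L (u # us)) (D \<union> ?V ^ n))"
      proof cases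
        case 1
        then show ?thesis by (intro cl_base) (simp add: ac_simps)
      next
        case 2
        then show ?thesis by (intro cl_scale cl_base) simp
      next
        case 3
        then have "y \<in> idl.span (?V ^ (n - length us))"
          using set_power_mono[of ?Q ?V "n - length us"] by (intro idl.span_base) auto
        from span_times[OF L_span[of us] this]
        have "?L us * y \<in> idl.span (?V ^ n)" using Cons.prems by (simp flip: power_add)
        then show ?thesis using cl_span cl_mono[of "?V ^ n" "insert (?L (u # us)) (D \<union> ?V ^ n)"] by blast
      qed
    qed
    moreover have "s * f - g * ?L us \<in> cl (insert (?L (u # us)) (D \<union> ?V ^ n))"
      using sg(2) cl_mono[of "D \<union> ?V ^ n" "insert (?L (u # us)) (D \<union> ?V ^ n)"] by blast
    ultimately have "(s * f - g * ?L us) + ?L us * g \<in> cl (insert (?L (u # us)) (D \<union> ?V ^ n))"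
      by (rule cl_add[rotated])
    then show ?case using cl_unit[OF sg(1)] by (simp add: ac_simps)
  qed
  moreover obtain U where U: "U \<subseteq> K" "finite U" "card U = n"
    using infinite_arbitrarily_large[OF K(2)] by blast
  moreover obtain us where us: "set us = U" "distinct us" using finite_distinct_list[OF U(2)] by blast
  ultimately have "f \<in> cl (insert (?L us) (D \<union> ?V ^ n))" using distinct_card[of us] by auto
  moreover have "length us = n" using U us distinct_card[of us] by auto
  then have "?L us \<in> cl (D \<union> ?V ^ n)"
    using L_span[of us] cl_span cl_mono[of "?V ^ n" "D \<union> ?V ^ n"] by blast
  ultimately show ?thesis by (simp add: cl_absorb)
qed

text \<open>Setting each element of \<open>xs\<close> equal to a multiple c a, one pencil at a time,
  leaves the single generator \<open>a\<close>, and (a, xs)^n becomes (a^n).\<close>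

lemma lines_intersection:
  assumes K: "separated K" "infinite K"
    and "creg D (a # xs)" "set (a # xs) \<subseteq> I"
    and "\<And>cs. length cs = length xs \<Longrightarrow> set cs \<subseteq> K \<Longrightarrow>
      f \<in> cl (insert (a ^ n) (D \<union> set (map2 (\<lambda>x c. x - c * a) xs cs)))"
  shows "f \<in> cl (D \<union> set (a # xs) ^ n)"
  using assms(3-)
proof (induction xs arbitrary: D)
  case Nil
  then show ?case by (simp add: singleton_power)
next
  case (Cons x xs)
  show ?case
  proof (rule pencil_intersection[OF K Cons.prems(1,2)])
    fix c assume c: "c \<in> K"
    show "f \<in> cl (insert (x - c * a) D \<union> set (a # xs) ^ n)"
    proof (rule Cons.IH)
      show "creg (insert (x - c * a) D) (a # xs)" by (rule creg_shear[OF Cons.prems(1,2)])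
      show "f \<in> cl (insert (a ^ n) (insert (x - c * a) D \<union> set (map2 (\<lambda>x c. x - c * a) xs cs)))"
        if "length cs = length xs" "set cs \<subseteq> K" for cs
        using Cons.prems(3)[of "c # cs"] that c by (simp add: insert_commute)
    qed (use Cons.prems in auto)
  qed
qed

end

section \<open>Descending chains and Krull's height theorem\<close>

text \<open>The contraction of the extension of (X) to the localization at \<open>S\<close>. The
  \<open>saturated\<close> ideals correspond to the ideals of that localization.\<close>

definition saturate :: "'a::comm_ring_1 set \<Rightarrow> 'a set \<Rightarrow> 'a set" where
  "saturate S X = {z. \<exists>s\<in>S. s * z \<in> idl.span X}"

definition saturated :: "'a::comm_ring_1 set \<Rightarrow> 'a set \<Rightarrow> bool" where
  "saturated S B \<longleftrightarrow> idl.subspace B \<and> (\<forall>s\<in>S. \<forall>z. s * z \<in> B \<longrightarrow> z \<in> B)"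

lemma saturate_superset: "mult_closed S \<Longrightarrow> X \<subseteq> saturate S X"
  by (auto simp: saturate_def mult_closed_def idl.span_base intro!: bexI[of _ 1])

lemma saturated_saturate:
  assumes S: "mult_closed S" shows "saturated S (saturate S X)"
  unfolding saturated_def
proof (intro conjI ballI allI impI idl.subspaceI)
  show "0 \<in> saturate S X" using S by (auto simp: saturate_def mult_closed_def idl.span_zero)
  fix x y assume "x \<in> saturate S X" "y \<in> saturate S X"
  then obtain s s' where s: "s \<in> S" "s * x \<in> idl.span X" "s' \<in> S" "s' * y \<in> idl.span X"
    by (auto simp: saturate_def)
  have "s' * (s * x) + s * (s' * y) \<in> idl.span X" using s by (simp add: idl.span_add idl.span_scale)
  then have "(s * s') * (x + y) \<in> idl.span X" by (simp add: algebra_simps)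
  then show "x + y \<in> saturate S X" using s S by (auto simp: saturate_def mult_closed_def)
next
  fix c x assume "x \<in> saturate S X"
  then obtain s where s: "s \<in> S" "s * x \<in> idl.span X" by (auto simp: saturate_def)
  have "c * (s * x) \<in> idl.span X" using s by (simp add: idl.span_scale)
  then have "s * (c * x) \<in> idl.span X" by (simp add: ac_simps)
  then show "c * x \<in> saturate S X" using s by (auto simp: saturate_def)
next
  fix s z assume s: "s \<in> S" "s * z \<in> saturate S X"
  then obtain s' where "s' \<in> S" "s' * (s * z) \<in> idl.span X" by (auto simp: saturate_def)
  then have "s' * s \<in> S" "(s' * s) * z \<in> idl.span X"
    using s(1) S by (auto simp: mult_closed_def mult.assoc)
  then show "z \<in> saturate S X" by (auto simp: saturate_def)
qed

lemma saturate_mono: "X \<subseteq> Y \<Longrightarrow> saturate S X \<subseteq> saturate S Y"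
  using idl.span_mono[of X Y] by (auto simp: saturate_def)

lemma ideal_breakdown:
  assumes "idl.subspace A" "z \<in> idl.span (insert a A)"
  shows "\<exists>c. z - c * a \<in> A"
proof -
  have "idl.span A = A" using assms(1) by simp
  then show ?thesis using assms(2) idl.span_breakdown_eq[of z a A] by metis
qed

lemma prime_mult_closed: "prime_idl P \<Longrightarrow> mult_closed (- P)"
  by (auto simp: prime_idl_def mult_closed_def)

lemma prime_power: "prime_idl P \<Longrightarrow> x ^ n \<in> P \<Longrightarrow> x \<in> P"
  by (induction n) (auto simp: prime_idl_def)

lemma prime_subspace: "prime_idl P \<Longrightarrow> idl.subspace P"
  by (simp add: prime_idl_def)

text \<open>The minimal condition for the ideals of the localization at \<open>S\<close> of the
  quotient by \<open>A\<close>, that is, the statement that this ring is Artinian.\<close>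

definition dcc_above :: "'a::comm_ring_1 set \<Rightarrow> 'a set \<Rightarrow> bool" where
  "dcc_above S A \<longleftrightarrow> (\<forall>\<B>. \<B> \<noteq> {} \<longrightarrow> (\<forall>B\<in>\<B>. saturated S B \<and> A \<subseteq> B) \<longrightarrow>
     (\<exists>B\<in>\<B>. \<forall>B'\<in>\<B>. B' \<subseteq> B \<longrightarrow> B' = B))"

lemma dcc_aboveD:
  assumes "dcc_above S A" "\<B> \<noteq> {}" "\<And>B. B \<in> \<B> \<Longrightarrow> saturated S B \<and> A \<subseteq> B"
  obtains B where "B \<in> \<B>" "\<And>B'. B' \<in> \<B> \<Longrightarrow> B' \<subseteq> B \<Longrightarrow> B' = B"
  using assms unfolding dcc_above_def by meson

lemma dcc_above_trivial:
  assumes "\<And>B. saturated S B \<Longrightarrow> A \<subseteq> B \<Longrightarrow> B = A \<or> B = UNIV"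
  shows "dcc_above S A"
  unfolding dcc_above_def
proof (intro allI impI)
  fix \<B> assume ne: "\<B> \<noteq> {}" and B: "\<forall>B\<in>\<B>. saturated S B \<and> A \<subseteq> B"
  show "\<exists>B\<in>\<B>. \<forall>B'\<in>\<B>. B' \<subseteq> B \<longrightarrow> B' = B"
  proof (cases "A \<in> \<B>")
    case True
    then show ?thesis using B by (intro bexI[of _ A]) auto
  next
    case False
    then have "B = UNIV" if "B \<in> \<B>" for B using assms[of B] B that by auto
    then show ?thesis using ne by auto
  qed
qed

text \<open>If \<open>f * g \<in> A\<close>, a decreasing family above \<open>A\<close> is controlled by its traces
  \<open>B + (f)\<close>, which lie above \<open>A + (f)\<close>, and \<open>B : f\<close>, which lie above \<open>A + (g)\<close>.\<close>

lemma dcc_above_split: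
  assumes S: "mult_closed S" and A: "idl.subspace A" "f * g \<in> A"
    and f: "dcc_above S (idl.span (insert f A))" and g: "dcc_above S (idl.span (insert g A))"
  shows "dcc_above S A"
  unfolding dcc_above_def
proof (intro allI impI)
  fix \<B> assume ne: "\<B> \<noteq> {}" and \<B>: "\<forall>B\<in>\<B>. saturated S B \<and> A \<subseteq> B"
  let ?M = "\<lambda>B. saturate S (insert f B)" and ?C = "\<lambda>B. {c. f * c \<in> B}"
  have M: "saturated S (?M B) \<and> idl.span (insert f A) \<subseteq> ?M B" if "B \<in> \<B>" for B
  proof -
    have "insert f A \<subseteq> ?M B" using saturate_superset[OF S, of "insert f B"] \<B> that by auto
    moreover have "saturated S (?M B)" by (rule saturated_saturate[OF S])
    ultimately show ?thesis by (simp add: idl.span_minimal saturated_def)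
  qed
  have C: "saturated S (?C B) \<and> idl.span (insert g A) \<subseteq> ?C B" if "B \<in> \<B>" for B
  proof -
    have B: "idl.subspace B" "A \<subseteq> B" "\<And>s z. s \<in> S \<Longrightarrow> s * z \<in> B \<Longrightarrow> z \<in> B"
      using \<B> that by (auto simp: saturated_def)
    have "saturated S (?C B)" unfolding saturated_def
    proof (intro conjI ballI allI impI idl.subspaceI; simp)
      show "0 \<in> B" by (rule idl.subspace_0[OF B(1)])
      show "f * (x + y) \<in> B" if "f * x \<in> B" "f * y \<in> B" for x y
        using idl.subspace_add[OF B(1) that] by (simp add: algebra_simps)
      show "f * (c * x) \<in> B" if "f * x \<in> B" for c x
        using idl.subspace_scale[OF B(1) that, of c] by (simp add: ac_simps)
      show "f * z \<in> B" if "s \<in> S" "f * (s * z) \<in> B" for s z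
        using B(3)[OF that(1), of "f * z"] that(2) by (simp add: ac_simps)
    qed
    moreover have "insert g A \<subseteq> ?C B" using A(2) B(1,2) by (auto intro: idl.subspace_scale)
    ultimately show ?thesis by (simp add: idl.span_minimal saturated_def)
  qed
  have "?M ` \<B> \<noteq> {}" using ne by simp
  then obtain M0 where M0: "M0 \<in> ?M ` \<B>" "\<And>B'. B' \<in> ?M ` \<B> \<Longrightarrow> B' \<subseteq> M0 \<Longrightarrow> B' = M0"
    using dcc_aboveD[OF f, of "?M ` \<B>"] M by (metis (no_types, lifting) imageE)
  define \<B>' where "\<B>' = {B \<in> \<B>. ?M B = M0}"
  have "?C ` \<B>' \<noteq> {}" using M0(1) by (auto simp: \<B>'_def)
  moreover have "saturated S B \<and> idl.span (insert g A) \<subseteq> B" if "B \<in> ?C ` \<B>'" for B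
    using that C by (auto simp: \<B>'_def)
  ultimately obtain C0 where C0: "C0 \<in> ?C ` \<B>'" "\<And>B'. B' \<in> ?C ` \<B>' \<Longrightarrow> B' \<subseteq> C0 \<Longrightarrow> B' = C0"
    using dcc_aboveD[OF g, of "?C ` \<B>'"] by metis
  then obtain B where B: "B \<in> \<B>" "?M B = M0" "?C B = C0" by (auto simp: \<B>'_def)
  have "B' = B" if B': "B' \<in> \<B>" "B' \<subseteq> B" for B'
  proof
    have "?M B' \<subseteq> M0" using B(2) saturate_mono[of "insert f B'" "insert f B" S] B'(2) by auto
    then have M': "?M B' = M0" using M0(2) B'(1) by blast
    then have "?C B' \<in> ?C ` \<B>'" using B'(1) by (auto simp: \<B>'_def)
    moreover have "?C B' \<subseteq> C0" using B'(2) B(3) by blast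
    ultimately have C': "?C B' = C0" by (rule C0(2))
    have sub: "idl.subspace B" "idl.subspace B'" "\<And>s z. s \<in> S \<Longrightarrow> s * z \<in> B' \<Longrightarrow> z \<in> B'"
      using \<B> B B' by (auto simp: saturated_def)
    show "B \<subseteq> B'"
    proof
      fix b assume b: "b \<in> B"
      then have "b \<in> ?M B'" using saturate_superset[OF S, of "insert f B"] B(2) M' by auto
      then obtain s where s: "s \<in> S" "s * b \<in> idl.span (insert f B')" by (auto simp: saturate_def)
      moreover have "idl.span B' = B'" using sub(2) by simp
      ultimately obtain c where c: "s * b - c * f \<in> B'" using idl.span_breakdown_eq[of "s * b" f B'] by auto
      have "s * b - (s * b - c * f) \<in> B"
        by (rule idl.subspace_diff[OF sub(1) idl.subspace_scale[OF sub(1) b]]) (use c B'(2) in auto)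
      then have "f * c \<in> B" by (simp add: ac_simps)
      then have "f * c \<in> B'" using B(3) C' by blast
      then have "(s * b - c * f) + f * c \<in> B'" by (rule idl.subspace_add[OF sub(2) c])
      then show "b \<in> B'" using sub(3)[OF s(1)] by (simp add: ac_simps)
    qed
  qed (use B' in auto)
  then show "\<exists>B\<in>\<B>. \<forall>B'\<in>\<B>. B' \<subseteq> B \<longrightarrow> B' = B" using B(1) by blast
qed

context noeth_mod
begin

text \<open>Noetherian induction behind the fact that a Noetherian ring with all primes maximal is
  Artinian. At a maximal counterexample M: if M meets \<open>S\<close> or is prime, no saturated
  ideal lies strictly between M and the whole ring; otherwise f g lies in M with f and g outside,
  and \<open>dcc_above_split\<close> reduces M to two larger ideals.\<close>

theorem dcc_above_ideal:
  assumes S: "mult_closed S"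
    and A: "idl.subspace A" "k \<subseteq> A"
    and max: "\<And>P B. prime_idl P \<Longrightarrow> A \<subseteq> P \<Longrightarrow> P \<inter> S = {} \<Longrightarrow> idl.subspace B \<Longrightarrow> P \<subset> B \<Longrightarrow> B \<inter> S \<noteq> {}"
  shows "dcc_above S A"
proof (rule ccontr)
  assume "\<not> dcc_above S A"
  let ?F = "{B. idl.subspace B \<and> A \<subseteq> B \<and> \<not> dcc_above S B}"
  have "A \<in> ?F" using A \<open>\<not> dcc_above S A\<close> by simp
  then have "?F \<noteq> {}" by blast
  moreover have "idl.subspace B \<and> k \<subseteq> B" if "B \<in> ?F" for B using that A by auto
  ultimately obtain M where M: "M \<in> ?F" "\<And>B. B \<in> ?F \<Longrightarrow> M \<subseteq> B \<Longrightarrow> B = M"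
    using ex_maximal[of ?F] by meson
  have larger: "dcc_above S (idl.span (insert f M))" if "f \<notin> M" for f
  proof (rule ccontr)
    assume "\<not> ?thesis"
    moreover have "insert f M \<subseteq> idl.span (insert f M)" by (rule idl.span_superset)
    ultimately have "idl.span (insert f M) = M" using M(1) by (intro M(2)) auto
    then show False using that idl.span_base[of f "insert f M"] by auto
  qed
  have one: "B = UNIV" if "saturated S B" "s \<in> S" "s \<in> B" for B s
    using that by (auto simp: saturated_def) (metis idl.subspace_scale mult.right_neutral)
  show False
  proof (cases "M \<inter> S = {}")
    case False
    then have "dcc_above S M" using one by (intro dcc_above_trivial) blast
    then show False using M(1) by simp
  next
    case disj: True
    show False
    proof (cases "prime_idl M")
      case True
      have "dcc_above S M"
      proof (rule dcc_above_trivial)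
        fix B assume B: "saturated S B" "M \<subseteq> B"
        show "B = M \<or> B = UNIV"
        proof (cases "B = M")
          case False
          then have "B \<inter> S \<noteq> {}" using B M(1) disj True by (intro max[of M B]) (auto simp: saturated_def)
          then show ?thesis using one[OF B(1)] by auto
        qed simp
      qed
      then show False using M(1) by simp
    next
      case False
      have "1 \<notin> M" using disj S by (auto simp: mult_closed_def)
      then obtain f g where fg: "f * g \<in> M" "f \<notin> M" "g \<notin> M"
        using False M(1) by (auto simp: prime_idl_def)
      then have "dcc_above S M" using M(1) larger by (intro dcc_above_split[OF S, of M f g]) auto
      then show False using M(1) by simp
    qed
  qed
qed

text \<open>The multiplicative set of all g x^n with g outside \<open>P\<close> localizes at
  \<open>P\<close> and inverts x at the same time.\<close>

lemma prime_below:
  assumes P: "prime_idl P" and A: "idl.subspace A" "k \<subseteq> A"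
    and disj: "\<And>g n. g \<notin> P \<Longrightarrow> g * x ^ n \<notin> A"
  shows "\<exists>Q. prime_idl Q \<and> A \<subseteq> Q \<and> Q \<subseteq> P \<and> x \<notin> Q"
proof -
  let ?S = "{g * x ^ n |g n. g \<notin> P}"
  have "1 \<notin> P" using P by (simp add: prime_idl_def)
  have "mult_closed ?S" unfolding mult_closed_def
  proof (intro conjI ballI)
    have "1 * x ^ 0 \<in> ?S" using \<open>1 \<notin> P\<close> by blast
    then show "1 \<in> ?S" by simp
    fix a b assume "a \<in> ?S" "b \<in> ?S"
    then obtain g n h m where "a = g * x ^ n" "b = h * x ^ m" "g \<notin> P" "h \<notin> P" by auto
    moreover from this have "g * h \<notin> P" using P by (auto simp: prime_idl_def)
    ultimately show "a * b \<in> ?S" by (auto intro!: exI[of _ "g * h"] exI[of _ "n + m"] simp: power_add ac_simps)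
  qed
  moreover have "A \<inter> ?S = {}" using disj by auto
  ultimately obtain Q where Q: "prime_idl Q" "A \<subseteq> Q" "Q \<inter> ?S = {}"
    using ex_prime_disjoint[OF A] by meson
  have "Q \<subseteq> P"
  proof
    fix z assume z: "z \<in> Q"
    show "z \<in> P"
    proof (rule ccontr)
      assume "z \<notin> P"
      then have "z * x ^ 0 \<in> ?S" by blast
      then show False using z Q(3) by auto
    qed
  qed
  moreover have "1 * x ^ 1 \<in> ?S" using \<open>1 \<notin> P\<close> by blast
  then have "x \<notin> Q" using Q(3) by auto
  ultimately show ?thesis using Q by blast
qed

text \<open>Krull's principal ideal theorem in the domain modulo \<open>Q0\<close>. For b in
  \<open>Q\<close> outside \<open>Q0\<close>, \<open>B n\<close> is the contraction of (b^n) from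
  the localization at \<open>Q\<close>. Modulo \<open>a\<close> and locally at \<open>P\<close> the
  ring is Artinian, so B n = B (n+1) + a B n there for some n, and Nakayama gives B n = B (n+1).
  Since powers of one element b replace the symbolic powers of \<open>Q\<close>, the contradiction
  is a cancellation of b^n modulo \<open>Q0\<close>, which makes some s outside \<open>Q\<close> a
  multiple of b.\<close>

theorem principal_ideal_theorem:
  assumes pr: "prime_idl Q0" "prime_idl Q" "prime_idl P" and k: "k \<subseteq> Q0"
    and lt: "Q0 \<subset> Q" "Q \<subset> P" and a: "a \<in> P"
    and min: "\<And>P'. prime_idl P' \<Longrightarrow> insert a Q0 \<subseteq> P' \<Longrightarrow> P' \<subseteq> P \<Longrightarrow> P' = P"
  shows False
proof -
  note sub = prime_subspace[OF pr(1)] prime_subspace[OF pr(2)] prime_subspace[OF pr(3)]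
  obtain b where b: "b \<in> Q" "b \<notin> Q0" using lt by blast
  define B where "B n = saturate (- Q) (insert (b ^ n) Q0)" for n
  have satQ: "saturated (- Q) (B n)" for n
    unfolding B_def by (rule saturated_saturate[OF prime_mult_closed[OF pr(2)]])
  then have B: "idl.subspace (B n)" "\<And>s z. s \<notin> Q \<Longrightarrow> s * z \<in> B n \<Longrightarrow> z \<in> B n" for n
    by (auto simp: saturated_def)
  have supB: "insert (b ^ n) Q0 \<subseteq> B n" for n
    unfolding B_def by (rule saturate_superset[OF prime_mult_closed[OF pr(2)]])
  have dec: "B (Suc n) \<subseteq> B n" for n
  proof
    fix z assume "z \<in> B (Suc n)"
    then obtain s where s: "s \<notin> Q" "s * z \<in> idl.span (insert (b ^ Suc n) Q0)"
      by (auto simp: B_def saturate_def)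
    have "insert (b ^ Suc n) Q0 \<subseteq> B n" using supB[of n] B(1)[of n] by (auto intro: idl.subspace_scale)
    then have "s * z \<in> B n" using s(2) idl.span_minimal[OF _ B(1)] by blast
    then show "z \<in> B n" by (rule B(2)[OF s(1)])
  qed
  have aQ: "a \<notin> Q" using min[OF pr(2)] lt by auto
  let ?A = "idl.span (insert a Q0)" and ?M = "\<lambda>n. saturate (- P) (insert a (B n))"
  have SP: "mult_closed (- P)" by (rule prime_mult_closed[OF pr(3)])
  have "dcc_above (- P) ?A"
  proof (rule dcc_above_ideal[OF SP])
    show "k \<subseteq> ?A" using k idl.span_superset[of "insert a Q0"] by auto
    fix P' B assume "prime_idl P'" "?A \<subseteq> P'" "P' \<inter> - P = {}" "P' \<subset> B"
    moreover have "insert a Q0 \<subseteq> ?A" by (rule idl.span_superset)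
    ultimately have "P' = P" by (intro min) auto
    then show "B \<inter> - P \<noteq> {}" using \<open>P' \<subset> B\<close> by auto
  qed simp
  moreover have "saturated (- P) M \<and> ?A \<subseteq> M" if "M \<in> range ?M" for M
  proof -
    obtain n where n: "M = ?M n" using \<open>M \<in> range ?M\<close> by blast
    have "saturated (- P) M" unfolding n by (rule saturated_saturate[OF SP])
    moreover have "insert a Q0 \<subseteq> M" using saturate_superset[OF SP, of "insert a (B n)"] supB[of n] n by auto
    ultimately show ?thesis by (simp add: idl.span_minimal saturated_def)
  qed
  ultimately obtain M where M: "M \<in> range ?M" "\<And>M'. M' \<in> range ?M \<Longrightarrow> M' \<subseteq> M \<Longrightarrow> M' = M"
    using dcc_aboveD[of "- P" ?A "range ?M"] by (metis (no_types, lifting) empty_iff rangeI)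
  then obtain n where n: "M = ?M n" by blast
  have "?M (Suc n) \<subseteq> ?M n" using dec by (intro saturate_mono) auto
  then have eq: "?M (Suc n) = ?M n" using M(2)[of "?M (Suc n)"] n by auto
  obtain H where H: "finite H" "B n = idl.span (H \<union> k)"
    using finitely_generated[OF B(1)[of n]] supB[of n] k by auto
  obtain hs where hs: "set hs = H" using finite_list[OF H(1)] by blast
  have "\<exists>s\<in>- P. s * h \<in> idl.span (B (Suc n) \<union> P * set hs)" if h: "h \<in> set hs" for h
  proof -
    have "h \<in> B n" using h hs H(2) idl.span_base[of h "H \<union> k"] by auto
    then have "h \<in> ?M n" using saturate_superset[OF SP, of "insert a (B n)"] by auto
    then have "h \<in> ?M (Suc n)" using eq by simp
    then obtain s where s: "s \<notin> P" "s * h \<in> idl.span (insert a (B (Suc n)))" by (auto simp: saturate_def)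
    moreover have "idl.span (B (Suc n)) = B (Suc n)" using B(1) by simp
    ultimately obtain c where c: "s * h - c * a \<in> B (Suc n)"
      using idl.span_breakdown_eq[of "s * h" a "B (Suc n)"] by auto
    have "s * h - (s * h - c * a) \<in> B n"
      by (rule idl.subspace_diff[OF B(1) idl.subspace_scale[OF B(1) \<open>h \<in> B n\<close>]]) (use c dec in auto)
    then have "a * c \<in> B n" by (simp add: ac_simps)
    \<comment> \<open>\<open>a\<close> lies outside \<open>Q\<close> by the minimality of
      \<open>P\<close>, and \<open>B n\<close> is saturated for the complement of
      \<open>Q\<close>.\<close>
    then have "c \<in> B n" by (rule B(2)[OF aQ])
    then have "c \<in> idl.span (H \<union> k)" using H(2) by simp
    then have "a * c \<in> idl.span (B (Suc n) \<union> P * set hs)"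
    proof (rule span_times_subset[OF _ idl.span_base[of a "{a}"], rotated 2])
      fix x y assume "x \<in> {a}" "y \<in> H \<union> k"
      then consider "x = a" "y \<in> H" | "x = a" "y \<in> k" by auto
      then show "x * y \<in> idl.span (B (Suc n) \<union> P * set hs)"
      proof cases
        case 1
        then show ?thesis using a hs by (intro idl.span_base) auto
      next
        case 2
        then have "y \<in> B (Suc n)" using supB[of "Suc n"] k by auto
        then show ?thesis by (simp add: idl.span_base idl.span_scale)
      qed
    qed simp
    moreover have "s * h - c * a \<in> idl.span (B (Suc n) \<union> P * set hs)"
      using c by (simp add: idl.span_base)
    ultimately have "(s * h - c * a) + a * c \<in> idl.span (B (Suc n) \<union> P * set hs)"
      by (rule idl.span_add[rotated])
    then show ?thesis using s(1) by (auto simp: ac_simps)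
  qed
  moreover have "s - i \<in> - P" if "s \<in> - P" "i \<in> P" for s i
  proof
    assume "s - i \<in> P"
    then have "(s - i) + i \<in> P" using that(2) by (rule idl.subspace_add[OF sub(3)])
    then show False using that(1) by simp
  qed
  ultimately obtain s where s: "s \<in> - P" "\<And>h. h \<in> set hs \<Longrightarrow> s * h \<in> idl.span (B (Suc n))"
    using nakayama[OF sub(3) SP, of hs "B (Suc n)"] by blast
  moreover have "idl.span (B (Suc n)) = B (Suc n)" using B(1) by simp
  ultimately have "h \<in> B (Suc n)" if "h \<in> set hs" for h
    using B(2)[of s h "Suc n"] lt(2) that by auto
  then have "H \<union> k \<subseteq> B (Suc n)" using hs supB[of "Suc n"] k by auto
  then have "B n \<subseteq> B (Suc n)" using H(2) B(1) by (simp add: idl.span_minimal)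
  then have "b ^ n \<in> B (Suc n)" using supB[of n] by auto
  then obtain s where s: "s \<notin> Q" "s * b ^ n \<in> idl.span (insert (b ^ Suc n) Q0)"
    by (auto simp: B_def saturate_def)
  then obtain c where "s * b ^ n - c * b ^ Suc n \<in> Q0"
    using ideal_breakdown[OF sub(1)] by blast
  then have "b ^ n * (s - c * b) \<in> Q0" by (simp add: algebra_simps)
  then have "s - c * b \<in> Q0" using pr(1) prime_power[OF pr(1)] b(2) by (auto simp: prime_idl_def)
  then have "(s - c * b) + c * b \<in> Q"
    using lt b by (intro idl.subspace_add[OF sub(2)] idl.subspace_scale[OF sub(2)]) auto
  then show False using s(1) by simp
qed

section \<open>Height of primes over a finite sequence\<close>

definition prime_chain_to :: "(nat \<Rightarrow> 'a set) \<Rightarrow> nat \<Rightarrow> 'a set \<Rightarrow> bool" where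
  "prime_chain_to C n P \<longleftrightarrow> C n = P \<and> (\<forall>i\<le>n. prime_idl (C i) \<and> k \<subseteq> C i) \<and> (\<forall>i<n. C i \<subset> C (Suc i))"

text \<open>Let Q be a prime directly below \<open>P\<close> that contains the penultimate prime of
  the chain, and \<open>a\<close> a generator outside Q. As \<open>P\<close> is minimal over Q +
  (a), each generator x has a power that equals c a modulo Q up to a factor s outside
  \<open>P\<close>. The corrected generators \<open>bs\<close> lie in Q. If a prime Q' strictly
  below Q contained them, \<open>P\<close> would be minimal over Q' + (a), against the principal
  ideal theorem; so the induction applies to Q and \<open>bs\<close>, which is shorter by
  one.\<close>

theorem krull_height:
  assumes "prime_chain_to C n P" "set as \<subseteq> P"
    and "\<And>P'. prime_idl P' \<Longrightarrow> set as \<union> k \<subseteq> P' \<Longrightarrow> P' \<subseteq> P \<Longrightarrow> P' = P"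
  shows "n \<le> length as"
  using assms
proof (induction "length as" arbitrary: as C n P)
  case 0
  show ?case
  proof (rule ccontr)
    assume "\<not> n \<le> length as"
    then obtain m where m: "n = Suc m" by (cases n) auto
    then have C: "prime_idl (C m)" "k \<subseteq> C m" "C m \<subset> P" using 0(2) by (auto simp: prime_chain_to_def)
    have "C m = P" using 0(1) C by (intro 0(4)) auto
    then show False using C by simp
  qed
next
  case (Suc l)
  show ?case
  proof (cases n)
    case (Suc m)
    have C: "C n = P" "\<And>i. i \<le> n \<Longrightarrow> prime_idl (C i) \<and> k \<subseteq> C i" "\<And>i. i < n \<Longrightarrow> C i \<subset> C (Suc i)"
      using Suc.prems(1) by (auto simp: prime_chain_to_def)
    have P: "prime_idl P" using C(1) C(2)[of n] by simp
    let ?F = "{Q. prime_idl Q \<and> C m \<subseteq> Q \<and> Q \<subset> P}"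
    have "C m \<in> ?F" using C(1) C(2)[of m] C(3)[of m] Suc by auto
    then have "?F \<noteq> {}" by blast
    moreover have "idl.subspace B \<and> k \<subseteq> B" if "B \<in> ?F" for B
      using that C(2)[of m] Suc by (auto simp: prime_idl_def)
    ultimately obtain Q where Q: "Q \<in> ?F" "\<And>B. B \<in> ?F \<Longrightarrow> Q \<subseteq> B \<Longrightarrow> B = Q"
      using ex_maximal[of ?F] by meson
    have kQ: "k \<subseteq> Q" using Q(1) C(2)[of m] Suc by auto
    have "\<not> set as \<subseteq> Q" using Q(1) kQ Suc.prems(3)[of Q] by auto
    then obtain a where a: "a \<in> set as" "a \<notin> Q" by blast
    have minP: "P' = P" if "prime_idl P'" "insert a Q \<subseteq> P'" "P' \<subseteq> P" for P'
    proof (rule ccontr)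
      assume "P' \<noteq> P"
      then have "P' = Q" using that Q(1) by (intro Q(2)) auto
      then show False using that a by auto
    qed
    have "\<exists>s N c. s \<notin> P \<and> s * x ^ N - c * a \<in> Q" if x: "x \<in> set as" for x
    proof (rule ccontr)
      assume neg: "\<not> ?thesis"
      have span_Q: "idl.span Q = Q" using Q(1) by (simp add: prime_idl_def)
      have "g * x ^ N - c * a \<in> Q" if "g * x ^ N - c * a \<in> idl.span Q" for g N c
        using that unfolding span_Q .
      then have "g * x ^ N \<notin> idl.span (insert a Q)" if "g \<notin> P" for g N
        using neg that unfolding idl.span_breakdown_eq by blast
      moreover have "insert a Q \<subseteq> idl.span (insert a Q)" by (rule idl.span_superset)
      ultimately obtain P' where P': "prime_idl P'" "insert a Q \<subseteq> P'" "P' \<subseteq> P" "x \<notin> P'"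
        using prime_below[OF P, of "idl.span (insert a Q)" x] kQ by (metis idl.subspace_span insert_subset order_trans)
      then show False using minP[OF P'(1-3)] x Suc.prems(2) by auto
    qed
    then obtain s N c where snc: "\<And>x. x \<in> set as \<Longrightarrow> s x \<notin> P \<and> s x * x ^ N x - c x * a \<in> Q"
      by metis
    define bs where "bs = map (\<lambda>x. s x * x ^ N x - c x * a) (remove1 a as)"
    have len: "length bs = l" using Suc.hyps(2) a by (simp add: bs_def length_remove1)
    define C' where "C' = C(m := Q)"
    have "prime_chain_to C' m Q"
      unfolding prime_chain_to_def
    proof (intro conjI allI impI)
      show "C' m = Q" by (simp add: C'_def)
      show "prime_idl (C' i)" "k \<subseteq> C' i" if "i \<le> m" for i
        using that C(2)[of i] Q(1) kQ Suc by (auto simp: C'_def)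
      show "C' i \<subset> C' (Suc i)" if "i < m" for i
        using that C(3)[of i] Q(1) Suc by (auto simp: C'_def)
    qed
    moreover have "set bs \<subseteq> Q" using snc set_remove1_subset[of a as] by (auto simp: bs_def)
    moreover have "Q' = Q" if Q': "prime_idl Q'" "set bs \<union> k \<subseteq> Q'" "Q' \<subseteq> Q" for Q'
    proof (rule ccontr)
      assume "Q' \<noteq> Q"
      show False
      proof (rule principal_ideal_theorem[OF Q'(1) _ P, of Q a])
        fix P' assume P': "prime_idl P'" "insert a Q' \<subseteq> P'" "P' \<subseteq> P"
        have "x \<in> P'" if x: "x \<in> set as" for x
        proof (cases "x = a")
          case False
          then have "x \<in> set (remove1 a as)" using x by (simp add: in_set_remove1)
          then have "s x * x ^ N x - c x * a \<in> P'" using Q'(2) P'(2) by (auto simp: bs_def)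
          then have "(s x * x ^ N x - c x * a) + c x * a \<in> P'"
            using P' by (intro idl.subspace_add idl.subspace_scale) (auto simp: prime_idl_def)
          then have "s x \<in> P' \<or> x ^ N x \<in> P'" using P'(1) by (auto simp: prime_idl_def)
          then show ?thesis using snc[OF x] P'(3) prime_power[OF P'(1)] by blast
        qed (use P' in auto)
        then show "P' = P" using P' Q' by (intro Suc.prems(3)) auto
      qed (use Q' Q(1) \<open>Q' \<noteq> Q\<close> a Suc.prems(2) in auto)
    qed
    ultimately have "m \<le> length bs" using Suc.hyps(1)[of bs C' m Q] len by simp
    then show ?thesis using len Suc.hyps(2) Suc by simp
  qed simp
qed

text \<open>Let A be the ideal of the first i elements and x the next one. If g x^n were in A with g
  outside \<open>P\<close>, cancelling x would put g into A and so into \<open>P\<close>. Hence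
  \<open>prime_below\<close> finds a prime under \<open>P\<close> that contains A and omits x: one
  step of the chain for each element.\<close>

lemma prime_chain_of_regular:
  assumes "\<And>i z. i < length as \<Longrightarrow> as ! i * z \<in> idl.span (set (take i as) \<union> k) \<Longrightarrow> z \<in> idl.span (set (take i as) \<union> k)"
    and "i \<le> length as" "prime_idl P" "set (take i as) \<union> k \<subseteq> P"
  shows "\<exists>C. prime_chain_to C i P"
  using assms(2-)
proof (induction i arbitrary: P)
  case 0
  then show ?case by (intro exI[of _ "\<lambda>_. P"]) (simp add: prime_chain_to_def)
next
  case (Suc i)
  let ?A = "idl.span (set (take i as) \<union> k)"
  have take: "set (take i as) \<subseteq> set (take (Suc i) as)" by (rule set_take_subset_set_take) simp
  then have AP: "?A \<subseteq> P" using Suc.prems by (intro idl.span_minimal) (auto simp: prime_idl_def)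
  have cancel: "g \<in> ?A" if "g * (as ! i) ^ n \<in> ?A" for g n
    using that
  proof (induction n)
    case (Suc n)
    then have "as ! i * (g * (as ! i) ^ n) \<in> ?A" by (simp add: ac_simps)
    then have "g * (as ! i) ^ n \<in> ?A" by (rule assms(1)[rotated]) (use \<open>Suc i \<le> length as\<close> in simp)
    then show ?case by (rule Suc.IH)
  qed simp
  have "\<exists>Q. prime_idl Q \<and> ?A \<subseteq> Q \<and> Q \<subseteq> P \<and> as ! i \<notin> Q"
  proof (rule prime_below[OF Suc.prems(2)])
    show "k \<subseteq> ?A" using idl.span_superset[of "set (take i as) \<union> k"] by simp
    show "g * (as ! i) ^ n \<notin> ?A" if "g \<notin> P" for g n using cancel[of g n] \<open>?A \<subseteq> P\<close> that by blast
  qed simp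
  then obtain Q where Q: "prime_idl Q" "?A \<subseteq> Q" "Q \<subseteq> P" "as ! i \<notin> Q" by blast
  have "set (take i as) \<union> k \<subseteq> Q" using Q(2) idl.span_superset[of "set (take i as) \<union> k"] by blast
  then obtain C where C: "prime_chain_to C i Q" using Suc.IH[OF _ Q(1)] Suc.prems(1) by auto
  have "as ! i \<in> set (take (Suc i) as)" using Suc.prems(1) by (simp add: take_Suc_conv_app_nth)
  then have "Q \<subset> P" using Q Suc.prems(3) by blast
  have "prime_chain_to (C(Suc i := P)) (Suc i) P"
    unfolding prime_chain_to_def
  proof (intro conjI allI impI)
    show "(C(Suc i := P)) (Suc i) = P" by simp
    show "prime_idl ((C(Suc i := P)) j)" "k \<subseteq> (C(Suc i := P)) j" if "j \<le> Suc i" for j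
      using that C Suc.prems(2,3) by (auto simp: prime_chain_to_def)
    show "(C(Suc i := P)) j \<subset> (C(Suc i := P)) (Suc j)" if "j < Suc i" for j
      using that C \<open>Q \<subset> P\<close> by (auto simp: prime_chain_to_def)
  qed
  then show ?case by blast
qed

end

section \<open>Formal reductions and nilpotence in the associated graded ring\<close>

lemma span_sum_breakdown:
  fixes y :: "nat \<Rightarrow> 'a::comm_ring_1"
  assumes "z \<in> idl.span (X \<union> y ` {..<n})"
  shows "\<exists>c. z - (\<Sum>i<n. c i * y i) \<in> idl.span X"
  using assms
proof (induction n arbitrary: z)
  case (Suc n)
  have "X \<union> y ` {..<Suc n} = insert (y n) (X \<union> y ` {..<n})" by (auto simp: lessThan_Suc)
  then obtain e where "z - e * y n \<in> idl.span (X \<union> y ` {..<n})"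
    using Suc.prems by (auto simp: idl.span_breakdown_eq)
  then obtain c where c: "z - e * y n - (\<Sum>i<n. c i * y i) \<in> idl.span X" using Suc.IH by blast
  have "(\<Sum>i<Suc n. (c(n := e)) i * y i) = (\<Sum>i<n. c i * y i) + e * y n" by simp
  then have "z - (\<Sum>i<Suc n. (c(n := e)) i * y i) \<in> idl.span X" using c by (simp add: algebra_simps)
  then show ?case by blast
qed simp

context noeth_pair
begin

section \<open>Single degrees of the associated graded ring\<close>

definition formal_red :: "'a set \<Rightarrow> bool" where
  "formal_red E \<longleftrightarrow> (\<exists>n. I ^ Suc n \<subseteq> cl (E * I ^ n))"

definition pw :: "nat \<Rightarrow> 'a set" where
  "pw m = idl.span (I ^ m \<union> k)"

text \<open>\<open>pw m / fil D m\<close> is the component of degree \<open>m\<close> of the associated graded ring of \<open>I\<close> modulo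
  the initial forms of degree 1 of the elements of \<open>D\<close>; for \<open>m = 0\<close> the subtraction is truncated,
  which is harmless.\<close>

definition fil :: "'a set \<Rightarrow> nat \<Rightarrow> 'a set" where
  "fil D m = idl.span (D * I ^ (m - 1) \<union> I ^ Suc m \<union> k)"

text \<open>Multiplication by the initial form of \<open>a\<close> maps the component of degree m
  onto that of degree m + 1: the reduction equation seen in one degree.\<close>

definition onto :: "'a set \<Rightarrow> 'a \<Rightarrow> nat \<Rightarrow> bool" where
  "onto D a m \<longleftrightarrow> (\<forall>v\<in>pw (Suc m). \<exists>w\<in>pw m. v - a * w \<in> fil D (Suc m))"

definition nil :: "'a set \<Rightarrow> nat \<Rightarrow> 'a \<Rightarrow> 'a \<Rightarrow> bool" where
  "nil D m b y \<longleftrightarrow> (\<exists>j. b ^ j * y \<in> fil D (m + j))"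

text \<open>The degree m part of the b-power torsion of the graded ring modulo \<open>D\<close>,
  lifted to \<open>pw m\<close>.\<close>

definition nilset :: "'a set \<Rightarrow> nat \<Rightarrow> 'a \<Rightarrow> 'a set" where
  "nilset D m b = {y \<in> pw m. nil D m b y}"

lemma subspace_pw: "idl.subspace (pw m)" and subspace_fil: "idl.subspace (fil D m)"
  by (simp_all add: pw_def fil_def)

lemma k_pw: "k \<subseteq> pw m" and k_fil: "k \<subseteq> fil D m"
  unfolding pw_def fil_def by (auto intro: idl.span_base)

lemma pw_Suc_fil: "pw (Suc m) \<subseteq> fil D m"
  unfolding pw_def fil_def by (rule idl.span_mono) auto

lemma fil_pw: assumes "D \<subseteq> I" shows "fil D m \<subseteq> pw m"
proof -
  have "I ^ Suc m \<subseteq> idl.span (I ^ m)"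
    by (rule subset_trans[OF idl.span_superset ideal_power_antimono[OF I_ideal]]) simp
  moreover have "D * I ^ (m - 1) \<subseteq> pw m"
  proof (cases m)
    case 0
    have "(1::'a) \<in> pw 0" unfolding pw_def by (intro idl.span_base) (simp add: set_one)
    then have "x \<in> pw 0" for x using ideal_multL[OF subspace_pw, of 1 0 x] by simp
    then show ?thesis using 0 by blast
  next
    case (Suc n)
    have "D * I ^ n \<subseteq> I ^ Suc n" using assms by (simp add: set_times_mono2)
    then show ?thesis using Suc unfolding pw_def by (auto intro: idl.span_base)
  qed
  ultimately show ?thesis
    unfolding fil_def using subspace_pw k_pw idl.span_mono[of "I ^ m" "I ^ m \<union> k"]
    by (intro idl.span_minimal) (auto simp: pw_def)
qed

lemma mult_into_ideal:
  assumes "idl.subspace B" "\<And>x. x \<in> X \<Longrightarrow> c * x \<in> B" "y \<in> idl.span X"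
  shows "c * y \<in> B"
proof -
  have "idl.subspace {x. c * x \<in> B}"
  proof (rule idl.subspaceI; simp)
    show "0 \<in> B" by (rule idl.subspace_0[OF assms(1)])
    show "c * (x + y) \<in> B" if "c * x \<in> B" "c * y \<in> B" for x y
      using idl.subspace_add[OF assms(1) that] by (simp add: algebra_simps)
    show "c * (d * x) \<in> B" if "c * x \<in> B" for d x
      using idl.subspace_scale[OF assms(1) that, of d] by (simp add: ac_simps)
  qed
  then have "idl.span X \<subseteq> {x. c * x \<in> B}" using assms(2) by (intro idl.span_minimal) auto
  then show ?thesis using assms(3) by auto
qed

lemma pw_mult: "c \<in> I \<Longrightarrow> y \<in> pw m \<Longrightarrow> c * y \<in> pw (Suc m)"
  unfolding pw_def[of m]
proof (erule mult_into_ideal[OF subspace_pw, rotated])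
  fix x assume "c \<in> I" "x \<in> I ^ m \<union> k"
  then show "c * x \<in> pw (Suc m)" unfolding pw_def
    by (auto intro: idl.span_base idl.span_scale)
qed

lemma fil_mult:
  assumes c: "c \<in> I" and y: "y \<in> fil D m" shows "c * y \<in> fil D (Suc m)"
proof (rule mult_into_ideal[OF subspace_fil _ y[unfolded fil_def]])
  fix x assume "x \<in> D * I ^ (m - 1) \<union> I ^ Suc m \<union> k"
  then consider d i where "x = d * i" "d \<in> D" "i \<in> I ^ (m - 1)" | "x \<in> I ^ Suc m" | "x \<in> k"
    by (auto elim: set_times_elim)
  then show "c * x \<in> fil D (Suc m)"
  proof cases
    case 1
    show ?thesis
    proof (cases m)
      case 0
      have "d * 1 \<in> D * I ^ 0" using 1 by (auto simp: set_one simp del: mult_1_right)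
      then have "d \<in> fil D (Suc m)" unfolding fil_def using 0 by (intro idl.span_base) simp
      then show ?thesis using 1 by (metis ideal_multL idl.subspace_scale subspace_fil)
    next
      case (Suc n)
      then have "d * (c * i) \<in> D * I ^ Suc n" using 1 c by auto
      then have "d * (c * i) \<in> fil D (Suc m)" unfolding fil_def using Suc by (intro idl.span_base) simp
      then show ?thesis using 1 by (simp add: ac_simps)
    qed
  next
    case 2
    then have "c * x \<in> I ^ Suc (Suc m)" using c by auto
    then show ?thesis unfolding fil_def by (intro idl.span_base) simp
  next
    case 3
    then show ?thesis unfolding fil_def by (intro idl.span_scale idl.span_base) simp
  qed
qed

lemma pw_mult_power: "c \<in> I ^ n \<Longrightarrow> y \<in> pw m \<Longrightarrow> c * y \<in> pw (m + n)"
proof (induction n arbitrary: c)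
  case (Suc n)
  then obtain u v where "c = u * v" "u \<in> I" "v \<in> I ^ n" by (auto elim: set_times_elim)
  then show ?case using pw_mult[of u "v * y" "m + n"] Suc by (simp add: mult.assoc)
qed (simp add: set_one)

lemma fil_mult_power: "c \<in> I ^ n \<Longrightarrow> y \<in> fil D m \<Longrightarrow> c * y \<in> fil D (m + n)"
proof (induction n arbitrary: c)
  case (Suc n)
  then obtain u v where "c = u * v" "u \<in> I" "v \<in> I ^ n" by (auto elim: set_times_elim)
  then show ?case using fil_mult[of u "v * y" D "m + n"] Suc by (simp add: mult.assoc)
qed (simp add: set_one)

lemma formal_red_ge:
  assumes "I ^ Suc n \<subseteq> cl (E * I ^ n)" "n \<le> m" shows "I ^ Suc m \<subseteq> cl (E * I ^ m)"
proof
  fix z assume "z \<in> I ^ Suc m"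
  also have "I ^ Suc m = I ^ Suc n * I ^ (m - n)" using assms(2) by (simp flip: power_add power_Suc)
  finally obtain u v where uv: "z = u * v" "u \<in> I ^ Suc n" "v \<in> I ^ (m - n)" by (rule set_times_elim)
  have "u * v \<in> cl ((E * I ^ n) * I ^ (m - n))" using assms(1) uv by (intro cl_times) (auto intro: cl_base)
  moreover have "(E * I ^ n) * I ^ (m - n) = E * I ^ m" using assms(2) by (simp add: mult.assoc flip: power_add)
  ultimately show "z \<in> cl (E * I ^ m)" using uv(1) by simp
qed

lemma formal_red_power:
  assumes "I ^ Suc n \<subseteq> cl (E * I ^ n)" shows "I ^ (n + j) \<subseteq> cl (E ^ j * I ^ n)"
proof (induction j)
  case (Suc j)
  have "I ^ (n + Suc j) \<subseteq> cl (E * I ^ (n + j))" using formal_red_ge[OF assms, of "n + j"] by simp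
  also have "E * I ^ (n + j) \<subseteq> cl (E * (E ^ j * I ^ n))"
    using Suc by (auto elim!: set_times_elim intro!: cl_times intro: cl_base)
  then have "cl (E * I ^ (n + j)) \<subseteq> cl (E * (E ^ j * I ^ n))" by (rule cl_minimal)
  finally show ?case by (simp add: mult.assoc)
qed (auto intro: cl_base)

lemma formal_red_onto:
  assumes "I ^ Suc m \<subseteq> cl (insert a D * I ^ m)"
  shows "onto D a m"
  unfolding onto_def
proof
  fix v assume v: "v \<in> pw (Suc m)"
  let ?X = "insert a D * I ^ m" and ?Y = "D * I ^ m \<union> I ^ Suc (Suc m) \<union> k"
  have "I ^ Suc m \<subseteq> idl.span (?X \<union> k \<union> I ^ Suc (Suc m))"
    using assms cl_mono[of ?X "?X \<union> I ^ Suc (Suc m)"] cl_Un_power by blast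
  then have "pw (Suc m) \<subseteq> idl.span (?X \<union> k \<union> I ^ Suc (Suc m))"
    unfolding pw_def by (intro idl.span_minimal) (auto intro: idl.span_base)
  moreover have "?X \<union> k \<union> I ^ Suc (Suc m) \<subseteq> (*) a ` (I ^ m) \<union> ?Y"
    by (auto elim!: set_times_elim)
  then have "idl.span (?X \<union> k \<union> I ^ Suc (Suc m)) \<subseteq> idl.span ((*) a ` (I ^ m) \<union> ?Y)" by (rule idl.span_mono)
  ultimately obtain x y where xy: "v = x + y" "x \<in> idl.span ((*) a ` (I ^ m))" "y \<in> idl.span ?Y"
    using v unfolding idl.span_Un[of "(*) a ` (I ^ m)"] by blast
  obtain w where w: "w \<in> idl.span (I ^ m)" "x = a * w" using span_image_mult[OF xy(2)] by blast
  have "w \<in> pw m" using w(1) idl.span_mono[of "I ^ m" "I ^ m \<union> k"] by (auto simp: pw_def)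
  moreover have "v - a * w \<in> fil D (Suc m)" using xy w by (simp add: fil_def)
  ultimately show "\<exists>w\<in>pw m. v - a * w \<in> fil D (Suc m)" by blast
qed

text \<open>One degree is enough. With X = (a, D) I^m, surjectivity says that I^(m+1) lies in X +
  I^(m+2); multiplying by powers of I pushes the error into I^(m+1+j) for every j, and closedness in
  the I-adic topology removes it.\<close>

lemma onto_formal_red:
  assumes "onto D a m" shows "formal_red (insert a D)"
proof -
  let ?X = "insert a D * I ^ m"
  have base: "I ^ Suc m \<subseteq> idl.span (?X \<union> I ^ Suc (Suc m) \<union> k)"
  proof
    fix v assume "v \<in> I ^ Suc m"
    then have "v \<in> pw (Suc m)" by (simp add: pw_def idl.span_base)
    then obtain w where w: "w \<in> pw m" "v - a * w \<in> fil D (Suc m)" using assms by (auto simp: onto_def)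
    have "a * w \<in> idl.span (?X \<union> I ^ Suc (Suc m) \<union> k)"
      by (rule mult_into_ideal[OF idl.subspace_span _ w(1)[unfolded pw_def]])
        (auto intro: idl.span_base idl.span_scale)
    moreover have "fil D (Suc m) \<subseteq> idl.span (?X \<union> I ^ Suc (Suc m) \<union> k)"
      unfolding fil_def by (rule idl.span_mono) (auto elim!: set_times_elim)
    ultimately have "(v - a * w) + a * w \<in> idl.span (?X \<union> I ^ Suc (Suc m) \<union> k)"
      using w(2) by (intro idl.span_add) auto
    then show "v \<in> idl.span (?X \<union> I ^ Suc (Suc m) \<union> k)" by simp
  qed
  have step: "I ^ Suc m \<subseteq> idl.span (?X \<union> I ^ (Suc m + j) \<union> k)" for j
  proof (induction j)
    case (Suc j)
    have "I ^ (Suc m + j) \<subseteq> idl.span (?X \<union> I ^ (Suc m + Suc j) \<union> k)"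
    proof
      fix z assume "z \<in> I ^ (Suc m + j)"
      then obtain x c where xc: "z = x * c" "x \<in> I ^ Suc m" "c \<in> I ^ j"
        unfolding power_add by (rule set_times_elim)
      have "c * x \<in> idl.span (?X \<union> I ^ (Suc m + Suc j) \<union> k)"
      proof (rule mult_into_ideal[OF idl.subspace_span _ subsetD[OF base xc(2)]])
        fix y assume "y \<in> ?X \<union> I ^ Suc (Suc m) \<union> k"
        then consider "y \<in> ?X \<union> k" | "y \<in> I ^ Suc (Suc m)" by blast
        then show "c * y \<in> idl.span (?X \<union> I ^ (Suc m + Suc j) \<union> k)"
        proof cases
          case 1
          then show ?thesis by (intro idl.span_scale idl.span_base) auto
        next
          case 2
          then have "c * y \<in> I ^ j * I ^ Suc (Suc m)" using xc(3) by blast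
          also have "\<dots> = I ^ (Suc m + Suc j)" by (simp flip: power_add power_Suc add: ac_simps)
          finally show ?thesis by (intro idl.span_base) simp
        qed
      qed
      then show "z \<in> idl.span (?X \<union> I ^ (Suc m + Suc j) \<union> k)" using xc(1) by (simp add: mult.commute)
    qed
    then have "idl.span (?X \<union> I ^ (Suc m + j) \<union> k) \<subseteq> idl.span (?X \<union> I ^ (Suc m + Suc j) \<union> k)"
      by (intro idl.span_minimal) (auto intro: idl.span_base)
    then show ?case using Suc by blast
  qed (auto intro: idl.span_base)
  have "I ^ Suc m \<subseteq> cl ?X"
  proof
    fix z assume z: "z \<in> I ^ Suc m"
    show "z \<in> cl ?X"
    proof (rule cl_closed)
      fix n
      have "I ^ (Suc m + n) \<subseteq> idl.span (I ^ n)"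
        by (rule subset_trans[OF idl.span_superset ideal_power_antimono[OF I_ideal]]) simp
      also have "\<dots> \<subseteq> cl (?X \<union> I ^ n)" using cl_span cl_mono[of "I ^ n" "?X \<union> I ^ n"] by blast
      finally have "?X \<union> I ^ (Suc m + n) \<union> k \<subseteq> cl (?X \<union> I ^ n)" by (auto intro: cl_base cl_k)
      then have "idl.span (?X \<union> I ^ (Suc m + n) \<union> k) \<subseteq> cl (?X \<union> I ^ n)"
        using cl_ideal by (rule idl.span_minimal)
      then show "z \<in> cl (?X \<union> I ^ n)" using step[of n] z by blast
    qed
  qed
  then show ?thesis by (auto simp: formal_red_def)
qed

lemma fil_power_mono:
  assumes "b \<in> I" "b ^ j * y \<in> fil D (m + j)" "j \<le> i" shows "b ^ i * y \<in> fil D (m + i)"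
proof -
  have "b ^ (i - j) * (b ^ j * y) \<in> fil D ((m + j) + (i - j))"
    by (rule fil_mult_power[OF in_set_power[OF assms(1)] assms(2)])
  then show ?thesis using assms(3) by (simp flip: power_add mult.assoc)
qed

lemma nil_scale: "nil D m b y \<Longrightarrow> nil D m (c * b) y"
  unfolding nil_def by (metis idl.subspace_scale mult.assoc power_mult_distrib subspace_fil)

lemma nil_k: "b \<in> k \<Longrightarrow> nil D m b y"
  unfolding nil_def using k_fil[of D "m + 1"] ideal_multL[OF k_ideal, of b y] by (intro exI[of _ 1]) auto

lemma nil_fil: "y \<in> fil D m \<Longrightarrow> nil D m b y"
  unfolding nil_def by (intro exI[of _ 0]) simp

text \<open>Induction on i + j instead of a binomial expansion: b y is killed with exponents i - 1
  and j, and c y with exponents i and j - 1.\<close>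

lemma fil_add_power:
  assumes "b \<in> I" "c \<in> I" "b ^ i * y \<in> fil D (m + i)" "c ^ j * y \<in> fil D (m + j)"
  shows "(b + c) ^ (i + j) * y \<in> fil D (m + (i + j))"
  using assms(3,4)
proof (induction "i + j" arbitrary: i j m y)
  case 0
  then show ?case by simp
next
  case (Suc n)
  have bc: "b + c \<in> I" using assms(1,2) by (rule idl.subspace_add[OF I_ideal])
  consider "i = 0" | "j = 0" | i' j' where "i = Suc i'" "j = Suc j'" by (cases i; cases j) auto
  then show ?case
  proof cases
    case 1
    then show ?thesis using fil_mult_power[OF in_set_power[OF bc, of j], of y D m] Suc.prems by simp
  next
    case 2
    then show ?thesis using fil_mult_power[OF in_set_power[OF bc, of i], of y D m] Suc.prems by simp
  next
    case 3
    have "b * (c ^ j * y) \<in> fil D (Suc (m + j))" "c * (b ^ i * y) \<in> fil D (Suc (m + i))"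
      using Suc.prems assms(1,2) by (auto intro: fil_mult)
    then have "(b + c) ^ (i' + j) * (b * y) \<in> fil D (Suc m + (i' + j))"
      "(b + c) ^ (i + j') * (c * y) \<in> fil D (Suc m + (i + j'))"
      using Suc.prems Suc.hyps(2) 3
      by (intro Suc.hyps(1); simp add: ac_simps)+
    then have "(b + c) ^ (i' + j) * (b * y) + (b + c) ^ (i + j') * (c * y) \<in> fil D (m + (i + j))"
      using 3 by (intro idl.subspace_add[OF subspace_fil]) (auto simp: add.commute)
    also have "(b + c) ^ (i' + j) * (b * y) + (b + c) ^ (i + j') * (c * y) = (b + c) ^ (i + j) * y"
      using 3 by (simp add: algebra_simps)
    finally show ?thesis .
  qed
qed

lemma nil_add:
  assumes "b \<in> I" "c \<in> I" "nil D m b y" "nil D m c y" shows "nil D m (b + c) y"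
  using assms fil_add_power[OF assms(1,2)] unfolding nil_def by meson

lemma nilset_ideal: assumes "b \<in> I" shows "idl.subspace (nilset D m b)"
proof (rule idl.subspaceI)
  show "0 \<in> nilset D m b"
    using idl.subspace_0[OF subspace_pw] nil_fil[OF idl.subspace_0[OF subspace_fil]] by (simp add: nilset_def)
  fix x y assume "x \<in> nilset D m b" "y \<in> nilset D m b"
  then obtain i j where ij: "x \<in> pw m" "y \<in> pw m" "b ^ i * x \<in> fil D (m + i)" "b ^ j * y \<in> fil D (m + j)"
    by (auto simp: nilset_def nil_def)
  have "b ^ (i + j) * x \<in> fil D (m + (i + j))" "b ^ (i + j) * y \<in> fil D (m + (i + j))"
    using fil_power_mono[OF assms ij(3), of "i + j"] fil_power_mono[OF assms ij(4), of "i + j"] by auto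
  then have "b ^ (i + j) * (x + y) \<in> fil D (m + (i + j))"
    using idl.subspace_add[OF subspace_fil] by (metis distrib_left)
  then show "x + y \<in> nilset D m b"
    using ij idl.subspace_add[OF subspace_pw] by (auto simp: nilset_def nil_def)
next
  fix c x assume "x \<in> nilset D m b"
  then obtain i where i: "x \<in> pw m" "b ^ i * x \<in> fil D (m + i)" by (auto simp: nilset_def nil_def)
  then have "b ^ i * (c * x) \<in> fil D (m + i)"
    using idl.subspace_scale[OF subspace_fil i(2), of c] by (simp add: ac_simps)
  then show "c * x \<in> nilset D m b"
    using i idl.subspace_scale[OF subspace_pw] by (auto simp: nilset_def nil_def)
qed

lemma fil_nilset: "D \<subseteq> I \<Longrightarrow> fil D m \<subseteq> nilset D m b"
  using fil_pw[of D m] nil_fil by (auto simp: nilset_def)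

lemma nilset_mult_power:
  assumes "y \<in> nilset D m b" "c \<in> I ^ j" shows "c * y \<in> nilset D (m + j) b"
proof -
  obtain i where i: "y \<in> pw m" "b ^ i * y \<in> fil D (m + i)" using assms(1) by (auto simp: nilset_def nil_def)
  have "c * (b ^ i * y) \<in> fil D ((m + i) + j)" by (rule fil_mult_power[OF assms(2) i(2)])
  then have "b ^ i * (c * y) \<in> fil D ((m + j) + i)" by (simp add: ac_simps)
  then show ?thesis using pw_mult_power[OF assms(2) i(1)] by (auto simp: nilset_def nil_def)
qed

lemma nil_of_power:
  assumes "nil D (m + j) b (b ^ j * y)" shows "nil D m b y"
proof -
  obtain i where "b ^ i * (b ^ j * y) \<in> fil D ((m + j) + i)" using assms by (auto simp: nil_def)
  then have "b ^ (i + j) * y \<in> fil D (m + (i + j))" by (simp add: power_add ac_simps)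
  then show ?thesis by (auto simp: nil_def)
qed

text \<open>Two members of the pencil span b and b', because u - v is invertible modulo
  \<open>k\<close>; the defect of the inverse contributes the summand \<open>?\<kappa>\<close>,
  which lies in \<open>k\<close> and so is harmless.\<close>

lemma pencil_nil:
  assumes K: "separated K" "u \<in> K" "v \<in> K" "u \<noteq> v" and b: "b \<in> I" "b' \<in> I"
    and nil: "nil D m (b + u * b') y" "nil D m (b + v * b') y"
  shows "nil D m b y" "nil D m b' y"
proof -
  have mem: "b + u * b' \<in> I" "b + v * b' \<in> I"
    using b I_ideal by (auto intro: idl.subspace_add idl.subspace_scale)
  obtain w where w: "w * (u - v) - 1 \<in> k" using K by (auto simp: separated_def)
  let ?\<kappa> = "- ((w * (u - v) - 1) * b')"
  have nk: "nil D m ?\<kappa> y" using w by (intro nil_k idl.subspace_neg[OF k_ideal] ideal_multL[OF k_ideal])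
  have kI: "?\<kappa> \<in> I" using w k_subset I_ideal by (intro idl.subspace_neg ideal_multL) auto
  note scaled = idl.subspace_scale[OF I_ideal mem(1), of w] idl.subspace_scale[OF I_ideal mem(2), of "- w"]
  have "nil D m (w * (b + u * b') + (- w) * (b + v * b')) y"
    by (rule nil_add[OF scaled nil_scale[OF nil(1)] nil_scale[OF nil(2)]])
  from nil_add[OF idl.subspace_add[OF I_ideal scaled] kI this nk]
  have "nil D m ((w * (b + u * b') + (- w) * (b + v * b')) + ?\<kappa>) y" .
  also have "(w * (b + u * b') + (- w) * (b + v * b')) + ?\<kappa> = b'" by (simp add: algebra_simps)
  finally show b': "nil D m b' y" .
  have "nil D m ((b + u * b') + (- u) * b') y"
    by (rule nil_add[OF mem(1) idl.subspace_scale[OF I_ideal b(2)] nil(1) nil_scale[OF b']])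
  then show "nil D m b y" by simp
qed

text \<open>As for eigenvectors of distinct eigenvalues: a power of the last member of the pencil
  annihilates the last summand, so the induction applies to the multiples of the others by that
  power. Each of these y i is then torsion for two different members, hence for b and b'.\<close>

lemma pencil_independent:
  fixes u y :: "nat \<Rightarrow> 'a"
  assumes K: "separated K" "inj u" "range u \<subseteq> K" and b: "b \<in> I" "b' \<in> I"
    and y: "\<forall>i<n. y i \<in> nilset D m (b + u i * b')"
    and s: "(\<Sum>i<n. y i) \<in> nilset D m b \<inter> nilset D m b'"
    and "i < n"
  shows "y i \<in> nilset D m b \<inter> nilset D m b'"
  using y s \<open>i < n\<close>
proof (induction n arbitrary: m y i)
  case (Suc n)
  let ?b = "b + u n * b'"
  have bI: "?b \<in> I" using b I_ideal by (auto intro: idl.subspace_add idl.subspace_scale)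
  obtain J where J: "?b ^ J * y n \<in> fil D (m + J)" using Suc.prems(1)[rule_format, of n] by (auto simp: nilset_def nil_def)
  have yn: "y n \<in> pw m" using Suc.prems(1)[rule_format, of n] by (auto simp: nilset_def)
  have pJ: "?b ^ J \<in> I ^ J" by (rule in_set_power[OF bI])
  have yin: "y i \<in> nilset D m b \<inter> nilset D m b'" if i: "i < n" for i
  proof -
    have "?b ^ J * y i \<in> nilset D (m + J) b \<inter> nilset D (m + J) b'"
    proof (rule Suc.IH[of "\<lambda>i. ?b ^ J * y i", OF _ _ i])
      show "\<forall>j<n. ?b ^ J * y j \<in> nilset D (m + J) (b + u j * b')"
        using Suc.prems(1) pJ by (auto intro!: nilset_mult_power)
      have "?b ^ J * (\<Sum>i<Suc n. y i) \<in> nilset D (m + J) b \<inter> nilset D (m + J) b'"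
        using Suc.prems(2) pJ by (auto intro: nilset_mult_power)
      moreover have "?b ^ J * y n \<in> nilset D (m + J) c" for c
        using J pw_mult_power[OF pJ yn] nil_fil by (auto simp: nilset_def)
      moreover have "?b ^ J * (\<Sum>i<Suc n. y i) - ?b ^ J * y n = (\<Sum>i<n. ?b ^ J * y i)"
        by (simp add: distrib_left sum_distrib_left)
      ultimately show "(\<Sum>i<n. ?b ^ J * y i) \<in> nilset D (m + J) b \<inter> nilset D (m + J) b'"
        using idl.subspace_diff[OF nilset_ideal] b by (metis (no_types, lifting) IntD1 IntD2 IntI)
    qed
    then have "nil D (m + J) b (?b ^ J * y i)" "nil D (m + J) b' (?b ^ J * y i)" by (auto simp: nilset_def)
    then have "nil D (m + J) ?b (?b ^ J * y i)"
      using b I_ideal by (intro nil_add nil_scale idl.subspace_scale) auto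
    then have "nil D m ?b (y i)" by (rule nil_of_power)
    moreover have "nil D m (b + u i * b') (y i)" "y i \<in> pw m" using Suc.prems(1)[rule_format, of i] i by (auto simp: nilset_def)
    moreover have "u i \<noteq> u n" using K(2) i by (auto dest: injD)
    moreover have "u i \<in> K" "u n \<in> K" using K(3) by auto
    ultimately show ?thesis using pencil_nil[OF K(1), of "u i" "u n" b b' D m "y i"] b by (auto simp: nilset_def)
  qed
  have "(\<Sum>i<Suc n. y i) - (\<Sum>i<n. y i) \<in> nilset D m c" if "c = b \<or> c = b'" for c
  proof (rule idl.subspace_diff[OF nilset_ideal])
    show "c \<in> I" using that b by auto
    then show "(\<Sum>i<n. y i) \<in> nilset D m c"
      using that yin by (intro idl.subspace_sum[OF nilset_ideal]) auto
  qed (use that Suc.prems(2) in auto)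
  then have "y n \<in> nilset D m b \<inter> nilset D m b'" by simp
  then show ?case using yin Suc.prems(3) less_Suc_eq by metis
qed simp

text \<open>Infinitely many exceptional u would give torsion elements y i outside the common
  torsion. By the ascending chain condition one of them is a combination of the earlier ones modulo
  the common torsion, against independence.\<close>

lemma pencil_finite:
  assumes K: "separated K" and D: "D \<subseteq> I" and b: "b \<in> I" "b' \<in> I"
  shows "finite {u \<in> K. \<not> nilset D m (b + u * b') \<subseteq> nilset D m b \<inter> nilset D m b'}"
proof (rule ccontr)
  let ?B = "{u \<in> K. \<not> nilset D m (b + u * b') \<subseteq> nilset D m b \<inter> nilset D m b'}"
  let ?N = "nilset D m b \<inter> nilset D m b'"
  assume "infinite ?B"
  then obtain u :: "nat \<Rightarrow> 'a" where u: "inj u" "range u \<subseteq> ?B" by (meson infinite_countable_subset)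
  then have "\<forall>i. \<exists>y. y \<in> nilset D m (b + u i * b') \<and> y \<notin> ?N" by blast
  then obtain y where y: "\<And>i. y i \<in> nilset D m (b + u i * b')" "\<And>i. y i \<notin> ?N" by metis
  define E where "E n = idl.span (?N \<union> y ` {..<n})" for n
  have N: "idl.subspace ?N" using b by (simp add: nilset_ideal idl.subspace_inter)
  have "k \<subseteq> ?N" using fil_nilset[OF D] k_fil by blast
  then have "\<exists>n. \<forall>m\<ge>n. E m = E n"
    by (intro chain_stable) (auto simp: E_def intro: idl.span_base idl.span_mono[THEN subsetD, rotated])
  then obtain n where "E (Suc n) = E n" by (meson le_Suc_eq order_refl)
  moreover have "y n \<in> E (Suc n)" unfolding E_def by (intro idl.span_base) auto
  ultimately obtain c where c: "y n - (\<Sum>i<n. c i * y i) \<in> idl.span ?N"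
    unfolding E_def using span_sum_breakdown by blast
  \<comment> \<open>The relation between y n and the earlier y i, written as one sum of torsion
    elements of the first n + 1 members.\<close>
  define y' where "y' i = (if i = n then y n else - c i * y i)" for i
  have "(\<Sum>i<Suc n. y' i) = y n - (\<Sum>i<n. c i * y i)"
    by (simp add: y'_def sum_negf)
  moreover have "idl.span ?N = ?N" using N by simp
  ultimately have "(\<Sum>i<Suc n. y' i) \<in> ?N" using c by metis
  moreover have "y' i \<in> nilset D m (b + u i * b')" for i
  proof -
    have "b + u i * b' \<in> I" using b I_ideal by (auto intro: idl.subspace_add idl.subspace_scale)
    from idl.subspace_scale[OF nilset_ideal[OF this] y(1)[of i], of "- c i"] show ?thesis
      using y(1) by (simp add: y'_def)
  qed
  ultimately have "y' n \<in> ?N" using pencil_independent[OF K u(1) _ b, of "Suc n" y' D m n] u(2) by auto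
  then show False using y(2)[of n] by (simp add: y'_def)
qed

end

section \<open>Artinian arguments\<close>

locale zero_dim_pair = noeth_pair +
  assumes prime_maximal: "\<And>P B. prime_idl P \<Longrightarrow> I \<subseteq> P \<Longrightarrow> idl.subspace B \<Longrightarrow> P \<subset> B \<Longrightarrow> 1 \<in> B"
begin

text \<open>\<open>fil D m\<close> contains I^(m+1), so every prime above it contains I and is
  maximal. With \<open>S\<close> = {1} saturation is no condition.\<close>

lemma dcc_fil:
  assumes "\<B> \<noteq> {}" "\<And>B. B \<in> \<B> \<Longrightarrow> idl.subspace B \<and> fil D m \<subseteq> B"
  obtains B where "B \<in> \<B>" "\<And>B'. B' \<in> \<B> \<Longrightarrow> B' \<subseteq> B \<Longrightarrow> B' = B"
proof -
  have "dcc_above {1} (fil D m)"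
  proof (rule dcc_above_ideal)
    fix P B assume P: "prime_idl P" "fil D m \<subseteq> P" and B: "idl.subspace B" "P \<subset> B"
    have "I \<subseteq> P"
    proof
      fix x assume "x \<in> I"
      then have "x ^ Suc m \<in> fil D m" unfolding fil_def
        using in_set_power[of x I "Suc m"] by (intro idl.span_base) blast
      then show "x \<in> P" using P prime_power by blast
    qed
    then show "B \<inter> {1} \<noteq> {}" using prime_maximal[OF P(1) _ B] by auto
  qed (auto simp: mult_closed_def subspace_fil k_fil)
  moreover have "saturated {1} B \<and> fil D m \<subseteq> B" if "B \<in> \<B>" for B
    using assms(2)[OF that] by (auto simp: saturated_def)
  ultimately show ?thesis using dcc_aboveD[OF _ assms(1)] that by metis
qed

text \<open>From degree m on, multiplication by \<open>a\<close> is bijective from each component of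
  the graded ring modulo \<open>D\<close> to the next.\<close>

definition stable :: "'a set \<Rightarrow> 'a \<Rightarrow> nat \<Rightarrow> bool" where
  "stable D a m \<longleftrightarrow> (\<forall>m'\<ge>m. onto D a m' \<and> (\<forall>w\<in>pw m'. a * w \<in> fil D (Suc m') \<longrightarrow> w \<in> fil D m'))"

lemma onto_iterate:
  assumes "\<And>m'. m \<le> m' \<Longrightarrow> onto D a m'" "a \<in> I" "v \<in> pw (m + j)"
  shows "\<exists>y\<in>pw m. v - a ^ j * y \<in> fil D (m + j)"
  using assms(3)
proof (induction j arbitrary: v)
  case 0
  then show ?case using idl.subspace_0[OF subspace_fil] by (intro bexI[of _ v]) auto
next
  case (Suc j)
  then obtain w where w: "w \<in> pw (m + j)" "v - a * w \<in> fil D (Suc (m + j))"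
    using assms(1)[of "m + j"] by (auto simp: onto_def)
  obtain y where y: "y \<in> pw m" "w - a ^ j * y \<in> fil D (m + j)" using Suc.IH[OF w(1)] by blast
  have "(v - a * w) + a * (w - a ^ j * y) \<in> fil D (Suc (m + j))"
    by (rule idl.subspace_add[OF subspace_fil w(2) fil_mult[OF assms(2) y(2)]])
  then show ?case using y(1) by (intro bexI[of _ y]) (auto simp: algebra_simps)
qed

text \<open>Surjectivity from degree n on is the reduction equation. For injectivity, the elements
  of degree n killed by a^j form an ascending chain that stops at some j. An element of degree n + i
  is a^i y; if \<open>a\<close> kills it, then a^(i+1) kills y, so for i at least j already a^i
  does.\<close>

lemma stable_exists:
  assumes fr: "formal_red (insert a D)" and a: "a \<in> I" and D: "D \<subseteq> I"
  shows "\<exists>m. stable D a m"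
proof -
  obtain n where n: "I ^ Suc n \<subseteq> cl (insert a D * I ^ n)" using fr by (auto simp: formal_red_def)
  have onto: "onto D a m" if "n \<le> m" for m
    by (rule formal_red_onto[OF formal_red_ge[OF n that]])
  define Y where "Y j = {y \<in> pw n. a ^ j * y \<in> fil D (n + j)}" for j
  have "idl.subspace (Y j)" for j
  proof (rule idl.subspaceI)
    show "0 \<in> Y j" using idl.subspace_0[OF subspace_pw] idl.subspace_0[OF subspace_fil] by (simp add: Y_def)
    show "x + y \<in> Y j" if "x \<in> Y j" "y \<in> Y j" for x y
      using that idl.subspace_add[OF subspace_pw] idl.subspace_add[OF subspace_fil]
      by (auto simp: Y_def distrib_left)
    show "c * x \<in> Y j" if "x \<in> Y j" for c x
    proof -
      have "c * (a ^ j * x) \<in> fil D (n + j)" "c * x \<in> pw n"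
        using that by (auto simp: Y_def intro: idl.subspace_scale[OF subspace_fil] idl.subspace_scale[OF subspace_pw])
      then show ?thesis by (simp add: Y_def mult.left_commute)
    qed
  qed
  moreover have "k \<subseteq> Y j" for j
    using k_pw[of n] k_fil[of D "n + j"] idl.subspace_scale[OF subspace_fil, of _ D "n + j" "a ^ j"]
    by (auto simp: Y_def)
  moreover have "Y j \<subseteq> Y (Suc j)" for j
    using fil_mult[OF a] by (auto simp: Y_def mult.assoc)
  ultimately have "\<exists>j. \<forall>i\<ge>j. Y i = Y j" by (rule chain_stable)
  then obtain j where j: "\<And>i. j \<le> i \<Longrightarrow> Y i = Y j" by blast
  have "w \<in> fil D m" if m: "n + j \<le> m" and w: "w \<in> pw m" "a * w \<in> fil D (Suc m)" for m w
  proof -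
    obtain i where i: "m = n + i" "j \<le> i" using m by (metis add.assoc le_add1 le_iff_add)
    obtain y where y: "y \<in> pw n" "w - a ^ i * y \<in> fil D (n + i)"
      using onto_iterate[OF onto a, of n w i] w i by auto
    have "a * w - a * (w - a ^ i * y) \<in> fil D (Suc m)"
      using idl.subspace_diff[OF subspace_fil w(2)] fil_mult[OF a y(2)] i by simp
    then have "y \<in> Y (Suc i)" using y i by (simp add: Y_def algebra_simps)
    then have "y \<in> Y i" using j[of i] j[of "Suc i"] i(2) by auto
    then have "(w - a ^ i * y) + a ^ i * y \<in> fil D m"
      using y(2) i by (intro idl.subspace_add[OF subspace_fil]) (auto simp: Y_def)
    then show ?thesis by simp
  qed
  then have "stable D a (n + j)" using onto by (auto simp: stable_def)
  then show ?thesis by blast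
qed

lemma stable_cancel:
  assumes "stable D a m" "a \<in> I" "y \<in> pw m" "a ^ j * y \<in> fil D (m + j)"
  shows "y \<in> fil D m"
  using assms(4)
proof (induction j)
  case (Suc j)
  have "a ^ j * y \<in> pw (m + j)" by (rule pw_mult_power[OF in_set_power[OF assms(2)] assms(3)])
  then have "a ^ j * y \<in> fil D (m + j)"
    using assms(1) Suc.prems by (auto simp: stable_def mult.assoc)
  then show ?case by (rule Suc.IH)
qed simp

text \<open>Multiplication by \<open>b\<close> and division by \<open>a\<close> is an injective endomorphism of an Artinian module,
  hence surjective; \<open>V j\<close> is the image of its \<open>j\<close>-th iterate.\<close>

lemma nilset_onto:
  assumes st: "stable D a m" and a: "a \<in> I" and b: "b \<in> I" and D: "D \<subseteq> I"
    and nil: "nilset D m b \<subseteq> fil D m"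
  shows "onto D b m"
proof -
  have onto: "onto D a m'" if "m \<le> m'" for m' using st that by (simp add: stable_def)
  have cancel: "w \<in> fil D m'" if "m \<le> m'" "w \<in> pw m'" "a * w \<in> fil D (Suc m')" for m' w
    using st that by (simp add: stable_def)
  have bj: "b ^ j \<in> I ^ j" and aj: "a ^ j \<in> I ^ j" for j using a b by (auto intro: in_set_power)
  define V where "V j = {y \<in> pw m. \<exists>w\<in>pw m. a ^ j * y - b ^ j * w \<in> fil D (m + j)}" for j
  have "idl.subspace (V j) \<and> fil D m \<subseteq> V j" for j
  proof
    show "idl.subspace (V j)"
    proof (rule idl.subspaceI)
      show "0 \<in> V j" using idl.subspace_0[OF subspace_pw] idl.subspace_0[OF subspace_fil]
        by (auto simp: V_def intro!: bexI[of _ 0])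
      fix x y assume "x \<in> V j" "y \<in> V j"
      then obtain v w where "x \<in> pw m" "v \<in> pw m" "a ^ j * x - b ^ j * v \<in> fil D (m + j)"
        "y \<in> pw m" "w \<in> pw m" "a ^ j * y - b ^ j * w \<in> fil D (m + j)" by (auto simp: V_def)
      moreover from this have "(a ^ j * x - b ^ j * v) + (a ^ j * y - b ^ j * w) \<in> fil D (m + j)"
        by (intro idl.subspace_add[OF subspace_fil])
      ultimately show "x + y \<in> V j" using idl.subspace_add[OF subspace_pw]
        by (auto simp: V_def algebra_simps intro!: bexI[of _ "v + w"])
    next
      fix c x assume "x \<in> V j"
      then obtain v where "x \<in> pw m" "v \<in> pw m" "a ^ j * x - b ^ j * v \<in> fil D (m + j)" by (auto simp: V_def)
      moreover from this have "c * (a ^ j * x - b ^ j * v) \<in> fil D (m + j)" "c * x \<in> pw m" "c * v \<in> pw m"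
        by (auto intro: idl.subspace_scale[OF subspace_fil] idl.subspace_scale[OF subspace_pw])
      ultimately show "c * x \<in> V j"
        by (auto simp: V_def algebra_simps intro!: bexI[of _ "c * v"])
    qed
    show "fil D m \<subseteq> V j"
      using fil_pw[OF D, of m] fil_mult_power[OF aj, of _ D m j] idl.subspace_0[OF subspace_pw]
      by (auto simp: V_def intro!: bexI[of _ 0])
  qed
  then have "idl.subspace B \<and> fil D m \<subseteq> B" if "B \<in> range V" for B using that by auto
  moreover have "range V \<noteq> {}" by simp
  ultimately obtain W where W: "W \<in> range V" "\<And>B'. B' \<in> range V \<Longrightarrow> B' \<subseteq> W \<Longrightarrow> B' = W"
    by (metis dcc_fil)
  then obtain j where j: "W = V j" by blast
  have "V (Suc j) \<subseteq> V j"
  proof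
    fix y assume "y \<in> V (Suc j)"
    then obtain w where w: "y \<in> pw m" "w \<in> pw m" "a ^ Suc j * y - b ^ Suc j * w \<in> fil D (Suc (m + j))"
      by (auto simp: V_def)
    obtain w' where w': "w' \<in> pw m" "b * w - a * w' \<in> fil D (Suc m)"
      using onto[of m] pw_mult[OF b w(2)] by (auto simp: onto_def)
    have "b ^ j * (b * w - a * w') \<in> fil D (Suc (m + j))" using fil_mult_power[OF bj w'(2), of j] by simp
    with w(3) have "(a ^ Suc j * y - b ^ Suc j * w) + b ^ j * (b * w - a * w') \<in> fil D (Suc (m + j))"
      by (rule idl.subspace_add[OF subspace_fil])
    then have "a * (a ^ j * y - b ^ j * w') \<in> fil D (Suc (m + j))" by (simp add: algebra_simps)
    moreover have "a ^ j * y - b ^ j * w' \<in> pw (m + j)"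
      by (rule idl.subspace_diff[OF subspace_pw pw_mult_power[OF aj w(1)] pw_mult_power[OF bj w'(1)]])
    ultimately have "a ^ j * y - b ^ j * w' \<in> fil D (m + j)" by (rule cancel[OF le_add1, rotated])
    then show "y \<in> V j" using w(1) w'(1) by (auto simp: V_def)
  qed
  then have V: "V (Suc j) = V j" using W j by blast
  show ?thesis unfolding onto_def
  proof
    fix v assume "v \<in> pw (Suc m)"
    then obtain w where w: "w \<in> pw m" "v - a * w \<in> fil D (Suc m)" using onto[of m] by (auto simp: onto_def)
    obtain y where y: "y \<in> pw m" "b ^ j * w - a ^ j * y \<in> fil D (m + j)"
      using onto_iterate[OF onto a pw_mult_power[OF bj w(1)]] by blast
    have "- (b ^ j * w - a ^ j * y) \<in> fil D (m + j)" by (rule idl.subspace_neg[OF subspace_fil y(2)])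
    then have "y \<in> V j" using y(1) w(1) by (auto simp: V_def)
    then obtain w' where w': "w' \<in> pw m" "a ^ Suc j * y - b ^ Suc j * w' \<in> fil D (Suc (m + j))"
      unfolding V[symmetric] by (auto simp: V_def)
    have "a * (b ^ j * w - a ^ j * y) + (a ^ Suc j * y - b ^ Suc j * w') \<in> fil D (Suc (m + j))"
      by (rule idl.subspace_add[OF subspace_fil fil_mult[OF a y(2)] w'(2)])
    then have e: "b ^ j * (a * w - b * w') \<in> fil D (Suc (m + j))" by (simp add: algebra_simps)
    have "a * w - b * w' \<in> pw (Suc m)"
      by (rule idl.subspace_diff[OF subspace_pw pw_mult[OF a w(1)] pw_mult[OF b w'(1)]])
    \<comment> \<open>The absence of b-torsion is known in degree m only. The difference has degree
      m + 1, so it is first divided by \<open>a\<close>.\<close>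
    then obtain z where z: "z \<in> pw m" "(a * w - b * w') - a * z \<in> fil D (Suc m)"
      using onto[of m] by (auto simp: onto_def)
    have "b ^ j * ((a * w - b * w') - a * z) \<in> fil D (Suc (m + j))" using fil_mult_power[OF bj z(2), of j] by simp
    with e have "b ^ j * (a * w - b * w') - b ^ j * ((a * w - b * w') - a * z) \<in> fil D (Suc (m + j))"
      by (rule idl.subspace_diff[OF subspace_fil])
    then have "a * (b ^ j * z) \<in> fil D (Suc (m + j))" by (simp add: algebra_simps)
    then have "b ^ j * z \<in> fil D (m + j)" by (rule cancel[OF le_add1 pw_mult_power[OF bj z(1)]])
    then have "z \<in> fil D m" using nil z(1) by (auto simp: nilset_def nil_def)
    then have "(v - a * w) + (((a * w - b * w') - a * z) + a * z) \<in> fil D (Suc m)"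
      by (intro idl.subspace_add[OF subspace_fil w(2)] idl.subspace_add[OF subspace_fil z(2)] fil_mult[OF a])
    then have "v - b * w' \<in> fil D (Suc m)" by simp
    then show "\<exists>w\<in>pw m. v - b * w \<in> fil D (Suc m)" using w'(1) by blast
  qed
qed

text \<open>In a degree where \<open>a\<close> is stable it has no torsion. By
  \<open>pencil_finite\<close> the same holds for a + u y with finitely many exceptions, and absence
  of torsion implies surjectivity.\<close>

theorem pencil_formal_red:
  assumes K: "separated K" and D: "D \<subseteq> I" and a: "a \<in> I" and y: "y \<in> I"
    and fr: "formal_red (insert a D)"
  shows "finite {u \<in> K. \<not> formal_red (insert (a + u * y) D)}"
proof -
  obtain m where st: "stable D a m" using stable_exists[OF fr a D] by blast
  have "formal_red (insert (a + u * y) D)"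
    if "nilset D m (a + u * y) \<subseteq> nilset D m a \<inter> nilset D m y" for u
  proof -
    have "nilset D m a \<subseteq> fil D m" using stable_cancel[OF st a] by (auto simp: nilset_def nil_def)
    moreover have "a + u * y \<in> I" using a y I_ideal by (intro idl.subspace_add idl.subspace_scale)
    ultimately have "onto D (a + u * y) m" using that by (intro nilset_onto[OF st a _ D]) auto
    then show ?thesis by (rule onto_formal_red)
  qed
  then have "{u \<in> K. \<not> formal_red (insert (a + u * y) D)}
    \<subseteq> {u \<in> K. \<not> nilset D m (a + u * y) \<subseteq> nilset D m a \<inter> nilset D m y}" by blast
  then show ?thesis using pencil_finite[OF K D a y] by (rule finite_subset)
qed

lemma nil_list_power:
  assumes "set gs \<subseteq> I" "\<And>g. g \<in> set gs \<Longrightarrow> nil D m g y"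
  shows "\<exists>q. \<forall>x\<in>set gs ^ q. x * y \<in> fil D (m + q)"
  using assms
proof (induction gs)
  case Nil
  then show ?case by (intro exI[of _ 1]) simp
next
  case (Cons g gs)
  then obtain q where q: "\<And>x. x \<in> set gs ^ q \<Longrightarrow> x * y \<in> fil D (m + q)" by auto
  obtain t where t: "g ^ t * y \<in> fil D (m + t)" using Cons.prems(2)[of g] by (auto simp: nil_def)
  have "x * y \<in> fil D (m + (t + q))" if x: "x \<in> set (g # gs) ^ (t + q)" for x
  proof -
    obtain i z where iz: "i \<le> t + q" "z \<in> set gs ^ (t + q - i)" "x = g ^ i * z"
      using set_power_insert[of x g "set gs" "t + q"] x by auto
    have gi: "g ^ j \<in> I ^ j" for j using Cons.prems(1) by (intro in_set_power) auto
    have zI: "set gs ^ n \<subseteq> I ^ n" for n using Cons.prems(1) by (intro set_power_mono) auto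
    show ?thesis
    proof (cases "t \<le> i")
      case True
      have "g ^ (i - t) * z \<in> I ^ (i - t) * I ^ (t + q - i)" using gi zI iz(2) by blast
      then have "g ^ (i - t) * z \<in> I ^ q" using True iz(1) by (simp flip: power_add)
      then have "(g ^ (i - t) * z) * (g ^ t * y) \<in> fil D ((m + t) + q)" using t by (rule fil_mult_power)
      moreover have "g ^ i = g ^ (i - t) * g ^ t" using True by (simp flip: power_add)
      ultimately show ?thesis using iz(3) by (simp add: ac_simps)
    next
      case False
      then have "t + q - i = q + (t - i)" by simp
      then obtain z1 z2 where z: "z = z1 * z2" "z1 \<in> set gs ^ q" "z2 \<in> set gs ^ (t - i)"
        using iz(2) by (auto simp: power_add elim: set_times_elim)
      have "g ^ i * z2 \<in> I ^ i * I ^ (t - i)" using gi zI z(3) by blast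
      then have "g ^ i * z2 \<in> I ^ t" using False by (simp flip: power_add)
      then have "(g ^ i * z2) * (z1 * y) \<in> fil D ((m + q) + t)" using q[OF z(2)] by (rule fil_mult_power)
      then show ?thesis using iz(3) z(1) by (simp add: ac_simps)
    qed
  qed
  then show ?case by blast
qed

text \<open>\<open>J\<close> has finitely many generators modulo \<open>k\<close>, each with a power
  that kills y, so some J^q kills y. The reduction equation places a^(n+q) in J^q I^n up to
  I^(n+q+1) and \<open>k\<close>; hence a power of \<open>a\<close> kills y, and \<open>a\<close>
  acts injectively from degree m on.\<close>

lemma reduction_nil:
  assumes J: "idl.subspace J" "k \<subseteq> J" "J \<subseteq> I" "I ^ Suc n \<subseteq> cl (J * I ^ n)"
    and st: "stable D a m" and a: "a \<in> I" and y: "y \<in> pw m" "\<And>g. g \<in> J \<Longrightarrow> nil D m g y"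
  shows "y \<in> fil D m"
proof -
  obtain G where G: "finite G" "J = idl.span (G \<union> k)" using finitely_generated[OF J(1,2)] by blast
  obtain gs where gs: "set gs = G" using finite_list[OF G(1)] by blast
  have GJ: "G \<subseteq> J" using G(2) by (auto intro: idl.span_base)
  then obtain q where q: "\<And>x. x \<in> G ^ q \<Longrightarrow> x * y \<in> fil D (m + q)"
    using nil_list_power[of gs D m y] gs J(3) y(2) by blast
  have ideal: "idl.subspace {x. x * y \<in> fil D j}" for j
  proof (rule idl.subspaceI; simp)
    show "0 \<in> fil D j" by (rule idl.subspace_0[OF subspace_fil])
    show "(x + z) * y \<in> fil D j" if "x * y \<in> fil D j" "z * y \<in> fil D j" for x z
      using idl.subspace_add[OF subspace_fil that] by (simp add: algebra_simps)
    show "c * x * y \<in> fil D j" if "x * y \<in> fil D j" for c x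
      using idl.subspace_scale[OF subspace_fil that, of c] by (simp add: ac_simps)
  qed
  have ky: "x * y \<in> fil D j" if "x \<in> k" for x j using ideal_multL[OF k_ideal that, of y] k_fil by auto
  have Gk: "(G \<union> k) ^ i \<subseteq> idl.span (G ^ i \<union> k)" for i
  proof (induction i)
    case (Suc i)
    have "x * z \<in> idl.span (G ^ Suc i \<union> k)" if "x \<in> G \<union> k" "z \<in> (G \<union> k) ^ i" for x z
    proof (rule mult_into_ideal[OF idl.subspace_span _ subsetD[OF Suc that(2)]])
      fix w assume "w \<in> G ^ i \<union> k"
      then show "x * w \<in> idl.span (G ^ Suc i \<union> k)"
        using that(1) by (auto intro: idl.span_base idl.span_scale span_multL)
    qed
    then show ?case by (auto elim!: set_times_elim)
  next
    case 0
    show ?case using idl.span_superset[of "G ^ 0 \<union> k"] by simp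
  qed
  have "J ^ q \<subseteq> idl.span (G ^ q \<union> k)"
    using span_power_subset[of "G \<union> k" q] idl.span_minimal[OF Gk[of q]] unfolding G(2) by simp
  also have "\<dots> \<subseteq> {x. x * y \<in> fil D (m + q)}"
    using q ky by (intro idl.span_minimal ideal) auto
  finally have Jq: "x * y \<in> fil D (m + q)" if "x \<in> J ^ q" for x using that by blast
  have "J ^ q * I ^ n \<union> k \<union> I ^ Suc (n + q) \<subseteq> {x. x * y \<in> fil D (m + (n + q))}"
  proof
    fix x assume "x \<in> J ^ q * I ^ n \<union> k \<union> I ^ Suc (n + q)"
    then consider u v where "x = u * v" "u \<in> J ^ q" "v \<in> I ^ n" | "x \<in> k" | "x \<in> I ^ Suc (n + q)"
      by (auto elim: set_times_elim)
    then show "x \<in> {x. x * y \<in> fil D (m + (n + q))}"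
    proof cases
      case 1
      have "v * (u * y) \<in> fil D ((m + q) + n)" by (rule fil_mult_power[OF 1(3) Jq[OF 1(2)]])
      then show ?thesis using 1 by (simp add: ac_simps)
    next
      case 2
      then show ?thesis using ky by simp
    next
      case 3
      from pw_mult_power[OF this y(1)] show ?thesis using pw_Suc_fil[of "m + (n + q)" D] by auto
    qed
  qed
  then have "idl.span (J ^ q * I ^ n \<union> k \<union> I ^ Suc (n + q)) \<subseteq> {x. x * y \<in> fil D (m + (n + q))}"
    using ideal by (rule idl.span_minimal)
  moreover have "a ^ (n + q) \<in> cl (J ^ q * I ^ n)"
    using formal_red_power[OF J(4), of q] in_set_power[OF a, of "n + q"] by blast
  then have "a ^ (n + q) \<in> idl.span (J ^ q * I ^ n \<union> k \<union> I ^ Suc (n + q))"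
    using cl_mono[of "J ^ q * I ^ n" "J ^ q * I ^ n \<union> I ^ Suc (n + q)"] by (intro cl_Un_power) blast
  ultimately have "a ^ (n + q) * y \<in> fil D (m + (n + q))" by blast
  then show ?thesis by (rule stable_cancel[OF st a y(1)])
qed

text \<open>This replaces the choice of a general element. By the minimal condition some b in
  \<open>J\<close> has minimal torsion in degree m. If it contained a nonzero y, some g in
  \<open>J\<close> would have no power killing y, and b + u g, for all but finitely many u, would
  lie in \<open>J\<close> and have strictly smaller torsion. So b has no torsion and acts
  surjectively.\<close>

theorem ex_formal_red_in_reduction:
  assumes K: "separated K" "infinite K" and D: "D \<subseteq> I" and a: "a \<in> I"
    and fr: "formal_red (insert a D)"
    and J: "idl.subspace J" "k \<subseteq> J" "J \<subseteq> I" "I ^ Suc n \<subseteq> cl (J * I ^ n)"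
  shows "\<exists>b\<in>J. formal_red (insert b D)"
proof -
  obtain m where st: "stable D a m" using stable_exists[OF fr a D] by blast
  have "nilset D m ` J \<noteq> {}" using idl.subspace_0[OF J(1)] by blast
  moreover have "idl.subspace B \<and> fil D m \<subseteq> B" if "B \<in> nilset D m ` J" for B
    using that nilset_ideal[of _ D m] fil_nilset[OF D, of m] J(3) by blast
  ultimately obtain B where B: "B \<in> nilset D m ` J"
    "\<And>B'. B' \<in> nilset D m ` J \<Longrightarrow> B' \<subseteq> B \<Longrightarrow> B' = B" by (metis dcc_fil)
  then obtain b where b: "b \<in> J" "B = nilset D m b" by blast
  have "nilset D m b \<subseteq> fil D m"
  proof (rule ccontr)
    assume "\<not> ?thesis"
    then obtain y where y: "y \<in> nilset D m b" "y \<notin> fil D m" by blast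
    then obtain g where g: "g \<in> J" "\<not> nil D m g y"
      using reduction_nil[OF J st a, of y] by (auto simp: nilset_def)
    have "finite {u \<in> K. \<not> nilset D m (b + u * g) \<subseteq> nilset D m b \<inter> nilset D m g}"
      using b(1) g(1) J(3) by (intro pencil_finite[OF K(1) D]) auto
    then obtain u where u: "nilset D m (b + u * g) \<subseteq> nilset D m b \<inter> nilset D m g"
      using K(2) by (metis (mono_tags, lifting) finite_subset mem_Collect_eq subsetI)
    have "b + u * g \<in> J" using b g J(1) by (intro idl.subspace_add idl.subspace_scale)
    then have "nilset D m (b + u * g) = nilset D m b" using B(2) u b(2) by blast
    then show False using u y(1) g(2) by (auto simp: nilset_def)
  qed
  then have "onto D b m" using b(1) J(3) by (intro nilset_onto[OF st a _ D]) auto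
  then show ?thesis using onto_formal_red b(1) by blast
qed

end

section \<open>Exchange of generators\<close>

primrec horner :: "'a::comm_ring_1 list \<Rightarrow> 'a \<Rightarrow> 'a" where
  "horner [] u = 0"
| "horner (c # cs) u = c + u * horner cs u"

text \<open>Synthetic division by u - v with quotient \<open>qs\<close>. The last clause runs it
  backwards inside an ideal: the coefficients of \<open>cs\<close> are combinations of those of
  \<open>qs\<close> and of the value at v.\<close>

lemma horner_divide:
  "\<exists>qs. length qs = length cs - 1 \<and> (\<forall>u. horner cs u = horner cs v + (u - v) * horner qs u) \<and>
    (\<forall>Q. idl.subspace Q \<longrightarrow> set qs \<subseteq> Q \<longrightarrow> horner cs v \<in> Q \<longrightarrow> set cs \<subseteq> Q)"
proof (induction cs)
  case Nil
  then show ?case by simp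
next
  case (Cons c cs)
  then obtain qs where qs: "length qs = length cs - 1" "\<And>u. horner cs u = horner cs v + (u - v) * horner qs u"
    "\<And>Q. idl.subspace Q \<Longrightarrow> set qs \<subseteq> Q \<Longrightarrow> horner cs v \<in> Q \<Longrightarrow> set cs \<subseteq> Q" by blast
  show ?case
  proof (cases cs)
    case Nil
    then show ?thesis by (intro exI[of _ "[]"]) simp
  next
    case (Cons c' cs')
    have "\<forall>u. horner (c # cs) u = horner (c # cs) v + (u - v) * horner (horner cs v # qs) u"
    proof
      fix u show "horner (c # cs) u = horner (c # cs) v + (u - v) * horner (horner cs v # qs) u"
        unfolding horner.simps by (subst qs(2)[of u]) (simp add: algebra_simps)
    qed
    moreover have "set (c # cs) \<subseteq> Q"
      if Q: "idl.subspace Q" "set (horner cs v # qs) \<subseteq> Q" "horner (c # cs) v \<in> Q" for Q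
    proof -
      have "horner (c # cs) v - v * horner cs v \<in> Q"
        by (rule idl.subspace_diff[OF Q(1,3) idl.subspace_scale[OF Q(1)]]) (use Q(2) in simp)
      then show ?thesis using qs(3)[OF Q(1)] Q(2) by simp
    qed
    moreover have "length (horner cs v # qs) = length (c # cs) - 1" using qs(1) Cons by simp
    ultimately show ?thesis by blast
  qed
qed

lemma horner_linear_mult: "\<exists>ds. \<forall>u. horner ds u = e + (y + u * z) * horner cs u"
proof (induction cs arbitrary: e)
  case Nil
  then show ?case by (intro exI[of _ "[e]"]) simp
next
  case (Cons c cs)
  obtain ds where "\<And>u. horner ds u = z * c + (y + u * z) * horner cs u" using Cons by blast
  then have "horner ((e + y * c) # ds) u = e + (y + u * z) * horner (c # cs) u" for u
    by (simp add: algebra_simps)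
  then show ?case by blast
qed

text \<open>The coefficient of u is the one that the polarization reads off; the higher ones stay
  unnamed.\<close>

lemma binomial_horner:
  "\<exists>cs. \<forall>u. (y + u * z) ^ Suc n = horner (y ^ Suc n # of_nat (Suc n) * y ^ n * z # cs) u"
proof (induction n)
  case 0
  then show ?case by (intro exI[of _ "[]"]) simp
next
  case (Suc n)
  then obtain cs where cs: "\<And>u. (y + u * z) ^ Suc n = horner (y ^ Suc n # of_nat (Suc n) * y ^ n * z # cs) u" by blast
  obtain ds where ds: "\<And>u. horner ds u = z * (of_nat (Suc n) * y ^ n * z) + (y + u * z) * horner cs u"
    using horner_linear_mult by blast
  have "(y + u * z) ^ Suc (Suc n) = horner (y ^ Suc (Suc n) # of_nat (Suc (Suc n)) * y ^ Suc n * z # ds) u" for u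
  proof -
    have "(y + u * z) ^ Suc (Suc n) = (y + u * z) * (y + u * z) ^ Suc n" by simp
    then show ?thesis unfolding cs by (simp add: ds algebra_simps)
  qed
  then show ?case by blast
qed

context noeth_pair
begin

text \<open>Synthetic division at one point v replaces the determinant: u - v is cancelled at the
  remaining points, and the quotient has one coefficient less.\<close>

lemma vandermonde:
  assumes "separated K" "infinite K" "\<And>u. u \<in> K \<Longrightarrow> horner cs u \<in> cl Y"
  shows "set cs \<subseteq> cl Y"
  using assms
proof (induction "length cs" arbitrary: cs K)
  case (Suc n)
  obtain v where v: "v \<in> K" using Suc.prems(2) by (metis finite.emptyI ex_in_conv)
  obtain qs where qs: "length qs = length cs - 1" "\<And>u. horner cs u = horner cs v + (u - v) * horner qs u"
    "\<And>Q. idl.subspace Q \<Longrightarrow> set qs \<subseteq> Q \<Longrightarrow> horner cs v \<in> Q \<Longrightarrow> set cs \<subseteq> Q"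
    using horner_divide[of cs v] by blast
  have "set qs \<subseteq> cl Y"
  proof (rule Suc.hyps(1))
    show "n = length qs" using qs(1) Suc.hyps(2) by simp
    show "separated (K - {v})" using Suc.prems(1) by (auto simp: separated_def)
    show "infinite (K - {v})" using Suc.prems(2) by simp
    fix u assume u: "u \<in> K - {v}"
    have "horner cs u - horner cs v \<in> cl Y" using Suc.prems(3) u v by (intro cl_diff) auto
    then have "(u - v) * horner qs u \<in> cl Y" using qs(2)[of u] by simp
    then show "horner qs u \<in> cl Y" by (rule separated_cancel[OF Suc.prems(1), rotated -1]) (use u v in auto)
  qed
  then show ?case by (rule qs(3)[OF cl_ideal]) (rule Suc.prems(3)[OF v])
qed simp

text \<open>The factors y are traded one by one for the factors of w. Substituting y + u z for y and
  reading off the coefficient of u gives (r - j) x w' z y^(r-j-1); the integers r - j run through 1,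
  ..., r, all invertible modulo \<open>k\<close>.\<close>

lemma polarization:
  assumes K: "separated K" "infinite K"
    and char: "\<And>n. 0 < n \<Longrightarrow> n \<le> r \<Longrightarrow> \<exists>w. w * of_nat n - 1 \<in> k"
    and x: "\<And>y. y \<in> I \<Longrightarrow> x * y ^ r \<in> cl Y"
    and "w \<in> I ^ r"
  shows "x * w \<in> cl Y"
proof -
  have "x * w * y ^ (r - j) \<in> cl Y" if "j \<le> r" "w \<in> I ^ j" "y \<in> I" for j w y
    using that
  proof (induction j arbitrary: w y)
    case 0
    then show ?case using x by (simp add: set_one)
  next
    case (Suc j)
    obtain z w' where w: "w = z * w'" "z \<in> I" "w' \<in> I ^ j"
      using Suc.prems(2) by (auto elim: set_times_elim)
    define n where "n = r - Suc j"
    have n: "r - j = Suc n" using Suc.prems(1) by (simp add: n_def)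
    obtain cs where cs: "\<And>u. (y + u * z) ^ Suc n = horner (y ^ Suc n # of_nat (Suc n) * y ^ n * z # cs) u"
      using binomial_horner by blast
    have scale: "horner (map ((*) c) ds) u = c * horner ds u" for c :: 'a and ds u
      by (induction ds) (simp_all add: algebra_simps)
    have "horner (map ((*) (x * w')) (y ^ Suc n # of_nat (Suc n) * y ^ n * z # cs)) u \<in> cl Y" for u
    proof -
      have "y + u * z \<in> I" using Suc.prems(3) w(2) I_ideal by (intro idl.subspace_add idl.subspace_scale)
      then have "x * w' * (y + u * z) ^ Suc n \<in> cl Y"
        using Suc.IH[of w' "y + u * z"] Suc.prems(1) w(3) n by simp
      then show ?thesis unfolding scale cs .
    qed
    then have "set (map ((*) (x * w')) (y ^ Suc n # of_nat (Suc n) * y ^ n * z # cs)) \<subseteq> cl Y"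
      by (intro vandermonde[OF K])
    then have "of_nat (Suc n) * (x * w * y ^ n) \<in> cl Y" using w(1) by (simp add: ac_simps del: of_nat_Suc)
    moreover have "Suc n \<le> r" using n by linarith
    then obtain v where "v * of_nat (Suc n) - 1 \<in> k" using char[of "Suc n"] by blast
    ultimately show ?case unfolding n_def[symmetric] by (rule unit_mod_k[rotated])
  qed
  \<comment> \<open>For j = r no factor y is left, so any element of I serves as y.\<close>
  from this[of r w 0] show ?thesis using assms(5) idl.subspace_0[OF I_ideal] by simp
qed

section \<open>Replacing one generator\<close>

lemma reg_of_dvd:
  assumes "reg D c" "c \<in> cl (insert b D)" shows "reg D b"
  unfolding reg_def
proof (intro allI impI)
  fix z assume z: "b * z \<in> cl D"
  obtain s e where s: "s - 1 \<in> I" "s * c - e * b \<in> cl D" using assms(2) by (rule cl_insert_memE)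
  have "z * (s * c - e * b) + e * (b * z) \<in> cl D" by (rule cl_comb[OF s(2) z])
  then have "c * (s * z) \<in> cl D" by (simp add: algebra_simps)
  then have "s * z \<in> cl D" by (rule regD[OF assms(1)])
  then show "z \<in> cl D" by (rule cl_unit[OF s(1)])
qed

text \<open>By the reduction equation a power of \<open>a\<close> is a multiple of \<open>b\<close>
  modulo \<open>D\<close>, and it is regular; so is its divisor \<open>b\<close>.\<close>

lemma reg_exchange:
  assumes "reg D a" "a \<in> I" "formal_red (insert b D)"
  shows "reg D b"
proof -
  obtain n where n: "I ^ Suc n \<subseteq> cl (insert b D * I ^ n)" using assms(3) by (auto simp: formal_red_def)
  have "insert b D * I ^ n \<subseteq> cl (insert b D)"
    by (auto elim!: set_times_elim intro: cl_base intro!: cl_multL)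
  then have "a ^ Suc n \<in> cl (insert b D)" using n in_set_power[OF assms(2), of "Suc n"] cl_minimal by blast
  then show ?thesis by (rule reg_of_dvd[OF reg_power[OF assms(1)]])
qed

text \<open>Let d = length ys + 1. All but t of d t + (t+1) factors from I can be taken among b and
  \<open>ys\<close>. Of these (d-1) t + (t+1) factors, t + 1 equal b unless some y occurs t + 1
  times. So for M = I^(d t) and a in I, a^(t+1) M lies in b^(t+1) M modulo the powers of
  \<open>ys\<close>, as \<open>exchange\<close> requires.\<close>

lemma formal_red_powers:
  assumes E: "set ys \<subseteq> I" "b \<in> I" and fr: "I ^ Suc t \<subseteq> cl (insert b (set ys) * I ^ t)"
  shows "I ^ (Suc (length ys) * t + Suc t) \<subseteq>
    cl ((*) (b ^ Suc t) ` (I ^ (Suc (length ys) * t)) \<union> (\<lambda>y. y ^ Suc t) ` set ys)"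
proof -
  let ?e = "length ys * t" and ?E = "insert b (set ys)"
  let ?Z = "(*) (b ^ Suc t) ` (I ^ (Suc (length ys) * t)) \<union> (\<lambda>y. y ^ Suc t) ` set ys"
  have "x * c \<in> cl ?Z" if x: "x \<in> ?E ^ (?e + Suc t)" and c: "c \<in> I ^ t" for x c
  proof -
    have "?E = set ys \<union> {b}" by auto
    then have "x \<in> idl.span ((\<lambda>y. y ^ Suc t) ` set ys \<union> {b} ^ Suc t * ?E ^ ?e)"
      using span_power_pigeonhole[of ys "{b}" t "Suc t"] x by auto
    then have "c * x \<in> cl ?Z"
    proof (rule mult_into_ideal[OF cl_ideal, rotated])
      fix w assume "w \<in> (\<lambda>y. y ^ Suc t) ` set ys \<union> {b} ^ Suc t * ?E ^ ?e"
      then consider "w \<in> (\<lambda>y. y ^ Suc t) ` set ys" | v where "w = b ^ Suc t * v" "v \<in> ?E ^ ?e"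
        unfolding singleton_power by (auto elim: set_times_elim)
      then show "c * w \<in> cl ?Z"
      proof cases
        case 1
        then show ?thesis by (intro cl_scale cl_base) simp
      next
        case 2
        have "v \<in> I ^ ?e" using 2(2) set_power_mono[of ?E I ?e] E by auto
        then have "c * v \<in> I ^ t * I ^ ?e" using c by blast
        then have "c * v \<in> I ^ (Suc (length ys) * t)" by (simp add: power_add)
        then have "b ^ Suc t * (c * v) \<in> cl ?Z" by (intro cl_base) blast
        then show ?thesis using 2(1) by (simp add: mult.left_commute)
      qed
    qed
    then show ?thesis by (simp add: mult.commute)
  qed
  then have "?E ^ (?e + Suc t) * I ^ t \<subseteq> cl ?Z" by (auto elim!: set_times_elim)
  moreover have "I ^ (t + (?e + Suc t)) \<subseteq> cl (?E ^ (?e + Suc t) * I ^ t)" by (rule formal_red_power[OF fr])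
  ultimately have "I ^ (t + (?e + Suc t)) \<subseteq> cl ?Z" using cl_minimal by blast
  then show ?thesis by (simp add: ac_simps)
qed

text \<open>Large t only: each exchange may raise the exponent from which the current generators
  satisfy the reduction equation.\<close>

definition eventually_colon :: "'a \<Rightarrow> 'a list \<Rightarrow> bool" where
  "eventually_colon x xs \<longleftrightarrow> (\<exists>t0. \<forall>t\<ge>t0. \<forall>m\<in>I ^ (length xs * t). x * m \<in> cl ((\<lambda>y. y ^ Suc t) ` set xs))"

lemma eventually_colon_exchange:
  assumes I: "set ys \<subseteq> I" "a \<in> I" "b \<in> I" and creg: "creg {} (ys @ [a])"
    and fr: "formal_red (insert b (set ys))" and x: "eventually_colon x (ys @ [a])"
  shows "eventually_colon x (ys @ [b])"
proof -
  obtain n where n: "I ^ Suc n \<subseteq> cl (insert b (set ys) * I ^ n)" using fr by (auto simp: formal_red_def)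
  obtain t0 where t0: "\<And>t m. t0 \<le> t \<Longrightarrow> m \<in> I ^ (length (ys @ [a]) * t) \<Longrightarrow>
      x * m \<in> cl ((\<lambda>y. y ^ Suc t) ` set (ys @ [a]))" using x by (auto simp: eventually_colon_def)
  have "x * m \<in> cl ((\<lambda>y. y ^ Suc t) ` set (ys @ [b]))"
    if t: "max n t0 \<le> t" and m: "m \<in> I ^ (length (ys @ [b]) * t)" for t m
  proof -
    let ?D = "(\<lambda>y. y ^ Suc t) ` set ys" and ?M = "I ^ (Suc (length ys) * t)"
    have "creg {} (map (\<lambda>y. y ^ Suc t) (ys @ [a]))" using I by (intro creg_powers[OF creg]) auto
    then have "reg ?D (a ^ Suc t)" by (simp add: creg_append del: power_Suc)
    moreover have "x * m \<in> cl (insert (a ^ Suc t) ?D)" if "m \<in> ?M" for m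
      using t0[of t m] t that by simp
    moreover have "a ^ Suc t * m \<in> cl ((*) (b ^ Suc t) ` ?M \<union> ?D)" if "m \<in> ?M" for m
    proof -
      have "m * a ^ Suc t \<in> ?M * I ^ Suc t" using that in_set_power[OF I(2), of "Suc t"] by blast
      then have "a ^ Suc t * m \<in> I ^ (Suc (length ys) * t + Suc t)"
        unfolding power_add by (simp only: mult.commute)
      then show ?thesis
        using formal_red_powers[OF I(1,3) formal_red_ge[OF n, of t]] t by auto
    qed
    moreover have "m \<in> ?M" using m by simp
    ultimately have "x * m \<in> cl (insert (b ^ Suc t) ?D)" by (rule exchange)
    then show ?thesis by simp
  qed
  then show ?thesis unfolding eventually_colon_def by blast
qed

lemma eventually_colon_rotate: "eventually_colon x (ys @ [b]) \<longleftrightarrow> eventually_colon x (b # ys)"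
  by (simp add: eventually_colon_def)

text \<open>With Q = (xs) and d = length xs, I^(d t) equals Q^(d t - n) I^n up to closure, so x
  carries it into Q^(d t + 1), and every product of d t + 1 generators contains a (t+1)st
  power.\<close>

lemma colon_eventually:
  assumes xs: "set xs \<subseteq> I" "xs \<noteq> []" and fr: "I ^ Suc n \<subseteq> cl (set xs * I ^ n)"
    and x: "\<And>m. m \<in> I ^ n \<Longrightarrow> x * m \<in> cl (set xs ^ Suc n)" and t: "n \<le> t" and m: "m \<in> I ^ (length xs * t)"
  shows "x * m \<in> cl ((\<lambda>y. y ^ Suc t) ` set xs)"
proof -
  let ?Z = "(\<lambda>y. y ^ Suc t) ` set xs"
  have "t \<le> length xs * t" using xs(2) by (cases xs) auto
  then obtain j where j: "length xs * t = n + j" using t by (metis le_add_diff_inverse order_trans)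
  have pigeon: "set xs ^ (j + Suc n) \<subseteq> cl ?Z"
  proof -
    have "set xs ^ (j + Suc n) = (set xs \<union> {}) ^ (length xs * t + 1)" using j by (simp add: ac_simps)
    also have "\<dots> \<subseteq> idl.span (?Z \<union> {} ^ 1 * (set xs \<union> {}) ^ (length xs * t))"
      by (rule span_power_pigeonhole)
    also have "?Z \<union> {} ^ 1 * (set xs \<union> {}) ^ (length xs * t) = ?Z" by (simp add: set_times_def)
    finally show ?thesis using cl_span by blast
  qed
  show ?thesis
  proof (rule cl_mult_into)
    show "m \<in> cl (set xs ^ j * I ^ n)" using formal_red_power[OF fr, of j] m j by auto
    fix y assume "y \<in> set xs ^ j * I ^ n"
    then obtain u v where uv: "y = u * v" "u \<in> set xs ^ j" "v \<in> I ^ n" by (rule set_times_elim)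
    have "u * (x * v) \<in> cl ?Z"
    proof (rule cl_mult_into[OF _ x[OF uv(3)]])
      fix w assume "w \<in> set xs ^ Suc n"
      then have "u * w \<in> set xs ^ j * set xs ^ Suc n" using uv(2) by blast
      then show "u * w \<in> cl ?Z" using pigeon by (auto simp only: power_add)
    qed
    then show "x * y \<in> cl ?Z" using uv(1) by (simp add: ac_simps)
  qed
qed

end

context zero_dim_pair
begin

text \<open>The generators of \<open>xs\<close> are exchanged one at a time for elements of \<open>J\<close>.\<close>

lemma colon_in_reduction:
  assumes K: "separated K" "infinite K"
    and xs: "set xs \<subseteq> I" "creg {} xs" "formal_red (set xs)" and x: "eventually_colon x xs"
    and J: "idl.subspace J" "k \<subseteq> J" "J \<subseteq> I" "I ^ Suc n \<subseteq> cl (J * I ^ n)"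
  shows "x \<in> cl J"
proof -
  have "\<exists>bs as. length bs = j \<and> length as = length xs - j \<and> set bs \<subseteq> J \<and> set as \<subseteq> I \<and>
    creg {} (bs @ as) \<and> formal_red (set (bs @ as)) \<and> eventually_colon x (bs @ as)" if "j \<le> length xs" for j
    using that
  proof (induction j)
    case 0
    then show ?case using xs x by (intro exI[of _ "[]"] exI[of _ xs]) simp
  next
    case (Suc j)
    then obtain bs as where bs: "length bs = j" "length as = length xs - j" "set bs \<subseteq> J" "set as \<subseteq> I"
      "creg {} (bs @ as)" "formal_red (set (bs @ as))" "eventually_colon x (bs @ as)" by auto
    then have "as \<noteq> []" using Suc.prems by auto
    then obtain ys a where as: "as = ys @ [a]" by (metis rev_exhaust)
    let ?D = "set (bs @ ys)"
    have D: "?D \<subseteq> I" "a \<in> I" using bs J(3) as by auto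
    have frD: "formal_red (insert a ?D)" using bs(6) as by simp
    then obtain b where b: "b \<in> J" "formal_red (insert b ?D)"
      using ex_formal_red_in_reduction[OF K D frD J] by blast
    have bI: "b \<in> I" using b J by auto
    have creg: "creg {} ((bs @ ys) @ [a])" using bs(5) as by simp
    then have "reg ?D a" by (simp add: creg_append)
    then have "reg ?D b" using D(2) b(2) by (rule reg_exchange)
    then have "creg {} ((bs @ ys) @ [b])" using creg by (simp add: creg_append)
    \<comment> \<open>The new generator moves to the front, so that the next exchange again concerns
      the last place, where regularity can be changed for one entry alone.\<close>
    then have "creg {} (b # bs @ ys)" using creg_rotate[of b "bs @ ys"] D bI by auto
    moreover have "eventually_colon x ((bs @ ys) @ [b])"
      using bs(7) as by (intro eventually_colon_exchange[OF D bI creg b(2)]) simp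
    then have "eventually_colon x (b # bs @ ys)" unfolding eventually_colon_rotate by simp
    moreover have "formal_red (set (b # bs @ ys))" using b(2) by simp
    ultimately show ?case using bs as b(1)
      by (intro exI[of _ "b # bs"] exI[of _ ys]) auto
  qed
  from this[of "length xs"] obtain bs where bs: "length bs = length xs" "set bs \<subseteq> J" "creg {} bs" "eventually_colon x bs"
    by auto
  obtain t0 where t0: "\<And>t m. t0 \<le> t \<Longrightarrow> m \<in> I ^ (length bs * t) \<Longrightarrow> x * m \<in> cl ((\<lambda>y. y ^ Suc t) ` set bs)"
    using bs(4) by (auto simp: eventually_colon_def)
  have bsI: "set bs \<subseteq> I" using bs(2) J(3) by blast
  have "x \<in> cl ({} \<union> set bs)"
  proof (rule colon_generators[OF bs(3) bsI])
    fix q assume "q \<in> set bs ^ (length bs * t0)"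
    then have "q \<in> I ^ (length bs * t0)" using set_power_mono[OF bsI] by blast
    then show "x * q \<in> cl ({} \<union> (\<lambda>x. x ^ Suc t0) ` set bs)" using t0[of t0 q] by simp
  qed
  then show ?thesis using cl_mono[OF bs(2)] by auto
qed

end

section \<open>Elements of the core\<close>

context noeth_pair
begin

lemma sheared_span:
  "length xs = length cs \<Longrightarrow> set xs \<subseteq> idl.span (insert a (set (map2 (\<lambda>x c. x - c * a) xs cs)))"
proof (induction xs cs rule: list_induct2)
  case (Cons x xs c cs)
  let ?T = "insert a (set (map2 (\<lambda>x c. x - c * a) (x # xs) (c # cs)))"
  have "(x - c * a) + c * a \<in> idl.span ?T"
    by (intro idl.span_add idl.span_scale idl.span_base) auto
  then have "x \<in> idl.span ?T" by simp
  moreover have "idl.span (insert a (set (map2 (\<lambda>x c. x - c * a) xs cs))) \<subseteq> idl.span ?T"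
    by (rule idl.span_mono) auto
  ultimately show ?case using Cons.IH by auto
qed simp

lemma reg_sheared:
  assumes "length xs = length cs" "creg D (a # xs)" "set (a # xs) \<subseteq> I"
  shows "reg (D \<union> set (map2 (\<lambda>x c. x - c * a) xs cs)) a"
  using assms
proof (induction xs cs arbitrary: D rule: list_induct2)
  case (Cons x xs c cs)
  have "creg (insert (x - c * a) D) (a # xs)" by (rule creg_shear[OF Cons.prems])
  then have "reg (insert (x - c * a) D \<union> set (map2 (\<lambda>x c. x - c * a) xs cs)) a"
    using Cons.prems by (intro Cons.IH) auto
  then show ?case by simp
qed simp

lemma formal_red_mono:
  assumes "formal_red E" "E \<subseteq> idl.span E'" shows "formal_red E'"
proof -
  obtain n where n: "I ^ Suc n \<subseteq> cl (E * I ^ n)" using assms(1) by (auto simp: formal_red_def)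
  have "x * c \<in> cl (E' * I ^ n)" if "x \<in> E" "c \<in> I ^ n" for x c
    using that assms(2) by (intro cl_times cl_span cl_base) auto
  then have "E * I ^ n \<subseteq> cl (E' * I ^ n)" by (auto elim!: set_times_elim)
  then show ?thesis using n cl_minimal unfolding formal_red_def by blast
qed

text \<open>Stated without the closure, so that these are exactly the preimages of the reductions in
  the quotient by \<open>k\<close>.\<close>

definition reduction :: "'a set \<Rightarrow> bool" where
  "reduction L \<longleftrightarrow> idl.subspace L \<and> k \<subseteq> L \<and> L \<subseteq> I \<and> (\<exists>n. I ^ Suc n \<subseteq> idl.span (L * I ^ n \<union> k))"

text \<open>A formal reduction need not generate a reduction, but E + I^N + k is one for every N >
  0, because the error in the reduction equation can be pushed into I^N I^n. So x lies in all these
  ideals, and I-adic closedness removes I^N.\<close>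

lemma core_subset_cl:
  assumes x: "\<And>L. reduction L \<Longrightarrow> x \<in> L" and E: "E \<subseteq> I" "formal_red E"
  shows "x \<in> cl E"
proof (rule cl_closed)
  fix N
  show "x \<in> cl (E \<union> I ^ N)"
  proof (cases N)
    case 0
    then show ?thesis using cl_Un_one(1)[of E] by simp
  next
    case (Suc N')
    obtain n where n: "I ^ Suc n \<subseteq> cl (E * I ^ n)" using E(2) by (auto simp: formal_red_def)
    define L where "L = idl.span (E \<union> I ^ N \<union> k)"
    have "I ^ N \<subseteq> I" using ideal_times_subset(1)[OF I_ideal] Suc by simp
    then have "L \<subseteq> I" unfolding L_def using E(1) k_subset I_ideal by (intro idl.span_minimal) auto
    moreover have "E \<union> I ^ N \<union> k \<subseteq> L" unfolding L_def by (rule idl.span_superset)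
    moreover have "I ^ Suc n \<subseteq> idl.span (L * I ^ n \<union> k)"
    proof -
      have "I ^ Suc n \<subseteq> idl.span (E * I ^ n \<union> k \<union> I ^ (N + n))"
        using n cl_mono[of "E * I ^ n" "E * I ^ n \<union> I ^ (N + n)"] cl_Un_power by blast
      also have "E * I ^ n \<union> k \<union> I ^ (N + n) \<subseteq> L * I ^ n \<union> k"
        using \<open>E \<union> I ^ N \<union> k \<subseteq> L\<close> set_times_mono2[of E L "I ^ n" "I ^ n"]
          set_times_mono2[of "I ^ N" L "I ^ n" "I ^ n"] by (auto simp: power_add)
      then have "idl.span (E * I ^ n \<union> k \<union> I ^ (N + n)) \<subseteq> idl.span (L * I ^ n \<union> k)" by (rule idl.span_mono)
      finally show ?thesis .
    qed
    ultimately have "reduction L" unfolding reduction_def L_def by auto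
    then have "x \<in> L" by (rule x)
    then show ?thesis unfolding L_def by (intro span_in_cl)
  qed
qed

text \<open>With \<open>b u = a + u * y\<close>, any two of the \<open>b u\<close> generate the ideal \<open>(a, y)\<close>.\<close>

lemma product_colon:
  assumes K: "separated K" and x: "\<And>u. u \<in> U \<Longrightarrow> x \<in> cl (insert (a + u * y) D)" and U: "U \<subseteq> K"
    and "length us = Suc n" "distinct us" "set us \<subseteq> U" "h \<in> {a, y} ^ n"
  shows "x * h \<in> cl (insert (\<Prod>u\<leftarrow>us. a + u * y) D)"
  using assms(4-)
proof (induction n arbitrary: us h)
  case 0
  then obtain u where "us = [u]" by (auto simp: length_Suc_conv)
  then show ?case using 0 x[of u] by (simp add: set_one)
next
  case (Suc n)
  obtain u v zs where us: "us = u # v # zs" using Suc.prems(1) by (metis length_Suc_conv)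
  obtain g h' where h: "h = g * h'" "g \<in> {a, y}" "h' \<in> {a, y} ^ n"
    using Suc.prems(4) by (auto elim: set_times_elim)
  let ?P = "\<lambda>us. \<Prod>u\<leftarrow>us. a + u * y"
  have scale: "c * (x * h') \<in> cl (insert (c * p) D)" if "x * h' \<in> cl (insert p D)" for c p
    by (rule cl_mult_into[OF _ that]) (auto intro: cl_base cl_scale)
  have "(a + u * y) * (x * h') \<in> cl (insert (?P us) D)"
    using scale[OF Suc.IH[of "v # zs" h'], of "a + u * y"] Suc.prems us h by simp
  moreover have "(a + v * y) * (x * h') \<in> cl (insert (?P us) D)"
    using scale[OF Suc.IH[of "u # zs" h'], of "a + v * y"] Suc.prems us h by (simp add: ac_simps)
  ultimately have comb: "c * ((a + u * y) * (x * h')) - d * ((a + v * y) * (x * h')) \<in> cl (insert (?P us) D)" for c d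
    by (rule cl_comb_diff)
  have "(u - v) * (x * h) \<in> cl (insert (?P us) D)"
  proof (cases "g = y")
    case True
    then show ?thesis using comb[of 1 1] h(1) by (simp add: algebra_simps)
  next
    case False
    then have "g = a" using h(2) by simp
    \<comment> \<open>The coefficients come from -v (a + u y) + u (a + v y) = (u - v) a.\<close>
    then show ?thesis using comb[of "- v" "- u"] h(1) by (simp add: algebra_simps)
  qed
  then show ?case
    by (rule separated_cancel[OF K, rotated -1]) (use us Suc.prems U in auto)
qed

text \<open>Modulo \<open>D\<close>, \<open>y\<close> is integral over \<open>(a)\<close>; the finiteness comes from the ascending chain of the
  ideals \<open>E j\<close>, which are the submodules \<open>a ^ m R[y / a]\<close> truncated at degree \<open>j\<close>.\<close>

lemma integral_over_principal:
  assumes fr: "formal_red (insert a D)" and reg: "reg D a" and y: "y \<in> I"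
  shows "\<exists>j0. \<forall>j\<ge>j0. y ^ Suc j \<in> cl (D \<union> (*) a ` ({a, y} ^ j))"
proof -
  obtain m where m: "I ^ Suc m \<subseteq> cl (insert a D * I ^ m)" using fr by (auto simp: formal_red_def)
  have power_in: "I ^ (m + i) \<subseteq> cl (D \<union> (*) (a ^ i) ` (I ^ m))" for i
  proof -
    have "insert a D ^ i * I ^ m \<subseteq> cl (D \<union> (*) (a ^ i) ` (I ^ m))"
    proof
      fix z assume "z \<in> insert a D ^ i * I ^ m"
      then obtain u v where uv: "z = u * v" "u \<in> insert a D ^ i" "v \<in> I ^ m" by (rule set_times_elim)
      have "u \<in> cl (D \<union> {a ^ i})"
      proof -
        obtain l w where lw: "l \<le> i" "w \<in> D ^ (i - l)" "u = a ^ l * w" using set_power_insert[OF uv(2)] by blast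
        show ?thesis
        proof (cases "l = i")
          case True
          then show ?thesis using lw by (simp add: set_one cl_base)
        next
          case False
          then obtain q where "i - l = Suc q" using lw(1) by (metis Suc_diff_Suc le_neq_implies_less)
          then obtain d w' where "w = d * w'" "d \<in> D" using lw(2) by (auto elim: set_times_elim)
          then have "w \<in> cl (D \<union> {a ^ i})" by (auto intro: cl_base cl_multL)
          then show ?thesis using lw(3) by (auto intro: cl_scale)
        qed
      qed
      then have "v * u \<in> cl (D \<union> (*) (a ^ i) ` (I ^ m))"
        by (rule cl_Un_scale) (use uv(3) in \<open>auto simp: mult.commute intro!: cl_base\<close>)
      then show "z \<in> cl (D \<union> (*) (a ^ i) ` (I ^ m))" using uv(1) by (simp add: mult.commute)
    qed
    then show ?thesis using formal_red_power[OF m, of i] cl_minimal by blast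
  qed
  define E where "E j = {w. a ^ j * w \<in> cl (D \<union> (*) (a ^ m) ` ({a, y} ^ j))}" for j
  have "idl.subspace (E j)" for j
  proof (rule idl.subspaceI)
    show "0 \<in> E j" by (simp add: E_def cl_zero)
    show "v + w \<in> E j" if "v \<in> E j" "w \<in> E j" for v w
      using that by (auto simp: E_def distrib_left intro: cl_add)
    show "c * w \<in> E j" if "w \<in> E j" for c w
      using that cl_scale[of "a ^ j * w" _ c] by (simp add: E_def ac_simps)
  qed
  moreover have "k \<subseteq> E j" for j by (auto simp: E_def intro: cl_scale cl_k)
  moreover have "E j \<subseteq> E (Suc j)" for j
  proof
    fix w assume "w \<in> E j"
    then have "a ^ j * w \<in> cl (D \<union> (*) (a ^ m) ` ({a, y} ^ j))" by (simp add: E_def)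
    then have "a * (a ^ j * w) \<in> cl (D \<union> (*) (a ^ m) ` ({a, y} ^ Suc j))"
    proof (rule cl_Un_scale)
      fix v assume "v \<in> (*) (a ^ m) ` ({a, y} ^ j)"
      then obtain h where h: "v = a ^ m * h" "h \<in> {a, y} ^ j" by blast
      then have "a * h \<in> {a, y} ^ Suc j" by auto
      then have "a ^ m * (a * h) \<in> cl (D \<union> (*) (a ^ m) ` ({a, y} ^ Suc j))" by (intro cl_base) blast
      then show "a * v \<in> cl (D \<union> (*) (a ^ m) ` ({a, y} ^ Suc j))" using h(1) by (simp add: ac_simps)
    qed
    then show "w \<in> E (Suc j)" by (simp add: E_def mult.assoc)
  qed
  ultimately have "\<exists>n. \<forall>j\<ge>n. E j = E n" by (rule chain_stable)
  then obtain n where n: "\<And>j. n \<le> j \<Longrightarrow> E j = E n" by blast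
  have "y ^ Suc j \<in> cl (D \<union> (*) a ` ({a, y} ^ j))" if j: "max n m \<le> j" for j
  proof -
    obtain i where i: "Suc j = m + i" using j by (metis le_Suc_eq le_add_diff_inverse max.bounded_iff)
    have "y ^ Suc j \<in> I ^ (m + i)" using in_set_power[OF y] i by metis
    then have "y ^ Suc j \<in> cl (D \<union> (*) (a ^ i) ` (I ^ m))" using power_in by blast
    then obtain s w where sw: "s - 1 \<in> I" "s * y ^ Suc j - a ^ i * w \<in> cl D"
      unfolding cl_Un[of _ D] using span_image_mult by blast
    let ?Y = "(*) (a ^ m) ` ({a, y} ^ Suc j)"
    have "y ^ Suc j \<in> {a, y} ^ Suc j" by (intro in_set_power) simp
    then have "a ^ m * y ^ Suc j \<in> cl (D \<union> ?Y)" by (intro cl_base) blast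
    moreover have "s * y ^ Suc j - a ^ i * w \<in> cl (D \<union> ?Y)" using sw(2) cl_mono[of D "D \<union> ?Y"] by blast
    ultimately have "s * (a ^ m * y ^ Suc j) - a ^ m * (s * y ^ Suc j - a ^ i * w) \<in> cl (D \<union> ?Y)"
      by (rule cl_comb_diff)
    then have "(a ^ m * a ^ i) * w \<in> cl (D \<union> ?Y)" by (simp add: algebra_simps)
    then have "w \<in> E (Suc j)" using i by (simp add: E_def power_add[symmetric])
    \<comment> \<open>The drop from j + 1 to j is the whole gain: a^(j+1) w now lies in a^m times a
      (a, y)^j, so y^(j+1) acquires the factor \<open>a\<close> once a^m is cancelled.\<close>
    then have "w \<in> E j" using n[of j] n[of "Suc j"] j by simp
    let ?X = "(*) a ` ({a, y} ^ j)"
    have "a * (a ^ j * w) \<in> cl (D \<union> (*) (a ^ m) ` ?X)"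
      using \<open>w \<in> E j\<close> unfolding E_def mem_Collect_eq
    proof (rule cl_Un_scale)
      fix v assume "v \<in> (*) (a ^ m) ` ({a, y} ^ j)"
      then obtain h where h: "v = a ^ m * h" "h \<in> {a, y} ^ j" by blast
      then have "a ^ m * (a * h) \<in> cl (D \<union> (*) (a ^ m) ` ?X)" by (intro cl_base) blast
      then show "a * v \<in> cl (D \<union> (*) (a ^ m) ` ?X)" using h(1) by (simp add: ac_simps)
    qed
    then have "a ^ Suc j * w \<in> cl (D \<union> (*) (a ^ m) ` ?X)" by (simp add: mult.assoc)
    moreover have "s * y ^ Suc j - a ^ i * w \<in> cl (D \<union> (*) (a ^ m) ` ?X)"
      using sw(2) cl_mono[of D "D \<union> (*) (a ^ m) ` ?X"] by blast
    ultimately have "1 * (a ^ Suc j * w) + a ^ m * (s * y ^ Suc j - a ^ i * w) \<in> cl (D \<union> (*) (a ^ m) ` ?X)"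
      by (rule cl_comb)
    moreover have "a ^ Suc j = a ^ m * a ^ i" using i by (simp flip: power_add)
    then have "1 * (a ^ Suc j * w) + a ^ m * (s * y ^ Suc j - a ^ i * w) = a ^ m * (s * y ^ Suc j)"
      by (simp add: algebra_simps del: power_Suc)
    ultimately have "a ^ m * (s * y ^ Suc j) \<in> cl (D \<union> (*) (a ^ m) ` ?X)" by (simp only:)
    then obtain s' v where s': "s' - 1 \<in> I" "v \<in> idl.span ?X" "s' * (a ^ m * (s * y ^ Suc j)) - a ^ m * v \<in> cl D"
      unfolding cl_Un[of _ D] using span_image_mult[of _ "a ^ m" ?X] by blast
    have "a ^ m * (s' * (s * y ^ Suc j) - v) \<in> cl D" using s'(3) by (simp add: algebra_simps)
    then have "s' * (s * y ^ Suc j) - v \<in> cl D" by (rule regD[OF reg_power[OF reg]])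
    then have "s * y ^ Suc j \<in> cl (D \<union> ?X)" unfolding cl_Un using s'(1,2) by blast
    then show ?thesis by (rule cl_unit[OF sw(1)])
  qed
  then show ?thesis by blast
qed

end

context zero_dim_pair
begin

text \<open>For large j, H = (a, y)^j satisfies (a, y) H <= a H modulo \<open>D\<close>, so a
  product B of j + 1 elements a + u y satisfies B H <= a^(j+1) H. This is the situation of
  \<open>exchange\<close>, with B as the old element and a^(j+1) as the new one. The number j + 1 of
  factors is what \<open>product_colon\<close> requires for x H <= (B).\<close>

lemma core_colon_line:
  assumes K: "separated K" "infinite K" and D: "D \<subseteq> I" and a: "a \<in> I" and y: "y \<in> I"
    and fr: "formal_red (insert a D)" and reg: "reg D a" and x: "\<And>L. reduction L \<Longrightarrow> x \<in> L"
  shows "x * y ^ r \<in> cl (insert (a ^ Suc r) D)"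
proof -
  define U where "U = {u \<in> K. formal_red (insert (a + u * y) D)}"
  have bI: "a + u * y \<in> I" for u using a y I_ideal by (intro idl.subspace_add idl.subspace_scale)
  have "K - U = {u \<in> K. \<not> formal_red (insert (a + u * y) D)}" by (auto simp: U_def)
  then have "infinite U"
    using K(2) pencil_formal_red[OF K(1) D a y fr] by (metis Diff_infinite_finite finite_Diff2 U_def
      finite_Un infinite_super mem_Collect_eq Diff_partition subsetI)
  have xU: "x \<in> cl (insert (a + u * y) D)" if "u \<in> U" for u
    using that D bI by (intro core_subset_cl[OF x]) (auto simp: U_def)
  have regU: "reg D (a + u * y)" if "u \<in> U" for u
    using that by (intro reg_exchange[OF reg a]) (simp add: U_def)
  obtain j0 where j0: "\<And>j. j0 \<le> j \<Longrightarrow> y ^ Suc j \<in> cl (D \<union> (*) a ` ({a, y} ^ j))"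
    using integral_over_principal[OF fr reg y] by blast
  define j where "j = max j0 r"
  let ?H = "{a, y} ^ j"
  have H: "{a, y} ^ Suc j \<subseteq> cl (D \<union> (*) a ` ?H)"
  proof -
    have "{a, y} ^ Suc j \<subseteq> (*) a ` ?H \<union> {y ^ Suc j}"
      using power_insert_Suc[of a "{y}" j] unfolding singleton_power .
    also have "\<dots> \<subseteq> cl (D \<union> (*) a ` ?H)" using j0[of j] by (auto simp: j_def intro: cl_base)
    finally show ?thesis .
  qed
  have mult: "(a + u * y) * h \<in> cl (D \<union> (*) a ` ?H)" if "h \<in> ?H" for u h
  proof -
    have "a * h \<in> cl (D \<union> (*) a ` ?H)" "y * h \<in> cl (D \<union> (*) a ` ?H)"
      using that H by auto
    then have "1 * (a * h) + u * (y * h) \<in> cl (D \<union> (*) a ` ?H)" by (rule cl_comb)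
    then show ?thesis by (simp add: algebra_simps)
  qed
  have prod: "(\<Prod>u\<leftarrow>us. a + u * y) * h \<in> cl (D \<union> (*) (a ^ length us) ` ?H)" if "h \<in> ?H" for us h
  proof (induction us)
    case Nil
    then show ?case using that by (simp add: cl_base)
  next
    case (Cons u us)
    have "(a + u * y) * ((\<Prod>u\<leftarrow>us. a + u * y) * h) \<in> cl (D \<union> (*) (a ^ length (u # us)) ` ?H)"
    proof (rule cl_Un_scale[OF Cons])
      fix w assume "w \<in> (*) (a ^ length us) ` ?H"
      then obtain g where g: "w = a ^ length us * g" "g \<in> ?H" by blast
      have "a ^ length us * ((a + u * y) * g) \<in> cl (D \<union> (*) (a ^ length (u # us)) ` ?H)"
        by (rule cl_Un_scale[OF mult[OF g(2)]]) (auto intro!: cl_base simp: ac_simps)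
      then show "(a + u * y) * w \<in> cl (D \<union> (*) (a ^ length (u # us)) ` ?H)" using g(1) by (simp add: ac_simps)
    qed
    then show ?case by (simp add: ac_simps)
  qed
  obtain V where V: "V \<subseteq> U" "finite V" "card V = Suc j" using infinite_arbitrarily_large[OF \<open>infinite U\<close>] by blast
  obtain us where us: "set us = V" "distinct us" using finite_distinct_list[OF V(2)] by blast
  have len: "length us = Suc j" using us V distinct_card[of us] by simp
  let ?B = "\<Prod>u\<leftarrow>us. a + u * y"
  have "reg D (\<Prod>u\<leftarrow>ws. a + u * y)" if "set ws \<subseteq> U" for ws
    using that
  proof (induction ws)
    case Nil
    show ?case unfolding reg_def by simp
  next
    case (Cons u ws)
    then show ?case unfolding list.map prod_list.Cons by (intro reg_prod regU) auto
  qed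
  then have regB: "reg D ?B" using us V by simp
  have UK: "U \<subseteq> K" by (auto simp: U_def)
  have "x * h \<in> cl (insert ?B D)" if "h \<in> ?H" for h
    by (rule product_colon[OF K(1) xU UK len us(2)]) (use us V that in auto)
  moreover have "?B * h \<in> cl ((*) (a ^ Suc j) ` ?H \<union> D)" if "h \<in> ?H" for h
    using prod[OF that, of us] len by (simp add: Un_commute)
  \<comment> \<open>j was taken at least r so that y^r can be padded to degree j; the padding is
    cancelled at the end.\<close>
  moreover have "a ^ (j - r) * y ^ r \<in> ?H"
  proof -
    have "a ^ (j - r) * y ^ r \<in> {a, y} ^ (j - r) * {a, y} ^ r" by (intro set_times_intro in_set_power) auto
    then show ?thesis by (simp add: j_def flip: power_add)
  qed
  ultimately have "x * (a ^ (j - r) * y ^ r) \<in> cl (insert (a ^ Suc j) D)" by (rule exchange[OF regB])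
  moreover have "a ^ Suc j = a ^ (j - r) * a ^ Suc r" by (simp add: j_def flip: power_add power_Suc)
  ultimately have "a ^ (j - r) * (x * y ^ r) \<in> cl (insert (a ^ (j - r) * a ^ Suc r) D)" by (simp add: ac_simps)
  then show ?thesis by (rule reg_div[OF reg_power[OF reg]])
qed

theorem core_in_colon:
  assumes K: "separated K" "infinite K"
    and char: "\<And>n. 0 < n \<Longrightarrow> n \<le> r \<Longrightarrow> \<exists>w. w * of_nat n - 1 \<in> k"
    and xs: "set xs \<subseteq> I" "xs \<noteq> []" "creg {} xs" "formal_red (set xs)"
    and x: "\<And>L. reduction L \<Longrightarrow> x \<in> L" and w: "w \<in> I ^ r"
  shows "x * w \<in> cl (set xs ^ Suc r)"
proof (rule polarization[OF K char _ w])
  fix y assume y: "y \<in> I"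
  obtain a ys where as: "xs = a # ys" using xs(2) by (cases xs) auto
  have "x * y ^ r \<in> cl ({} \<union> set (a # ys) ^ Suc r)"
  proof (rule lines_intersection[OF K])
    fix cs assume cs: "length cs = length ys" "set cs \<subseteq> K"
    \<comment> \<open>Modulo \<open>?D\<close> every other generator is a multiple of
      \<open>a\<close>, so \<open>a\<close> alone generates a formal reduction.\<close>
    let ?D = "set (map2 (\<lambda>x c. x - c * a) ys cs)"
    have "reg ({} \<union> ?D) a" using cs xs as by (intro reg_sheared) auto
    moreover have "formal_red (insert a ?D)"
      using sheared_span[of ys cs a] cs as by (intro formal_red_mono[OF xs(4)]) (auto intro: idl.span_base)
    moreover have "?D \<subseteq> I"
      using xs(1) as I_ideal by (auto elim!: in_set_zipE intro!: idl.subspace_diff idl.subspace_scale)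
    ultimately show "x * y ^ r \<in> cl (insert (a ^ Suc r) ({} \<union> ?D))"
      using xs(1) as by (simp del: power_Suc) (intro core_colon_line[OF K _ _ y _ _ x]; auto)
  qed (use xs as in auto)
  then show "x * y ^ r \<in> cl (set xs ^ Suc r)" using as by simp
qed (simp_all)

end

section \<open>Presentation of a ring by the free commutative ring\<close>

lemma poly_mapping_single_induct [case_names zero add single]:
  fixes p :: "'a \<Rightarrow>\<^sub>0 'b::comm_monoid_add"
  assumes "P 0" "\<And>p q. P p \<Longrightarrow> P q \<Longrightarrow> P (p + q)" "\<And>m c. P (Poly_Mapping.single m c)"
  shows "P p"
proof (induction p rule: update_induct)
  case const
  then show ?case by (rule assms(1))
next
  case (update f a b)
  have "Poly_Mapping.update a b f = f + Poly_Mapping.single a b"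
    using update(1) by (intro poly_mapping_eqI) (auto simp: lookup_update lookup_add lookup_single when_def in_keys_iff)
  then show ?case using assms(2)[OF update(3) assms(3)] by simp
qed

context cring
begin

text \<open>The variables are all elements of the type. Those outside the carrier are sent to 1, so
  that every monomial has a value in the carrier.\<close>

definition mon_eval :: "'a multiset \<Rightarrow> 'a" where
  "mon_eval m = finprod R (\<lambda>a. (if a \<in> carrier R then a else \<one>) [^] count m a) (set_mset m)"

lemma mon_eval_superset:
  "finite A \<Longrightarrow> set_mset m \<subseteq> A \<Longrightarrow>
    mon_eval m = finprod R (\<lambda>a. (if a \<in> carrier R then a else \<one>) [^] count m a) A"
  unfolding mon_eval_def by (rule finprod_mono_neutral_cong_left) (auto simp: not_in_iff)

lemma mon_eval_closed: "mon_eval m \<in> carrier R"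
  unfolding mon_eval_def by (rule finprod_closed) auto

lemma mon_eval_zero: "mon_eval {#} = \<one>"
  by (simp add: mon_eval_def)

lemma mon_eval_add: "mon_eval (m + n) = mon_eval m \<otimes> mon_eval n"
proof -
  let ?A = "set_mset m \<union> set_mset n" and ?c = "\<lambda>a. if a \<in> carrier R then a else \<one>"
  have "mon_eval (m + n) = finprod R (\<lambda>a. ?c a [^] count (m + n) a) ?A"
    by (rule mon_eval_superset) auto
  also have "\<dots> = finprod R (\<lambda>a. ?c a [^] count m a \<otimes> ?c a [^] count n a) ?A"
    by (rule finprod_cong') (auto simp: nat_pow_mult)
  also have "\<dots> = finprod R (\<lambda>a. ?c a [^] count m a) ?A \<otimes> finprod R (\<lambda>a. ?c a [^] count n a) ?A"
    by (rule finprod_multf) auto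
  also have "\<dots> = mon_eval m \<otimes> mon_eval n"
    by (simp add: mon_eval_superset[of ?A])
  finally show ?thesis .
qed

lemma mon_eval_single: "a \<in> carrier R \<Longrightarrow> mon_eval {#a#} = a"
  by (simp add: mon_eval_def finprod_insert)

lemma int_add_pow_0: "add_pow R (0::int) x = \<zero>"
  by (simp add: add_pow_def)

text \<open>The free commutative ring is the monoid ring of the multisets with integer coefficients,
  which belongs to the class \<open>comm_ring_1\<close>.\<close>

definition free_eval :: "('a multiset \<Rightarrow>\<^sub>0 int) \<Rightarrow> 'a" where
  "free_eval p = finsum R (\<lambda>m. [Poly_Mapping.lookup p m] \<cdot> mon_eval m) (Poly_Mapping.keys p)"

lemma free_eval_superset:
  "finite A \<Longrightarrow> Poly_Mapping.keys p \<subseteq> A \<Longrightarrow> free_eval p = finsum R (\<lambda>m. [Poly_Mapping.lookup p m] \<cdot> mon_eval m) A"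
  unfolding free_eval_def
  by (rule add.finprod_mono_neutral_cong_left) (auto simp: in_keys_iff mon_eval_closed int_add_pow_0)

lemma free_eval_closed: "free_eval p \<in> carrier R"
  unfolding free_eval_def by (rule finsum_closed) (auto simp: mon_eval_closed)

lemma free_eval_add: "free_eval (p + q) = free_eval p \<oplus> free_eval q"
proof -
  let ?A = "Poly_Mapping.keys p \<union> Poly_Mapping.keys q"
  have "free_eval (p + q) = finsum R (\<lambda>m. [Poly_Mapping.lookup (p + q) m] \<cdot> mon_eval m) ?A"
    by (rule free_eval_superset) (auto simp: in_keys_iff lookup_add)
  also have "\<dots> = finsum R (\<lambda>m. [Poly_Mapping.lookup p m] \<cdot> mon_eval m \<oplus> [Poly_Mapping.lookup q m] \<cdot> mon_eval m) ?A"
    by (rule finsum_cong') (auto simp: lookup_add add.int_pow_mult mon_eval_closed)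
  also have "\<dots> = finsum R (\<lambda>m. [Poly_Mapping.lookup p m] \<cdot> mon_eval m) ?A \<oplus> finsum R (\<lambda>m. [Poly_Mapping.lookup q m] \<cdot> mon_eval m) ?A"
    by (rule finsum_addf) (auto simp: mon_eval_closed)
  also have "\<dots> = free_eval p \<oplus> free_eval q"
    by (simp add: free_eval_superset[of ?A])
  finally show ?thesis .
qed

lemma free_eval_single: "free_eval (Poly_Mapping.single m c) = [c] \<cdot> mon_eval m"
  using free_eval_superset[of "{m}" "Poly_Mapping.single m c"] mon_eval_closed[of m]
  by (auto simp: finsum_singleton)

lemma free_eval_zero: "free_eval 0 = \<zero>"
  by (simp add: free_eval_def)

lemma free_eval_one: "free_eval 1 = \<one>"
  using free_eval_single[of 0 1] by (simp add: mon_eval_zero)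

lemma free_eval_mult: "free_eval (p * q) = free_eval p \<otimes> free_eval q"
proof (induction p rule: poly_mapping_single_induct)
  case zero
  then show ?case by (simp add: free_eval_zero free_eval_closed)
next
  case (add p p')
  then show ?case by (simp add: free_eval_add free_eval_closed l_distr distrib_right)
next
  case (single m c)
  show ?case
  proof (induction q rule: poly_mapping_single_induct)
    case zero
    then show ?case by (simp add: free_eval_zero free_eval_closed)
  next
    case (add p p')
    then show ?case by (simp add: free_eval_add free_eval_closed r_distr distrib_left)
  next
    case (single n d)
    have "free_eval (Poly_Mapping.single m c * Poly_Mapping.single n d) = add_pow R (c * d) (mon_eval m \<otimes> mon_eval n)"
      by (simp add: mult_single free_eval_single mon_eval_add)
    also have "\<dots> = add_pow R c (mon_eval m) \<otimes> add_pow R d (mon_eval n)"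
      by (simp add: add_pow_ldistr_int add_pow_rdistr_int mon_eval_closed add.int_pow_pow mult.commute)
    finally show ?case by (simp add: free_eval_single)
  qed
qed

lemma free_eval_surj: "a \<in> carrier R \<Longrightarrow> free_eval (Poly_Mapping.single {#a#} 1) = a"
  by (simp add: free_eval_single mon_eval_single)

end

context noeth_pair
begin

lemma cl_subset_span:
  assumes "I ^ N \<subseteq> idl.span (X \<union> k)" shows "cl X = idl.span (X \<union> k)"
proof
  have "X \<union> k \<union> I ^ N \<subseteq> idl.span (X \<union> k)" using assms idl.span_superset by blast
  then have "idl.span (X \<union> k \<union> I ^ N) \<subseteq> idl.span (X \<union> k)" by (simp add: idl.span_minimal)
  moreover have "cl X \<subseteq> idl.span (X \<union> k \<union> I ^ N)"
    using cl_mono[of X "X \<union> I ^ N"] cl_Un_power by blast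
  ultimately show "cl X \<subseteq> idl.span (X \<union> k)" by blast
qed (use span_in_cl in blast)

lemma reduction_closed:
  assumes "reduction L" shows "cl L = L"
proof -
  obtain n where L: "idl.subspace L" "k \<subseteq> L" "I ^ Suc n \<subseteq> idl.span (L * I ^ n \<union> k)"
    using assms by (auto simp: reduction_def)
  have span_L: "idl.span (L \<union> k) = L" using L by (simp add: Un_absorb2)
  have "L * I ^ n \<union> k \<subseteq> L" using ideal_times_subset(1)[OF L(1)] L(2) by auto
  then have "idl.span (L * I ^ n \<union> k) \<subseteq> L" using L(1) by (simp add: idl.span_minimal)
  then have "I ^ Suc n \<subseteq> idl.span (L \<union> k)" using L(3) span_L by auto
  from cl_subset_span[OF this] show ?thesis unfolding span_L .
qed

lemma creg_nth: "creg D xs \<longleftrightarrow> (\<forall>i<length xs. reg (D \<union> set (take i xs)) (xs ! i))"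
proof (induction xs arbitrary: D)
  case (Cons x xs)
  show ?case unfolding creg.simps Cons.IH length_Cons All_less_Suc2 by simp
qed simp

end

context zero_dim_pair
begin

text \<open>The characteristic enters at exponent r: the core is placed in Q^(r+1) : I^r for Q =
  (xs), and I^t = Q^(t-r) I^r, up to closure, carries this to t. Conversely the colon ideal for t
  enters every reduction through \<open>eventually_colon\<close>. For the second equivalence,
  multiplying I^t by Q^((d-1) t) with d = length xs lands in I^(d t), and
  \<open>colon_powers\<close> recovers Q^(t+1).\<close>

theorem core_eq_colon:
  assumes K: "separated K" "infinite K"
    and char: "\<And>n. 0 < n \<Longrightarrow> n \<le> r \<Longrightarrow> \<exists>w. w * of_nat n - 1 \<in> k"
    and xs: "set xs \<subseteq> I" "xs \<noteq> []" "creg {} xs" and fr: "I ^ Suc r \<subseteq> cl (set xs * I ^ r)" and t: "r \<le> t"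
  shows "(\<forall>L. reduction L \<longrightarrow> x \<in> L) \<longleftrightarrow> (\<forall>w\<in>I ^ t. x * w \<in> cl (set xs ^ Suc t))" (is "?core \<longleftrightarrow> ?col")
    and "(\<forall>w\<in>I ^ t. x * w \<in> cl (set xs ^ Suc t)) \<longleftrightarrow>
      (\<forall>w\<in>I ^ (length xs * t). x * w \<in> cl ((\<lambda>y. y ^ Suc t) ` set xs))" (is "_ \<longleftrightarrow> ?col'")
proof -
  have formal: "formal_red (set xs)" using fr by (auto simp: formal_red_def)
  have fr_t: "I ^ Suc t \<subseteq> cl (set xs * I ^ t)" by (rule formal_red_ge[OF fr t])
  show "?core \<longleftrightarrow> ?col"
  proof
    assume core: ?core
    have r: "x * w \<in> cl (set xs ^ Suc r)" if "w \<in> I ^ r" for w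
      by (rule core_in_colon[OF K char xs formal _ that]) (use core in auto)
    obtain j where j: "t = r + j" using t le_Suc_ex by blast
    show ?col
    proof
      fix w assume "w \<in> I ^ t"
      then have "w \<in> cl (set xs ^ j * I ^ r)" using formal_red_power[OF fr, of j] j by auto
      then show "x * w \<in> cl (set xs ^ Suc t)"
      proof (rule cl_mult_into[rotated])
        fix v assume "v \<in> set xs ^ j * I ^ r"
        then obtain u w where uw: "v = u * w" "u \<in> set xs ^ j" "w \<in> I ^ r" by (rule set_times_elim)
        have "u * (x * w) \<in> cl (set xs ^ j * set xs ^ Suc r)"
          using uw by (intro cl_times r) (auto intro: cl_base)
        also have "set xs ^ j * set xs ^ Suc r = set xs ^ Suc t"
          using j by (simp flip: power_add power_Suc add: ac_simps)
        finally show "x * v \<in> cl (set xs ^ Suc t)" using uw(1) by (simp add: ac_simps)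
      qed
    qed
  next
    assume col: ?col
    have "eventually_colon x xs" unfolding eventually_colon_def
      using colon_eventually[OF xs(1,2) fr_t, of x] col by blast
    then show ?core
    proof (intro allI impI)
      fix L assume L: "reduction L"
      then obtain n where n: "idl.subspace L" "k \<subseteq> L" "L \<subseteq> I" "I ^ Suc n \<subseteq> idl.span (L * I ^ n \<union> k)"
        by (auto simp: reduction_def)
      then have "I ^ Suc n \<subseteq> cl (L * I ^ n)" using span_in_cl by blast
      with \<open>eventually_colon x xs\<close> n(1-3) have "x \<in> cl L"
        by (intro colon_in_reduction[OF K xs(1,3) formal])
      then show "x \<in> L" using reduction_closed[OF L] by simp
    qed
  qed
  show "?col \<longleftrightarrow> ?col'"
  proof
    assume ?col
    then show ?col' using colon_eventually[OF xs(1,2) fr_t, of x t] by blast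
  next
    assume col': ?col'
    show ?col
    proof
      fix w assume w: "w \<in> I ^ t"
      have "x * w \<in> cl ({} \<union> set xs ^ Suc t)"
      proof (rule colon_powers[OF xs(3,1,2)])
        fix q assume "q \<in> set xs ^ ((length xs - 1) * t)"
        then have "q \<in> I ^ ((length xs - 1) * t)" using set_power_mono[OF xs(1)] by blast
        then have "w * q \<in> I ^ t * I ^ ((length xs - 1) * t)" using w by blast
        also have "\<dots> = I ^ (length xs * t)" using xs(2) by (cases xs) (simp_all flip: power_add)
        finally show "x * w * q \<in> cl ({} \<union> (\<lambda>x. x ^ Suc t) ` set xs)" using col' by (auto simp: mult.assoc)
      qed
      then show "x * w \<in> cl (set xs ^ Suc t)" by simp
    qed
  qed
qed

end

text \<open>Kept abstract in the map, so that the same facts serve for R and, by composing with the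
  projection, for a quotient of R.\<close>

locale presentation = cring R for R :: "('a, 'b) ring_scheme" (structure) +
  fixes \<phi> :: "'p::comm_ring_1 \<Rightarrow> 'a"
  assumes \<phi>_closed: "\<phi> p \<in> carrier R"
    and \<phi>_add: "\<phi> (p + q) = \<phi> p \<oplus> \<phi> q"
    and \<phi>_mult: "\<phi> (p * q) = \<phi> p \<otimes> \<phi> q"
    and \<phi>_one: "\<phi> 1 = \<one>"
    and \<phi>_surj: "a \<in> carrier R \<Longrightarrow> \<exists>p. \<phi> p = a"
begin

lemma \<phi>_zero: "\<phi> 0 = \<zero>"
  using \<phi>_add[of 0 0] \<phi>_closed[of 0] by (simp add: add.l_cancel_one)

lemma \<phi>_minus: "\<phi> (- p) = \<ominus> \<phi> p"
  using \<phi>_add[of "- p" p] \<phi>_zero \<phi>_closed by (simp add: minus_equality)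

section \<open>Transport of ideals along the surjection\<close>

definition ker :: "'p set" where "ker = {p. \<phi> p = \<zero>}"

definition pre :: "'a set \<Rightarrow> 'p set" where "pre A = {p. \<phi> p \<in> A}"

lemma \<phi>_diff: "p - q \<in> ker \<longleftrightarrow> \<phi> p = \<phi> q"
proof -
  have "\<phi> (p - q) = \<phi> p \<ominus> \<phi> q" using \<phi>_add[of p "- q"] by (simp add: \<phi>_minus minus_eq)
  then show ?thesis using \<phi>_closed by (simp add: ker_def)
qed

lemma subspace_pre: "ideal A R \<Longrightarrow> idl.subspace (pre A)"
  by (rule idl.subspaceI)
    (auto simp: pre_def \<phi>_zero \<phi>_add \<phi>_mult \<phi>_closed ideal.axioms(1) additive_subgroup.zero_closed
      additive_subgroup.a_closed ideal.I_l_closed)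

lemma ker_pre: "ideal A R \<Longrightarrow> ker \<subseteq> pre A"
  by (auto simp: pre_def ker_def ideal.axioms(1) additive_subgroup.zero_closed)

lemma subspace_ker: "idl.subspace ker"
proof -
  have "ker = pre {\<zero>}" by (auto simp: ker_def pre_def)
  then show ?thesis using subspace_pre[OF zeroideal] by simp
qed

lemma ideal_image: assumes B: "idl.subspace B" shows "ideal (\<phi> ` B) R"
proof (rule idealI)
  show "ring R" by (rule ring_axioms)
  show "subgroup (\<phi> ` B) (add_monoid R)"
  proof
    show "\<phi> ` B \<subseteq> carrier (add_monoid R)" using \<phi>_closed by auto
    show "x \<otimes>\<^bsub>add_monoid R\<^esub> y \<in> \<phi> ` B" if "x \<in> \<phi> ` B" "y \<in> \<phi> ` B" for x y
      using that idl.subspace_add[OF B] by (auto simp flip: \<phi>_add)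
    show "\<one>\<^bsub>add_monoid R\<^esub> \<in> \<phi> ` B" using idl.subspace_0[OF B] \<phi>_zero by force
    show "inv\<^bsub>add_monoid R\<^esub> x \<in> \<phi> ` B" if x: "x \<in> \<phi> ` B" for x
    proof -
      obtain b where "x = \<phi> b" "b \<in> B" using x by blast
      moreover from this have "\<phi> (- b) \<in> \<phi> ` B" using idl.subspace_neg[OF B] by blast
      ultimately show ?thesis by (simp add: \<phi>_minus flip: a_inv_def)
    qed
  qed
  fix a x assume ax: "a \<in> \<phi> ` B" "x \<in> carrier R"
  then obtain b p where "a = \<phi> b" "b \<in> B" "x = \<phi> p" using \<phi>_surj by blast
  then show "x \<otimes> a \<in> \<phi> ` B" "a \<otimes> x \<in> \<phi> ` B"
    using idl.subspace_scale[OF B, of b p] ideal_multL[OF B, of b p] by (auto simp flip: \<phi>_mult)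
qed

lemma image_pre: "A \<subseteq> carrier R \<Longrightarrow> \<phi> ` pre A = A"
  using \<phi>_surj by (auto simp: pre_def image_iff)

lemma image_pre_ideal: "ideal A R \<Longrightarrow> \<phi> ` pre A = A"
  by (rule image_pre) (simp add: ideal.axioms(1) additive_subgroup.a_subset)

lemma image_mem: assumes "idl.subspace B" shows "\<phi> z \<in> \<phi> ` B \<longleftrightarrow> z \<in> idl.span (B \<union> ker)"
proof
  assume "\<phi> z \<in> \<phi> ` B"
  then obtain b where b: "b \<in> B" "z - b \<in> ker" by (auto simp: \<phi>_diff)
  then have "b + (z - b) \<in> idl.span (B \<union> ker)" by (intro idl.span_add idl.span_base) auto
  then show "z \<in> idl.span (B \<union> ker)" by simp
next
  assume "z \<in> idl.span (B \<union> ker)"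
  then obtain x y where xy: "z = x + y" "x \<in> idl.span B" "y \<in> idl.span ker" unfolding idl.span_Un by blast
  have "x \<in> B" "y \<in> ker" using xy assms subspace_ker idl.span_minimal[of B B] idl.span_minimal[of ker ker] by auto
  then have "\<phi> z = \<phi> x" using xy(1) \<phi>_diff[of z x] by simp
  then show "\<phi> z \<in> \<phi> ` B" using \<open>x \<in> B\<close> by simp
qed

lemma image_span_mem: "\<phi> z \<in> \<phi> ` idl.span X \<longleftrightarrow> z \<in> idl.span (X \<union> ker)"
proof -
  have "idl.span (idl.span X \<union> ker) = idl.span (X \<union> ker)"
  proof
    have "idl.span X \<union> ker \<subseteq> idl.span (X \<union> ker)" using idl.span_mono[of X "X \<union> ker"] by (auto intro: idl.span_base)
    then show "idl.span (idl.span X \<union> ker) \<subseteq> idl.span (X \<union> ker)" by (simp add: idl.span_minimal)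
    show "idl.span (X \<union> ker) \<subseteq> idl.span (idl.span X \<union> ker)" by (rule idl.span_mono) (auto intro: idl.span_base)
  qed
  then show ?thesis using image_mem[of "idl.span X"] by simp
qed

lemma pre_image: "idl.subspace B \<Longrightarrow> ker \<subseteq> B \<Longrightarrow> pre (\<phi> ` B) = B"
  using image_mem[of B] by (auto simp: pre_def Un_absorb2)

lemma image_span: "\<phi> ` idl.span X = genideal R (\<phi> ` X)"
proof
  have sub: "\<phi> ` X \<subseteq> carrier R" using \<phi>_closed by auto
  have "X \<subseteq> pre (genideal R (\<phi> ` X))" using genideal_self[OF sub] by (auto simp: pre_def)
  then have "idl.span X \<subseteq> pre (genideal R (\<phi> ` X))"
    using subspace_pre[OF genideal_ideal[OF sub]] by (rule idl.span_minimal)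
  then show "\<phi> ` idl.span X \<subseteq> genideal R (\<phi> ` X)" by (auto simp: pre_def)
  show "genideal R (\<phi> ` X) \<subseteq> \<phi> ` idl.span X"
    by (rule genideal_minimal[OF ideal_image]) (auto intro: idl.span_base)
qed

lemma image_times: "\<phi> ` idl.span (A * B) = \<phi> ` idl.span A \<cdot> \<phi> ` idl.span B"
proof
  have id: "ideal (\<phi> ` idl.span A) R" "ideal (\<phi> ` idl.span B) R" by (auto intro: ideal_image)
  have "A * B \<subseteq> pre (\<phi> ` idl.span A \<cdot> \<phi> ` idl.span B)"
  proof
    fix z assume "z \<in> A * B"
    then obtain a b where "z = a * b" "a \<in> A" "b \<in> B" by (rule set_times_elim)
    then show "z \<in> pre (\<phi> ` idl.span A \<cdot> \<phi> ` idl.span B)"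
      by (auto simp: pre_def \<phi>_mult intro!: ideal_prod.prod idl.span_base)
  qed
  then have "idl.span (A * B) \<subseteq> pre (\<phi> ` idl.span A \<cdot> \<phi> ` idl.span B)"
    using subspace_pre[OF ideal_prod_is_ideal[OF id]] by (rule idl.span_minimal)
  then show "\<phi> ` idl.span (A * B) \<subseteq> \<phi> ` idl.span A \<cdot> \<phi> ` idl.span B" by (auto simp: pre_def)
  show "\<phi> ` idl.span A \<cdot> \<phi> ` idl.span B \<subseteq> \<phi> ` idl.span (A * B)"
  proof
    fix z assume "z \<in> \<phi> ` idl.span A \<cdot> \<phi> ` idl.span B"
    then show "z \<in> \<phi> ` idl.span (A * B)"
    proof (induction rule: ideal_prod.induct)
      case (prod i j)
      then obtain a b where "i = \<phi> a" "a \<in> idl.span A" "j = \<phi> b" "b \<in> idl.span B" by blast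
      then show ?case using span_times[of a A b B] by (auto simp flip: \<phi>_mult)
    next
      case (sum s1 s2)
      then obtain a b where "s1 = \<phi> a" "a \<in> idl.span (A * B)" "s2 = \<phi> b" "b \<in> idl.span (A * B)" by blast
      then show ?case using idl.span_add[of a "A * B" b] by (auto simp flip: \<phi>_add)
    qed
  qed
qed

lemma image_power: "\<phi> ` idl.span (A ^ n) = ideal_power R (\<phi> ` idl.span A) n"
proof (induction n)
  case 0
  have "1 \<in> idl.span (1::'p set)" by (rule idl.span_base) (simp add: set_one)
  then have "p \<in> idl.span (1::'p set)" for p using span_multL[of 1 1 p] by simp
  then have "idl.span (1::'p set) = UNIV" by auto
  moreover have "\<phi> ` UNIV = carrier R" using \<phi>_closed \<phi>_surj by fastforce
  ultimately show ?case by (simp add: nat_pow_def ideals_set_def)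
next
  case (Suc n)
  have "\<phi> ` idl.span (A ^ Suc n) = \<phi> ` idl.span (A ^ n * A)" by (simp add: mult.commute)
  also have "\<dots> = ideal_power R (\<phi> ` idl.span A) n \<cdot> \<phi> ` idl.span A" by (simp add: image_times Suc)
  also have "\<dots> = ideal_power R (\<phi> ` idl.span A) (Suc n)" by (simp add: nat_pow_def ideals_set_def)
  finally show ?case .
qed

lemma noeth_mod_ker:
  assumes "noetherian_ring R" shows "noeth_mod ker"
proof
  show "idl.subspace ker" by (rule subspace_ker)
  fix A :: "'p set" assume A: "idl.subspace A" "ker \<subseteq> A"
  obtain F where F: "F \<subseteq> carrier R" "finite F" "\<phi> ` A = genideal R F"
    using noetherian_ring.finetely_gen[OF assms ideal_image[OF A(1)]] by blast
  have "\<forall>a\<in>F. \<exists>p. \<phi> p = a" using F(1) \<phi>_surj by blast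
  then obtain g where g: "\<And>a. a \<in> F \<Longrightarrow> \<phi> (g a) = a" by metis
  have img: "\<phi> ` (g ` F) = F" using g by force
  then have "\<phi> ` A = \<phi> ` idl.span (g ` F)" using F(3) image_span[of "g ` F"] by simp
  then have "A = idl.span (g ` F \<union> ker)"
    using image_span_mem[of _ "g ` F"] pre_image[OF A] by (auto simp: pre_def)
  then show "\<exists>F. finite F \<and> A = idl.span (F \<union> ker)" using F(2) by blast
qed

lemma prime_pre:
  assumes "primeideal P R" shows "prime_idl (pre P)"
proof -
  interpret P: primeideal P R by (rule assms)
  have "\<one> \<notin> P" using P.one_imp_carrier P.I_notcarr by auto
  then show ?thesis
    unfolding prime_idl_def using subspace_pre[OF P.is_ideal] P.I_prime[OF \<phi>_closed \<phi>_closed]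
    by (auto simp: pre_def \<phi>_one \<phi>_mult)
qed

lemma prime_image:
  assumes P: "prime_idl P" "ker \<subseteq> P" shows "primeideal (\<phi> ` P) R"
proof (rule primeidealI)
  have sub: "idl.subspace P" using P(1) by (simp add: prime_idl_def)
  show "ideal (\<phi> ` P) R" by (rule ideal_image[OF sub])
  show "cring R" by (rule is_cring)
  have mem: "\<phi> z \<in> \<phi> ` P \<longleftrightarrow> z \<in> P" for z using pre_image[OF sub P(2)] by (auto simp: pre_def)
  show "carrier R \<noteq> \<phi> ` P" using mem[of 1] P(1) \<phi>_one one_closed by (auto simp: prime_idl_def)
  fix a b assume "a \<in> carrier R" "b \<in> carrier R" "a \<otimes> b \<in> \<phi> ` P"
  moreover from this obtain p q where "a = \<phi> p" "b = \<phi> q" using \<phi>_surj by metis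
  ultimately have "p * q \<in> P" using mem[of "p * q"] by (simp add: \<phi>_mult)
  then show "a \<in> \<phi> ` P \<or> b \<in> \<phi> ` P" using P(1) \<open>a = \<phi> p\<close> \<open>b = \<phi> q\<close> by (auto simp: prime_idl_def)
qed

lemma image_psubset:
  assumes "idl.subspace A" "ker \<subseteq> A" "idl.subspace B" "ker \<subseteq> B" "A \<subset> B"
  shows "\<phi> ` A \<subset> \<phi> ` B"
  using pre_image[OF assms(1,2)] pre_image[OF assms(3,4)] assms(5) by (metis image_mono psubsetE psubsetI)

lemma presentation_quotient:
  assumes "ideal J R" shows "presentation (R Quot J) (\<lambda>p. J +> \<phi> p)"
proof -
  interpret J: ideal J R by (rule assms)
  interpret Q: cring "R Quot J" by (rule J.quotient_is_cring[OF is_cring])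
  note hom = J.rcos_ring_hom
  show ?thesis
  proof
    show "J +> \<phi> p \<in> carrier (R Quot J)" for p by (rule ring_hom_closed[OF hom \<phi>_closed])
    show "J +> \<phi> (p + q) = (J +> \<phi> p) \<oplus>\<^bsub>R Quot J\<^esub> (J +> \<phi> q)" for p q
      unfolding \<phi>_add by (rule ring_hom_add[OF hom \<phi>_closed \<phi>_closed])
    show "J +> \<phi> (p * q) = (J +> \<phi> p) \<otimes>\<^bsub>R Quot J\<^esub> (J +> \<phi> q)" for p q
      unfolding \<phi>_mult by (rule ring_hom_mult[OF hom \<phi>_closed \<phi>_closed])
    show "J +> \<phi> 1 = \<one>\<^bsub>R Quot J\<^esub>" unfolding \<phi>_one by (rule ring_hom_one[OF hom])
    show "\<exists>p. J +> \<phi> p = a" if "a \<in> carrier (R Quot J)" for a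
      using that \<phi>_surj by (auto simp: FactRing_def A_RCOSETS_def' a_r_coset_def')
  qed
qed

end

context noeth_pair
begin

lemma reduction_power_exact:
  assumes E: "I ^ Suc n \<subseteq> idl.span (E * I ^ n \<union> k)"
  shows "I ^ (n + j) \<subseteq> idl.span (E ^ j * I ^ n \<union> k)"
proof (induction j)
  case 0
  show ?case using idl.span_superset[of "E ^ 0 * I ^ n \<union> k"] by simp
next
  case (Suc j)
  let ?Z = "E ^ Suc j * I ^ n \<union> k"
  have k_into: "c * x \<in> idl.span ?Z" if "x \<in> k" for c x using that by (intro idl.span_scale idl.span_base) simp
  show ?case
  proof
    fix z assume "z \<in> I ^ (n + Suc j)"
    then obtain c w where cw: "z = c * w" "c \<in> I" "w \<in> I ^ (n + j)" by (auto elim: set_times_elim)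
    have "c * w \<in> idl.span ?Z"
    proof (rule mult_into_ideal[OF idl.subspace_span _ subsetD[OF Suc cw(3)]])
      fix x assume "x \<in> E ^ j * I ^ n \<union> k"
      then consider u v where "x = u * v" "u \<in> E ^ j" "v \<in> I ^ n" | "x \<in> k" by (auto elim: set_times_elim)
      then show "c * x \<in> idl.span ?Z"
      proof cases
        case 1
        have cv: "c * v \<in> I ^ Suc n" using cw(2) 1 by auto
        have "u * (c * v) \<in> idl.span ?Z"
        proof (rule mult_into_ideal[OF idl.subspace_span _ subsetD[OF E cv]])
          fix y assume "y \<in> E * I ^ n \<union> k"
          then consider e i where "y = e * i" "e \<in> E" "i \<in> I ^ n" | "y \<in> k" by (auto elim: set_times_elim)
          then show "u * y \<in> idl.span ?Z"
          proof cases
            case 1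
            then have "(e * u) * i \<in> E ^ Suc j * I ^ n" using \<open>u \<in> E ^ j\<close> by auto
            then have "(e * u) * i \<in> idl.span ?Z" by (intro idl.span_base) blast
            then show ?thesis using 1 by (simp add: ac_simps)
          qed (rule k_into)
        qed
        then show ?thesis using 1 by (simp add: ac_simps)
      qed (rule k_into)
    qed
    then show "z \<in> idl.span ?Z" using cw(1) by simp
  qed
qed

text \<open>I^(n+j) lies in E^j I^n modulo \<open>k\<close>, so an ideal above a power of a
  reduction contains a power of I and is closed. This removes the closure from both colon
  ideals.\<close>

lemma cl_reduction_power:
  assumes "I ^ Suc n \<subseteq> idl.span (E * I ^ n \<union> k)" "E ^ j \<subseteq> idl.span X"
  shows "cl X = idl.span (X \<union> k)"
proof (rule cl_subset_span)
  have "u * v \<in> idl.span (X \<union> k)" if "u \<in> E ^ j" "v \<in> I ^ n" for u v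
    using that assms(2) idl.span_mono[of X "X \<union> k"] by (intro span_multL) blast
  then have "E ^ j * I ^ n \<union> k \<subseteq> idl.span (X \<union> k)"
    by (auto elim!: set_times_elim intro: idl.span_base)
  then have "idl.span (E ^ j * I ^ n \<union> k) \<subseteq> idl.span (X \<union> k)" by (simp add: idl.span_minimal)
  then show "I ^ (n + j) \<subseteq> idl.span (X \<union> k)" using reduction_power_exact[OF assms(1), of j] by blast
qed

end

context presentation
begin

section \<open>Reductions, dimension, height and the subfield under the surjection\<close>

lemma \<phi>_power: "\<phi> (p ^ n) = \<phi> p [^] n"
  by (induction n) (simp_all add: \<phi>_one \<phi>_mult \<phi>_closed m_comm)

lemma \<phi>_of_nat: "\<phi> (of_nat n) = [n] \<cdot> \<one>"
  by (induction n) (simp_all add: \<phi>_zero \<phi>_one \<phi>_add a_comm)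

lemma lift_list: "set as \<subseteq> carrier R \<Longrightarrow> \<exists>xs. map \<phi> xs = as"
proof (induction as)
  case (Cons a as)
  then obtain xs p where "map \<phi> xs = as" "\<phi> p = a" using \<phi>_surj[of a] by auto
  then show ?case by (intro exI[of _ "p # xs"]) simp
qed simp

lemma span_pre: "ideal J R \<Longrightarrow> idl.span (pre J) = pre J"
  using subspace_pre by simp

lemma colon_mem:
  "\<phi> z \<in> ideal_colon R (\<phi> ` idl.span X) (\<phi> ` idl.span Y) \<longleftrightarrow> (\<forall>w\<in>Y. z * w \<in> idl.span (X \<union> ker))"
proof
  assume z: "\<phi> z \<in> ideal_colon R (\<phi> ` idl.span X) (\<phi> ` idl.span Y)"
  show "\<forall>w\<in>Y. z * w \<in> idl.span (X \<union> ker)"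
  proof
    fix w assume "w \<in> Y"
    then have "\<phi> z \<otimes> \<phi> w \<in> \<phi> ` idl.span X" using z by (auto simp: ideal_colon_def idl.span_base)
    then show "z * w \<in> idl.span (X \<union> ker)" by (simp flip: \<phi>_mult add: image_span_mem)
  qed
next
  assume z: "\<forall>w\<in>Y. z * w \<in> idl.span (X \<union> ker)"
  have "\<phi> z \<otimes> \<phi> y \<in> \<phi> ` idl.span X" if "y \<in> idl.span Y" for y
  proof -
    have "y * z \<in> idl.span (X \<union> ker)"
      using span_times_subset[of Y "{z}" "X \<union> ker" y z] z that by (auto simp: mult.commute idl.span_base)
    then have "z * y \<in> idl.span (X \<union> ker)" by (simp add: mult.commute)
    then show ?thesis by (simp flip: \<phi>_mult add: image_span_mem)
  qed
  then show "\<phi> z \<in> ideal_colon R (\<phi> ` idl.span X) (\<phi> ` idl.span Y)"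
    by (auto simp: ideal_colon_def \<phi>_closed)
qed

lemma reduction_lift:
  assumes "\<phi> ` idl.span X = L" "\<phi> ` idl.span Y = J"
    and "ideal_power R J (Suc r) = L \<cdot> ideal_power R J r"
  shows "Y ^ Suc r \<subseteq> idl.span (X * Y ^ r \<union> ker)"
proof
  fix z assume "z \<in> Y ^ Suc r"
  then have "\<phi> z \<in> \<phi> ` idl.span (Y ^ Suc r)" by (intro imageI idl.span_base)
  also have "\<dots> = \<phi> ` idl.span (X * Y ^ r)"
    using assms unfolding image_power image_times by simp
  finally show "z \<in> idl.span (X * Y ^ r \<union> ker)" by (simp add: image_span_mem)
qed

lemma reduction_image:
  assumes Y: "\<phi> ` idl.span Y = J" and L: "idl.subspace L" "L \<subseteq> Y" "Y ^ Suc r \<subseteq> idl.span (L * Y ^ r \<union> ker)"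
  shows "is_reduction R (\<phi> ` L) J"
proof -
  have "\<phi> ` idl.span (Y ^ Suc r) = \<phi> ` idl.span (L * Y ^ r)"
  proof
    have "idl.span (Y ^ Suc r) \<subseteq> idl.span (L * Y ^ r \<union> ker)" using L(3) by (simp add: idl.span_minimal)
    then show "\<phi> ` idl.span (Y ^ Suc r) \<subseteq> \<phi> ` idl.span (L * Y ^ r)"
      using image_span_mem[of _ "L * Y ^ r"] by blast
    have "L * Y ^ r \<subseteq> Y ^ Suc r" using L(2) by (simp add: set_times_mono2)
    then show "\<phi> ` idl.span (L * Y ^ r) \<subseteq> \<phi> ` idl.span (Y ^ Suc r)" by (intro image_mono idl.span_mono)
  qed
  then have "ideal_power R J (r + 1) = \<phi> ` idl.span L \<cdot> ideal_power R J r"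
    unfolding image_power image_times Y by simp
  moreover have "idl.span L = L" using L(1) by simp
  moreover have "L \<subseteq> idl.span Y" using L(2) idl.span_superset by blast
  ultimately show ?thesis unfolding is_reduction_def using ideal_image[OF L(1)] Y by auto
qed

lemma quotient_ker:
  assumes "ideal J R" shows "presentation.ker (R Quot J) (\<lambda>p. J +> \<phi> p) = pre J"
proof -
  interpret J: ideal J R by (rule assms)
  interpret Q: presentation "R Quot J" "\<lambda>p. J +> \<phi> p" by (rule presentation_quotient[OF assms])
  have "J +> \<phi> p = J \<longleftrightarrow> \<phi> p \<in> J" for p
    using J.a_rcos_const J.rcos_const_imp_mem \<phi>_closed by blast
  moreover have "\<zero>\<^bsub>R Quot J\<^esub> = J" by (simp add: FactRing_def)
  ultimately show ?thesis unfolding Q.ker_def pre_def by simp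
qed

text \<open>A proper ideal strictly above \<open>P\<close> would lie in a prime, and together with
  \<open>P\<close> this prime would form a chain of length 1 in the quotient by
  \<open>J\<close>.\<close>

lemma krull_dim_zero_maximal:
  assumes noeth: "noetherian_ring R" and J: "ideal J R" and dim: "krull_dim (R Quot J) = 0"
    and P: "prime_idl P" "pre J \<subseteq> P" and B: "idl.subspace B" "P \<subset> B"
  shows "1 \<in> B"
proof (rule ccontr)
  assume "1 \<notin> B"
  interpret N: noeth_mod ker by (rule noeth_mod_ker[OF noeth])
  interpret Q: presentation "R Quot J" "\<lambda>p. J +> \<phi> p" by (rule presentation_quotient[OF J])
  have ker: "Q.ker = pre J" by (rule quotient_ker[OF J])
  have "ker \<subseteq> B" using ker_pre[OF J] P(2) B(2) by blast
  then obtain P' where P': "prime_idl P'" "B \<subseteq> P'"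
    using N.ex_prime_disjoint[of B "{1}"] B(1) \<open>1 \<notin> B\<close> by (auto simp: mult_closed_def)
  define C where "C i = (\<lambda>p. J +> \<phi> p) ` (if i = 0 then P else P')" for i :: nat
  have "primeideal ((\<lambda>p. J +> \<phi> p) ` P) (R Quot J)" "primeideal ((\<lambda>p. J +> \<phi> p) ` P') (R Quot J)"
    using P P' B(2) ker by (auto intro!: Q.prime_image)
  moreover have "(\<lambda>p. J +> \<phi> p) ` P \<subset> (\<lambda>p. J +> \<phi> p) ` P'"
    using P P' B(2) ker by (intro Q.image_psubset) (auto simp: prime_idl_def)
  ultimately have "prime_chain (R Quot J) C 1"
    by (auto simp: prime_chain_def C_def)
  then have "1 \<in> {n. \<exists>P. prime_chain (R Quot J) P n}" by blast
  then have "ereal (real 1) \<le> krull_dim (R Quot J)" unfolding krull_dim_def by (rule SUP_upper)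
  then show False using dim by simp
qed

text \<open>The upper bound is Krull's height theorem, the lower bound the chain of primes built
  from the regular sequence.\<close>

lemma prime_height_eq:
  assumes noeth: "noetherian_ring R"
    and xs: "\<And>i z. i < length xs \<Longrightarrow> xs ! i * z \<in> idl.span (set (take i xs) \<union> ker) \<Longrightarrow> z \<in> idl.span (set (take i xs) \<union> ker)"
    and P: "primeideal P R" "set xs \<subseteq> pre P"
    and min: "\<And>P'. prime_idl P' \<Longrightarrow> set xs \<union> ker \<subseteq> P' \<Longrightarrow> P' \<subseteq> pre P \<Longrightarrow> P' = pre P"
  shows "prime_height R P = ereal (real (length xs))"
proof -
  interpret N: noeth_mod ker by (rule noeth_mod_ker[OF noeth])
  interpret P: primeideal P R by (rule P(1))
  have preP: "prime_idl (pre P)" by (rule prime_pre[OF P(1)])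
  have kerP: "ker \<subseteq> pre P" by (rule ker_pre[OF P.is_ideal])
  show ?thesis unfolding prime_height_def
  proof (rule antisym)
    show "(SUP n\<in>{n. \<exists>C. prime_chain R C n \<and> C n = P}. ereal (real n)) \<le> ereal (real (length xs))"
    proof (rule SUP_least)
      fix n assume "n \<in> {n. \<exists>C. prime_chain R C n \<and> C n = P}"
      then obtain C where C: "prime_chain R C n" "C n = P" by blast
      have prC: "primeideal (C i) R" if "i \<le> n" for i using C(1) that by (simp add: prime_chain_def)
      have "N.prime_chain_to (\<lambda>i. pre (C i)) n (pre P)"
        unfolding N.prime_chain_to_def
      proof (intro conjI allI impI)
        show "pre (C n) = pre P" using C(2) by simp
        show "prime_idl (pre (C i))" "ker \<subseteq> pre (C i)" if "i \<le> n" for i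
          using prime_pre[OF prC[OF that]] ker_pre[of "C i"] prC[OF that] by (auto simp: primeideal_def)
        show "pre (C i) \<subset> pre (C (Suc i))" if "i < n" for i
        proof -
          have img: "\<phi> ` pre (C i) = C i" "\<phi> ` pre (C (Suc i)) = C (Suc i)"
            using prC[of i] prC[of "Suc i"] that by (auto intro!: image_pre_ideal simp: primeideal_def)
          have lt: "C i \<subset> C (Suc i)" using C(1) that by (simp add: prime_chain_def)
          then have "pre (C i) \<noteq> pre (C (Suc i))" using img by (metis less_irrefl)
          moreover have "pre (C i) \<subseteq> pre (C (Suc i))" using lt unfolding pre_def by blast
          ultimately show ?thesis by blast
        qed
      qed
      then have "n \<le> length xs" by (rule N.krull_height[OF _ P(2) min])
      then show "ereal (real n) \<le> ereal (real (length xs))" by simp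
    qed
    have "set (take (length xs) xs) \<union> ker \<subseteq> pre P" using P(2) kerP by simp
    then have "\<exists>C. N.prime_chain_to C (length xs) (pre P)"
    proof (rule N.prime_chain_of_regular[OF _ order_refl preP, rotated])
      fix i z assume "i < length xs" "xs ! i * z \<in> idl.span (set (take i xs) \<union> ker)"
      then show "z \<in> idl.span (set (take i xs) \<union> ker)" by (rule xs)
    qed
    then obtain C where C: "N.prime_chain_to C (length xs) (pre P)" by blast
    have "prime_chain R (\<lambda>i. \<phi> ` C i) (length xs)"
      unfolding prime_chain_def
    proof (intro conjI allI impI)
      have pr: "prime_idl (C i)" "ker \<subseteq> C i" if "i \<le> length xs" for i
        using C that by (auto simp: N.prime_chain_to_def)
      show "primeideal (\<phi> ` C i) R" if "i \<le> length xs" for i by (rule prime_image[OF pr[OF that]])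
      show "\<phi> ` C i \<subset> \<phi> ` C (Suc i)" if "i < length xs" for i
        using C that pr[of i] pr[of "Suc i"]
        by (intro image_psubset prime_subspace) (auto simp: N.prime_chain_to_def)
    qed
    moreover have "\<phi> ` C (length xs) = P" using C image_pre_ideal[OF P.is_ideal] by (simp add: N.prime_chain_to_def)
    ultimately show "ereal (real (length xs)) \<le> (SUP n\<in>{n. \<exists>C. prime_chain R C n \<and> C n = P}. ereal (real n))"
      by (intro SUP_upper) auto
  qed
qed

lemma subfield_inverse:
  assumes K: "subfield K R" "K \<subseteq> carrier R" and p: "\<phi> p \<in> K - {\<zero>}"
  shows "\<exists>w. w * p - 1 \<in> ker"
proof -
  have "inv \<phi> p \<in> K" "inv \<phi> p \<otimes> \<phi> p = \<one>" using subfield_m_inv[OF K(1) p] by auto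
  moreover from this obtain w where "\<phi> w = inv \<phi> p" using \<phi>_surj[of "inv \<phi> p"] K(2) by blast
  ultimately show ?thesis by (auto simp: \<phi>_diff \<phi>_mult \<phi>_one intro!: exI[of _ w])
qed

lemma lift_infinite_subfield:
  assumes K: "subfield K R" "infinite K" "K \<subseteq> carrier R"
  shows "\<exists>K'. infinite K' \<and> (\<forall>u\<in>K'. \<forall>v\<in>K'. u \<noteq> v \<longrightarrow> (\<exists>w. w * (u - v) - 1 \<in> ker))"
proof -
  obtain g where g: "\<And>a. a \<in> K \<Longrightarrow> \<phi> (g a) = a" using \<phi>_surj K(3) by (metis subsetD)
  have "inj_on g K" by (rule inj_onI) (metis g)
  then have "infinite (g ` K)" using K(2) by (simp add: finite_image_iff)
  moreover have "\<exists>w. w * (u - v) - 1 \<in> ker" if uv: "u \<in> g ` K" "v \<in> g ` K" "u \<noteq> v" for u v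
  proof -
    obtain a b where ab: "a \<in> K" "b \<in> K" "u = g a" "v = g b" using uv by blast
    then have "a \<noteq> b" using uv(3) by auto
    have car: "a \<in> carrier R" "b \<in> carrier R" using ab K(3) by auto
    have "\<phi> (u - v) = a \<ominus> b" using \<phi>_add[of u "- v"] ab g by (simp add: \<phi>_minus minus_eq)
    moreover have "a \<ominus> b \<in> K - {\<zero>}"
    proof -
      have "subring K R" by (rule subfieldE(1)[OF K(1)])
      then have "a \<ominus> b \<in> K" using ab by (simp add: minus_eq subringE(5,7))
      then show ?thesis using \<open>a \<noteq> b\<close> car by simp
    qed
    ultimately show ?thesis using subfield_inverse[OF K(1,3)] by metis
  qed
  ultimately show ?thesis by blast
qed

end

context presentation
begin

theorem core_as_colon:
  assumes noeth: "noetherian_ring R"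
    and K: "subfield K R" "infinite K" and I: "ideal I R"
    and dim: "krull_dim (R Quot I) = 0"
    and ht: "ideal_height R I = ereal (real d)" "d > 0"
    and \<alpha>: "regular_sequence R \<alpha>" and red: "is_reduction R (genideal R (set \<alpha>)) I"
    and char: "ring_char (R\<lparr>carrier := K\<rparr>) = 0 \<or>
         ring_char (R\<lparr>carrier := K\<rparr>) > reduction_number R (genideal R (set \<alpha>)) I"
    and t: "t \<ge> reduction_number R (genideal R (set \<alpha>)) I"
  shows "ideal_core R I = ideal_colon R (ideal_power R (genideal R (set \<alpha>)) (t + 1)) (ideal_power R I t)"
    and "ideal_colon R (ideal_power R (genideal R (set \<alpha>)) (t + 1)) (ideal_power R I t) =
      ideal_colon R (genideal R (set (map (\<lambda>a. a [^] (t + 1)) \<alpha>))) (ideal_power R I (d * t))"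
    and "ideal_colon R (genideal R (set (map (\<lambda>a. a [^] (t + 1)) \<alpha>))) (ideal_power R I (d * t)) =
      ideal_colon R (genideal R (set (map (\<lambda>a. a [^] (t + 1)) \<alpha>)))
        (genideal R (ideal_power R I (d * t) \<union> set (map (\<lambda>a. a [^] (t + 1)) \<alpha>)))"
proof -
  let ?J = "genideal R (set \<alpha>)" and ?Y = "pre I"
  define r where "r = reduction_number R ?J I"
  have \<alpha>_carrier: "set \<alpha> \<subseteq> carrier R" using \<alpha> by (simp add: regular_sequence_def)
  obtain xs where xs: "map \<phi> xs = \<alpha>" using lift_list[OF \<alpha>_carrier] by blast
  have set_xs: "\<phi> ` set xs = set \<alpha>" using xs by auto
  have J: "\<phi> ` idl.span (set xs) = ?J" by (simp add: image_span set_xs)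
  have Y: "\<phi> ` idl.span ?Y = I" unfolding span_pre[OF I] by (rule image_pre_ideal[OF I])
  have redJ: "ideal ?J R" "?J \<subseteq> I" "\<exists>r. ideal_power R I (r + 1) = ?J \<cdot> ideal_power R I r"
    using red by (auto simp: is_reduction_def)
  have r: "ideal_power R I (r + 1) = ?J \<cdot> ideal_power R I r"
    unfolding r_def reduction_number_def by (rule LeastI_ex[OF redJ(3)])
  have exact: "?Y ^ Suc r \<subseteq> idl.span (set xs * ?Y ^ r \<union> ker)"
    by (rule reduction_lift[OF J Y]) (use r in simp)
  interpret Z: zero_dim_pair ker ?Y
  proof -
    interpret N: noeth_mod ker by (rule noeth_mod_ker[OF noeth])
    show "zero_dim_pair ker ?Y"
    proof
      show "idl.subspace ?Y" by (rule subspace_pre[OF I])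
      show "ker \<subseteq> ?Y" by (rule ker_pre[OF I])
      show "1 \<in> B" if "prime_idl P" "?Y \<subseteq> P" "idl.subspace B" "P \<subset> B" for P B
        by (rule krull_dim_zero_maximal[OF noeth I dim that])
    qed
  qed
  have xsY: "set xs \<subseteq> ?Y"
    using set_xs genideal_self[OF \<alpha>_carrier] redJ(2) by (auto simp: pre_def)
  have regular: "z \<in> idl.span (set (take i xs) \<union> ker)"
    if "i < length xs" "xs ! i * z \<in> idl.span (set (take i xs) \<union> ker)" for i z
  proof -
    have img: "\<phi> ` set (take i xs) = set (take i \<alpha>)" unfolding xs[symmetric] by (simp add: take_map)
    have "\<phi> (xs ! i * z) \<in> genideal R (set (take i \<alpha>))"
      using that(2) by (simp flip: image_span_mem add: image_span img)
    then have "\<alpha> ! i \<otimes> \<phi> z \<in> genideal R (set (take i \<alpha>))"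
      using that(1) unfolding xs[symmetric] by (simp add: \<phi>_mult)
    moreover have "i < length \<alpha>" using that(1) xs by auto
    ultimately have "\<phi> z \<in> genideal R (set (take i \<alpha>))"
      using \<alpha> \<phi>_closed[of z] by (auto simp: regular_sequence_def)
    then show ?thesis by (simp flip: image_span_mem add: image_span img)
  qed
  \<comment> \<open>Since (xs) is a reduction, a prime that contains it contains a power of I and so
    I itself; it is then maximal and cannot lie strictly below another prime.\<close>
  have minimal: "P' = pre P"
    if P: "primeideal P R" and P': "prime_idl P'" "set xs \<union> ker \<subseteq> P'" "P' \<subseteq> pre P" for P P'
  proof (rule ccontr)
    assume "P' \<noteq> pre P"
    have "set xs * ?Y ^ r \<union> ker \<subseteq> P'"
      using P' by (auto simp: prime_idl_def intro: ideal_multL elim!: set_times_elim)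
    then have "?Y ^ Suc r \<subseteq> P'" using exact idl.span_minimal prime_subspace[OF P'(1)] by blast
    then have "?Y \<subseteq> P'" using in_set_power[of _ ?Y "Suc r"] prime_power[OF P'(1)] by blast
    then have "1 \<in> pre P"
      using P' \<open>P' \<noteq> pre P\<close> prime_subspace[OF prime_pre[OF P]] by (intro Z.prime_maximal[of P']) auto
    then show False using prime_pre[OF P] by (simp add: prime_idl_def)
  qed
  have height: "prime_height R P = ereal (real (length xs))" if "primeideal P R" "I \<subseteq> P" for P
    using that xsY by (intro prime_height_eq[OF noeth regular] minimal) (auto simp: pre_def)
  have d: "d = length xs"
  proof -
    let ?S = "{p. primeideal p R \<and> I \<subseteq> p}"
    \<comment> \<open>Over the empty set the infimum would be infinite, against the finite height d.
      Over a nonempty one it is the infimum of the constant \<open>length xs\<close>.\<close>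
    have "?S \<noteq> {}"
    proof
      assume "?S = {}"
      then have "ideal_height R I = (INF p\<in>{}. prime_height R p)" unfolding ideal_height_def by (rule arg_cong)
      then show False using ht(1) by (simp add: top_ereal_def)
    qed
    then have "ideal_height R I = ereal (real (length xs))"
      unfolding ideal_height_def using height by (subst INF_cong[OF refl, of _ _ "\<lambda>_. ereal (real (length xs))"]) auto
    then show ?thesis using ht(1) by simp
  qed
  have xs_ne: "xs \<noteq> []" using d ht(2) by auto
  have creg: "Z.creg {} xs"
    unfolding Z.creg_nth Z.reg_def
  proof (intro allI impI)
    fix i z assume i: "i < length xs" and z: "xs ! i * z \<in> Z.cl ({} \<union> set (take i xs))"
    then obtain s where s: "s - 1 \<in> ?Y" "s * (xs ! i * z) \<in> idl.span (set (take i xs) \<union> ker)"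
      by (auto simp: Z.cl_def)
    then have "xs ! i * (s * z) \<in> idl.span (set (take i xs) \<union> ker)" by (simp add: mult.left_commute)
    then have "s * z \<in> idl.span (set (take i xs) \<union> ker)" by (rule regular[OF i])
    then show "z \<in> Z.cl ({} \<union> set (take i xs))" using s(1) by (auto simp: Z.cl_def)
  qed
  have K_carrier: "K \<subseteq> carrier R" using subfieldE(3)[OF K(1)] .
  obtain K' where K': "infinite K'" "Z.separated K'"
    using lift_infinite_subfield[OF K K_carrier] unfolding Z.separated_def by blast
  \<comment> \<open>If n times 1 were zero, the characteristic of the subfield would be positive and
    at most n, hence at most r.\<close>
  have char': "\<exists>w. w * of_nat n - 1 \<in> ker" if n: "0 < n" "n \<le> r" for n
  proof (rule subfield_inverse[OF K(1) K_carrier])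
    have sub: "subring K R" by (rule subfieldE(1)[OF K(1)])
    have "[m] \<cdot> \<one> \<in> K" for m :: nat
      by (induction m) (auto simp: subringE(2,3,7)[OF sub])
    moreover have "[n] \<cdot> \<one> \<noteq> \<zero>"
    proof
      assume zero: "[n] \<cdot> \<one> = \<zero>"
      have eq: "add_pow (R\<lparr>carrier := K\<rparr>) m x = add_pow R m x" for m :: nat and x
        by (simp add: add_pow_def nat_pow_def)
      let ?P = "\<lambda>m::nat. m > 0 \<and> [m] \<cdot>\<^bsub>R\<lparr>carrier := K\<rparr>\<^esub> \<one>\<^bsub>R\<lparr>carrier := K\<rparr>\<^esub> = \<zero>\<^bsub>R\<lparr>carrier := K\<rparr>\<^esub>"
      have "?P n" using zero n by (simp add: eq)
      then have "\<exists>m. ?P m" by blast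
      then have "ring_char (R\<lparr>carrier := K\<rparr>) = (LEAST m. ?P m)" unfolding ring_char_def by (rule if_P)
      moreover have "?P (LEAST m. ?P m)" by (rule LeastI) fact
      moreover have "(LEAST m. ?P m) \<le> n" by (rule Least_le) fact
      ultimately show False using char n(2) r_def by auto
    qed
    ultimately show "\<phi> (of_nat n) \<in> K - {\<zero>}" by (simp add: \<phi>_of_nat)
  qed
  have fr: "?Y ^ Suc r \<subseteq> Z.cl (set xs * ?Y ^ r)" using exact Z.span_in_cl by blast
  have rt: "r \<le> t" using t r_def by simp
  let ?pw = "(\<lambda>y. y ^ Suc t) ` set xs"
  \<comment> \<open>Both numerators of the colon ideals contain a power of (xs), so their closures
    are the ideals themselves.\<close>
  have cl1: "Z.cl (set xs ^ Suc t) = idl.span (set xs ^ Suc t \<union> ker)"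
    by (rule Z.cl_reduction_power[OF exact idl.span_superset])
  have "set xs ^ (length xs * t + 1) \<subseteq> idl.span ?pw"
    using span_power_pigeonhole[of xs "{}" t 1] by (simp add: set_times_def[of "{}"])
  then have cl2: "Z.cl ?pw = idl.span (?pw \<union> ker)" by (rule Z.cl_reduction_power[OF exact])
  note main = Z.core_eq_colon[OF K'(2,1) char' xsY xs_ne creg fr rt, unfolded cl1 cl2]
  have J_pow: "ideal_power R ?J (t + 1) = \<phi> ` idl.span (set xs ^ Suc t)" using image_power[of "set xs" "Suc t"] J by simp
  have I_pow: "ideal_power R I n = \<phi> ` idl.span (?Y ^ n)" for n using image_power[of ?Y n] Y by simp
  have img_pw: "\<phi> ` ?pw = set (map (\<lambda>a. a [^] (t + 1)) \<alpha>)"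
    unfolding xs[symmetric] set_map image_image by (simp only: \<phi>_power Suc_eq_plus1)
  have gen_pw: "genideal R (set (map (\<lambda>a. a [^] (t + 1)) \<alpha>)) = \<phi> ` idl.span ?pw"
    unfolding img_pw[symmetric] image_span ..
  have gen_sum: "genideal R (\<phi> ` idl.span (?Y ^ (d * t)) \<union> set (map (\<lambda>a. a [^] (t + 1)) \<alpha>)) =
      \<phi> ` idl.span (idl.span (?Y ^ (d * t)) \<union> ?pw)"
    unfolding image_span[of "_ \<union> _"] image_Un img_pw ..
  have eqI: "A = B" if "A \<subseteq> carrier R" "B \<subseteq> carrier R" "\<And>z. \<phi> z \<in> A \<longleftrightarrow> \<phi> z \<in> B" for A B
    using that \<phi>_surj by (metis subsetD subsetI subset_antisym)
  have colon_carrier: "ideal_colon R A B \<subseteq> carrier R" for A B by (auto simp: ideal_colon_def)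
  have core: "\<phi> z \<in> ideal_core R I \<longleftrightarrow> (\<forall>L. Z.reduction L \<longrightarrow> z \<in> L)" for z
  proof
    assume z: "\<phi> z \<in> ideal_core R I"
    show "\<forall>L. Z.reduction L \<longrightarrow> z \<in> L"
    proof (intro allI impI)
      fix L assume "Z.reduction L"
      then obtain n where L: "idl.subspace L" "ker \<subseteq> L" "L \<subseteq> ?Y" "?Y ^ Suc n \<subseteq> idl.span (L * ?Y ^ n \<union> ker)"
        by (auto simp: Z.reduction_def)
      have "is_reduction R (\<phi> ` L) I" by (rule reduction_image[OF Y L(1,3,4)])
      then have "\<phi> z \<in> \<phi> ` L" using z by (auto simp: ideal_core_def)
      then show "z \<in> L" using pre_image[OF L(1,2)] by (auto simp: pre_def)
    qed
  next
    assume z: "\<forall>L. Z.reduction L \<longrightarrow> z \<in> L"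
    show "\<phi> z \<in> ideal_core R I" unfolding ideal_core_def
    proof (rule InterI, clarify)
      fix L assume "is_reduction R L I"
      then obtain n where L: "ideal L R" "L \<subseteq> I" "ideal_power R I (Suc n) = L \<cdot> ideal_power R I n"
        by (auto simp: is_reduction_def)
      have "\<phi> ` idl.span (pre L) = L" unfolding span_pre[OF L(1)] by (rule image_pre_ideal[OF L(1)])
      from reduction_lift[OF this Y L(3)] have "?Y ^ Suc n \<subseteq> idl.span (pre L * ?Y ^ n \<union> ker)" .
      then have "Z.reduction (pre L)"
        using L subspace_pre[OF L(1)] ker_pre[OF L(1)] unfolding Z.reduction_def by (auto simp: pre_def)
      then show "\<phi> z \<in> L" using z by (auto simp: pre_def)
    qed
  qed
  show "ideal_core R I = ideal_colon R (ideal_power R ?J (t + 1)) (ideal_power R I t)"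
  proof (rule eqI)
    have "ideal_core R I \<subseteq> ?J" using red by (auto simp: ideal_core_def)
    then show "ideal_core R I \<subseteq> carrier R"
      using redJ(1) ideal.axioms(1) additive_subgroup.a_subset by blast
    show "\<phi> z \<in> ideal_core R I \<longleftrightarrow> \<phi> z \<in> ideal_colon R (ideal_power R ?J (t + 1)) (ideal_power R I t)" for z
      unfolding J_pow I_pow core colon_mem by (rule main(1))
  qed (rule colon_carrier)
  show "ideal_colon R (ideal_power R ?J (t + 1)) (ideal_power R I t) =
      ideal_colon R (genideal R (set (map (\<lambda>a. a [^] (t + 1)) \<alpha>))) (ideal_power R I (d * t))"
    by (rule eqI[OF colon_carrier colon_carrier]) (unfold J_pow I_pow gen_pw colon_mem d, rule main(2))
  show "ideal_colon R (genideal R (set (map (\<lambda>a. a [^] (t + 1)) \<alpha>))) (ideal_power R I (d * t)) =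
      ideal_colon R (genideal R (set (map (\<lambda>a. a [^] (t + 1)) \<alpha>)))
        (genideal R (ideal_power R I (d * t) \<union> set (map (\<lambda>a. a [^] (t + 1)) \<alpha>)))"
  proof (rule eqI[OF colon_carrier colon_carrier])
    \<comment> \<open>The generators added on the right of the colon lie in the ideal on its left,
      so every z multiplies them into it.\<close>
    fix z
    have "z * w \<in> idl.span (?pw \<union> ker)" if "w \<in> ?pw" for w
      using that by (intro idl.span_scale idl.span_base) simp
    moreover have "z * w \<in> idl.span (?pw \<union> ker)"
      if "\<forall>w\<in>?Y ^ (d * t). z * w \<in> idl.span (?pw \<union> ker)" "w \<in> idl.span (?Y ^ (d * t))" for w
      by (rule Z.mult_into_ideal[OF idl.subspace_span _ that(2)]) (use that(1) in blast)
    ultimately have "(\<forall>w\<in>?Y ^ (d * t). z * w \<in> idl.span (?pw \<union> ker)) \<longleftrightarrow>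
      (\<forall>w\<in>idl.span (?Y ^ (d * t)) \<union> ?pw. z * w \<in> idl.span (?pw \<union> ker))"
      using idl.span_base by blast
    then show "\<phi> z \<in> ideal_colon R (genideal R (set (map (\<lambda>a. a [^] (t + 1)) \<alpha>))) (ideal_power R I (d * t)) \<longleftrightarrow>
      \<phi> z \<in> ideal_colon R (genideal R (set (map (\<lambda>a. a [^] (t + 1)) \<alpha>)))
        (genideal R (ideal_power R I (d * t) \<union> set (map (\<lambda>a. a [^] (t + 1)) \<alpha>)))"
      unfolding gen_sum gen_pw I_pow colon_mem .
  qed
qed

end

theorem theorem2p3:
  fixes R :: "('a, 'b) ring_scheme" and K I :: "'a set" and \<alpha> :: "'a list" and d t :: nat
  assumes "cohen_macaulay R"
    and "subfield K R" and "infinite K"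
    and "ideal I R"
    and "krull_dim (R Quot I) = 0"
    and "ideal_height R I = ereal (real d)" and "d > 0"
    and "regular_sequence R \<alpha>"
    and "is_reduction R (genideal R (set \<alpha>)) I"
    and "ring_char (R\<lparr>carrier := K\<rparr>) = 0 \<or>
         ring_char (R\<lparr>carrier := K\<rparr>) > reduction_number R (genideal R (set \<alpha>)) I"
    and "t \<ge> reduction_number R (genideal R (set \<alpha>)) I"
  shows "ideal_core R I =
           ideal_colon R (ideal_power R (genideal R (set \<alpha>)) (t + 1)) (ideal_power R I t)
       \<and> ideal_colon R (ideal_power R (genideal R (set \<alpha>)) (t + 1)) (ideal_power R I t) =
           ideal_colon R (genideal R (set (map (\<lambda>a. a [^]\<^bsub>R\<^esub> (t + 1)) \<alpha>)))
             (ideal_power R I (d * t))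
       \<and> ideal_colon R (genideal R (set (map (\<lambda>a. a [^]\<^bsub>R\<^esub> (t + 1)) \<alpha>)))
             (ideal_power R I (d * t)) =
           ideal_colon R (genideal R (set (map (\<lambda>a. a [^]\<^bsub>R\<^esub> (t + 1)) \<alpha>)))
             (genideal R (ideal_power R I (d * t) \<union> set (map (\<lambda>a. a [^]\<^bsub>R\<^esub> (t + 1)) \<alpha>)))"
proof -
  interpret cring R using assms(1) by (simp add: cohen_macaulay_def)
  have noeth: "noetherian_ring R" using assms(1) by (simp add: cohen_macaulay_def)
  interpret presentation R "free_eval"
    by unfold_locales (auto simp: free_eval_closed free_eval_add free_eval_mult free_eval_one intro: free_eval_surj)
  show ?thesis using core_as_colon[OF noeth assms(2-)] by blast
qed

end
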